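(* Assume $\alpha>3$ and let $(\ell_N)_{N\ge1}$ be a sequence of positive integers with $\ell_N\to\infty$ and $\ell_N/N\to0$. Then for every nonempty proper subset $A\subsetneq\mathbb T_L$, $$\lim_{N\to\infty}N^{1+\alpha}\,\mathrm{Cap}_N\big(\mathscr E_N(A),\mathscr E_N(A^c)\big)=\frac{1}{\Gamma(\alpha)\,I_\alpha}\sum_{x\in A,\,y\notin A}\mathrm{Cap}(x,y)=\frac{1}{\Gamma(\alpha)\,I_\alpha}\,\frac{|A|\,(L-|A|)}{L}.$$
   Context: Fix an integer $L\ge2$ and let $\mathbb T_L=\mathbb Z/L\mathbb Z$. Fix $\alpha>0$; set $a(0)=1$, $a(n)=n^\alpha$ for $n\ge1$, $g(0)=0$ and $g(n)=a(n)/a(n-1)$ for $n\ge1$. For $N\ge1$ let $E_N=\{\eta\in\{0,1,2,\dots\}^{\mathbb T_L}:\sum_x\eta_x=N\}$. For $\eta$ with $\eta_x>0$, $\sigma^{x,y}\eta$ denotes the configuration obtained from $\eta$ by moving one particle from $x$ to $y$. The totally asymmetric zero range process on $E_N$ is the continuous-time Markov chain with generator $(\mathcal LF)(\eta)=\sum_{x\in\mathbb T_L}g(\eta_x)[F(\sigma^{x,x+1}\eta)-F(\eta)]$. Its invariant probability measure is $\mu_N(\eta)=W_N^{-1}\prod_{x}a(\eta_x)^{-1}$ with $W_N=\sum_{\zeta\in E_N}\prod_x a(\zeta_x)^{-1}$. Write $\langle\cdot,\cdot\rangle_{\mu_N}$ for the inner product of $L^2(\mu_N)$ and $D_N(F)=\frac12\sum_{x\in\mathbb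 T_L}\sum_{\eta\in E_N}\mu_N(\eta)g(\eta_x)[F(\sigma^{x,x+1}\eta)-F(\eta)]^2$ for the Dirichlet form. For disjoint nonempty $\mathscr A,\mathscr B\subset E_N$, let $V_{\mathscr A,\mathscr B}$ be the function on $E_N$ equal to $1$ on $\mathscr A$, $0$ on $\mathscr B$, and $V(\eta)=\mathbf P_\eta[H_{\mathscr A}<H_{\mathscr B}]$ otherwise (the unique function with these boundary values satisfying $\mathcal LV=0$ off $\mathscr A\cup\mathscr B$), where $H$ denotes hitting times of the process; the capacity is $\mathrm{Cap}_N(\mathscr A,\mathscr B)=D_N(V_{\mathscr A,\mathscr B})$. Constants: $\Gamma(\alpha):=\sum_{j\ge0}1/a(j)$ (this is not Euler's Gamma function) and $I_\alpha:=\int_0^1u^\alpha(1-u)^\alpha\,du$. $\mathrm{Cap}(x,y)$, $x\neq y$, denotes the capacity between $x$ and $y$ of the rate-one totally asymmetric random walk on $\mathbb T_L$ jumping $z\to z+1$, with respect to the uniform measure; it equals $1/L$. Given $(\ell_N)$, set $\mathscr E^x_N=\{\eta\in E_N:\eta_x\ge N-\ell_N\}$ for $x\in\mathbb T_L$ and $\mathscr E_N(A)=\bigcup_{x\in A}\mathscr E^x_N$ for $A\subset\mathbb T_L$ (these sets are pairwise disjoint for $N$ large). *)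

theory Defs
  imports "HOL-Analysis.Analysis"
begin

text \<open>The torus T_L is represented by the sites {0..<L}; the successor of x is (x+1) mod L.
  Configurations are functions nat \<Rightarrow> nat vanishing outside {0..<L}.\<close>

definition zrp_a :: "real \<Rightarrow> nat \<Rightarrow> real" where
  "zrp_a \<alpha> n = (if n = 0 then 1 else real n powr \<alpha>)"

definition zrp_g :: "real \<Rightarrow> nat \<Rightarrow> real" where
  "zrp_g \<alpha> n = (if n = 0 then 0 else zrp_a \<alpha> n / zrp_a \<alpha> (n - 1))"

definition config_space :: "nat \<Rightarrow> nat \<Rightarrow> (nat \<Rightarrow> nat) set" where
  "config_space L N = {\<eta>. (\<forall>x. L \<le> x \<longrightarrow> \<eta> x = 0) \<and> (\<Sum>x<L. \<eta> x) = N}"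

text \<open>sigma^{x,y} eta: move one particle from x to y (used only when eta x > 0).\<close>
definition move :: "nat \<Rightarrow> nat \<Rightarrow> (nat \<Rightarrow> nat) \<Rightarrow> (nat \<Rightarrow> nat)" where
  "move x y \<eta> = (\<eta>(x := \<eta> x - 1))(y := (\<eta>(x := \<eta> x - 1)) y + 1)"

definition zrp_gen :: "nat \<Rightarrow> real \<Rightarrow> ((nat \<Rightarrow> nat) \<Rightarrow> real) \<Rightarrow> (nat \<Rightarrow> nat) \<Rightarrow> real" where
  "zrp_gen L \<alpha> F \<eta> = (\<Sum>x<L. zrp_g \<alpha> (\<eta> x) * (F (move x ((x + 1) mod L) \<eta>) - F \<eta>))"

definition zrp_W :: "nat \<Rightarrow> real \<Rightarrow> nat \<Rightarrow> real" where
  "zrp_W L \<alpha> N = (\<Sum>\<zeta>\<in>config_space L N. \<Prod>x<L. 1 / zrp_a \<alpha> (\<zeta> x))"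

definition zrp_mu :: "nat \<Rightarrow> real \<Rightarrow> nat \<Rightarrow> (nat \<Rightarrow> nat) \<Rightarrow> real" where
  "zrp_mu L \<alpha> N \<eta> = (\<Prod>x<L. 1 / zrp_a \<alpha> (\<eta> x)) / zrp_W L \<alpha> N"

definition zrp_dirichlet :: "nat \<Rightarrow> real \<Rightarrow> nat \<Rightarrow> ((nat \<Rightarrow> nat) \<Rightarrow> real) \<Rightarrow> real" where
  "zrp_dirichlet L \<alpha> N F = 1/2 * (\<Sum>x<L. \<Sum>\<eta>\<in>config_space L N.
      zrp_mu L \<alpha> N \<eta> * zrp_g \<alpha> (\<eta> x) * (F (move x ((x + 1) mod L) \<eta>) - F \<eta>)\<^sup>2)"

definition eq_pot :: "'s set \<Rightarrow> (('s \<Rightarrow> real) \<Rightarrow> 's \<Rightarrow> real) \<Rightarrow> 's set \<Rightarrow> 's set \<Rightarrow> 's \<Rightarrow> real" where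
  "eq_pot S gen A B = (THE V. (\<forall>x\<in>A. V x = 1) \<and> (\<forall>x\<in>B. V x = 0)
      \<and> (\<forall>x\<in>S - (A \<union> B). gen V x = 0) \<and> (\<forall>x. x \<notin> S \<longrightarrow> V x = 0))"

definition zrp_cap :: "nat \<Rightarrow> real \<Rightarrow> nat \<Rightarrow> (nat \<Rightarrow> nat) set \<Rightarrow> (nat \<Rightarrow> nat) set \<Rightarrow> real" where
  "zrp_cap L \<alpha> N A B = zrp_dirichlet L \<alpha> N (eq_pot (config_space L N) (zrp_gen L \<alpha>) A B)"

definition rw_gen :: "nat \<Rightarrow> (nat \<Rightarrow> real) \<Rightarrow> nat \<Rightarrow> real" where
  "rw_gen L V z = V ((z + 1) mod L) - V z"

definition rw_dirichlet :: "nat \<Rightarrow> (nat \<Rightarrow> real) \<Rightarrow> real" where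
  "rw_dirichlet L V = 1/2 * (\<Sum>z<L. (1 / real L) * (V ((z + 1) mod L) - V z)\<^sup>2)"

definition rw_cap :: "nat \<Rightarrow> nat \<Rightarrow> nat \<Rightarrow> real" where
  "rw_cap L x y = rw_dirichlet L (eq_pot {..<L} (rw_gen L) {x} {y})"

definition Gamma_const :: "real \<Rightarrow> real" where
  "Gamma_const \<alpha> = (\<Sum>j. 1 / zrp_a \<alpha> j)"

definition I_const :: "real \<Rightarrow> real" where
  "I_const \<alpha> = integral {0..1} (\<lambda>u::real. u powr \<alpha> * (1 - u) powr \<alpha>)"

definition well :: "nat \<Rightarrow> nat \<Rightarrow> (nat \<Rightarrow> nat) \<Rightarrow> nat \<Rightarrow> (nat \<Rightarrow> nat) set" where
  "well L N ell x = {\<eta> \<in> config_space L N. \<eta> x \<ge> N - ell N}"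

definition wells :: "nat \<Rightarrow> nat \<Rightarrow> (nat \<Rightarrow> nat) \<Rightarrow> nat set \<Rightarrow> (nat \<Rightarrow> nat) set" where
  "wells L N ell A = (\<Union>x\<in>A. well L N ell x)"

end

theory Submission
  imports Defs
begin

text \<open>
  Every configuration with \<open>N\<close> particles and a particle at \<open>x\<close> is \<open>\<xi> + \<delta>\<^sub>x\<close> with \<open>\<xi>\<close> of \<open>N - 1\<close> particles,
  and \<open>\<mu>(\<xi> + \<delta>\<^sub>x) g(\<xi>\<^sub>x + 1)\<close> is a product weight of \<open>\<xi>\<close> not depending on \<open>x\<close>. Hence, for the
  equilibrium potential \<open>V\<close> and any \<open>F\<close> that is nearly 1 on the first set and nearly 0 on the second,
  the capacity is, up to a small relative error, the weighted sum over \<open>\<xi>\<close> of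
  \<open>\<Sum>\<^sub>z F(\<xi> + \<delta>\<^sub>z) (V(\<xi> + \<delta>\<^sub>z) - V(\<xi> + \<delta>\<^bsub>z+1\<^esub>))\<close>. About \<open>V\<close> only \<open>0 \<le> V \<le> 1\<close> and its boundary
  values are used.

  \<open>F\<close> is the approximate equilibrium potential of the time-reversed process. If \<open>x \<in> A\<close> and \<open>y \<notin> A\<close> are the two most
  occupied sites, then \<open>F = H(M)\<close>, where \<open>M\<close> counts the particles from which the time-reversed walk reaches
  \<open>x\<close> before \<open>y\<close>, and \<open>H\<close> is harmonic for the two-site chain. Such an \<open>F\<close> makes the local flow equal
  to \<open>a(M) a(N - 1 - M) (V(\<xi> + \<delta>\<^sub>x) - V(\<xi> + \<delta>\<^sub>y))\<close> up to normalisation; the factor nearly cancels the weights of the two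
  large sites, so that for fixed occupation of the other sites the sum along the tube telescopes to
  \<open>1 - 0\<close>. If the two most occupied sites lie on the same side, then \<open>F\<close> is locally constant and there
  is no flow. What remains are configurations whose second and third largest occupation numbers are
  comparable, and their contribution vanishes for \<open>\<alpha> > 3\<close>.
\<close>

section \<open>Configurations\<close>

definition inc :: "nat \<Rightarrow> (nat \<Rightarrow> nat) \<Rightarrow> (nat \<Rightarrow> nat)" where
  "inc x \<xi> = \<xi>(x := Suc (\<xi> x))"

definition wt :: "nat \<Rightarrow> real \<Rightarrow> (nat \<Rightarrow> nat) \<Rightarrow> real" where
  "wt L \<alpha> \<xi> = (\<Prod>x<L. 1 / zrp_a \<alpha> (\<xi> x))"

lemma zrp_a_pos [simp]: "zrp_a \<alpha> n > 0"
  by (simp add: zrp_a_def)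

lemma zrp_a_nonneg [simp]: "zrp_a \<alpha> n \<ge> 0"
  using zrp_a_pos less_imp_le by blast

lemma zrp_a_nonzero [simp]: "zrp_a \<alpha> n \<noteq> 0"
  using zrp_a_pos[of \<alpha> n] by linarith

lemma zrp_a_eq: "n > 0 \<Longrightarrow> zrp_a \<alpha> n = real n powr \<alpha>"
  by (simp add: zrp_a_def)

lemma zrp_a_mono: "\<alpha> \<ge> 0 \<Longrightarrow> m \<le> n \<Longrightarrow> zrp_a \<alpha> m \<le> zrp_a \<alpha> n"
  by (auto simp: zrp_a_def intro: powr_mono2 ge_one_powr_ge_zero)

lemma wt_pos [simp]: "wt L \<alpha> \<xi> > 0"
  unfolding wt_def by (rule prod_pos) auto

lemma wt_nonneg [simp]: "wt L \<alpha> \<xi> \<ge> 0"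
  using wt_pos less_imp_le by blast

lemma config_space_le: "\<xi> \<in> config_space L n \<Longrightarrow> \<xi> z \<le> n"
  unfolding config_space_def
  by (cases "z < L") (auto intro: member_le_sum[of z "{..<L}" \<xi>])

lemma config_spaceD:
  assumes "\<xi> \<in> config_space L n"
  shows "z \<ge> L \<Longrightarrow> \<xi> z = 0" and "(\<Sum>z<L. \<xi> z) = n"
  using assms by (auto simp: config_space_def)

lemma finite_config_space [simp]: "finite (config_space L n)"
proof (rule finite_subset)
  show "config_space L n \<subseteq> {f. \<forall>x. (x \<in> {..<L} \<longrightarrow> f x \<in> {..n}) \<and> (x \<notin> {..<L} \<longrightarrow> f x = 0)}"
    using config_space_le by (auto simp: config_space_def)
  show "finite {f. \<forall>x. (x \<in> {..<L} \<longrightarrow> f x \<in> {..n}) \<and> (x \<notin> {..<L} \<longrightarrow> f x = (0::nat))}"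
    by (rule finite_set_of_finite_funs) auto
qed

lemma sum_inc:
  assumes "finite I"
  shows "(\<Sum>z\<in>I. inc x \<xi> z) = (\<Sum>z\<in>I. \<xi> z) + (if x \<in> I then 1 else 0)"
proof -
  have "(\<Sum>z\<in>I. inc x \<xi> z) = (\<Sum>z\<in>I. \<xi> z + (if x = z then 1 else 0))"
    by (rule sum.cong) (auto simp: inc_def)
  also have "\<dots> = (\<Sum>z\<in>I. \<xi> z) + (if x \<in> I then 1 else 0)"
    using assms by (simp add: sum.distrib sum.delta)
  finally show ?thesis .
qed

lemma inc_config: "x < L \<Longrightarrow> \<xi> \<in> config_space L n \<Longrightarrow> inc x \<xi> \<in> config_space L (Suc n)"
  using sum_inc[of "{..<L}" x \<xi>] by (auto simp: config_space_def) (auto simp: inc_def)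

lemma move_inc: "move x y (inc x \<xi>) = inc y \<xi>"
  by (simp add: move_def inc_def)

text \<open>Since \<open>a(n) = g(n) a(n - 1)\<close>, the jump rate cancels the factor brought in
  by the extra particle. What remains does not depend on \<open>x\<close>, which is the invariance
  of the product measure in local form.\<close>

lemma wt_inc:
  assumes "x < L"
  shows "wt L \<alpha> (inc x \<xi>) * zrp_g \<alpha> (inc x \<xi> x) = wt L \<alpha> \<xi>"
proof -
  have r: "(\<Prod>z\<in>{..<L} - {x}. 1 / zrp_a \<alpha> (inc x \<xi> z)) = (\<Prod>z\<in>{..<L} - {x}. 1 / zrp_a \<alpha> (\<xi> z))"
    by (rule prod.cong) (auto simp: inc_def)
  have "wt L \<alpha> (inc x \<xi>) = 1 / zrp_a \<alpha> (Suc (\<xi> x)) * (\<Prod>z\<in>{..<L} - {x}. 1 / zrp_a \<alpha> (\<xi> z))"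
    unfolding wt_def using assms by (subst prod.remove[of _ x]) (simp_all only: r, auto simp: inc_def)
  moreover have "wt L \<alpha> \<xi> = 1 / zrp_a \<alpha> (\<xi> x) * (\<Prod>z\<in>{..<L} - {x}. 1 / zrp_a \<alpha> (\<xi> z))"
    unfolding wt_def using assms by (subst prod.remove[of _ x]) auto
  ultimately show ?thesis
    by (simp add: zrp_g_def inc_def)
qed

text \<open>The substitution \<open>\<eta> = inc x \<xi>\<close> absorbs the jump rates into the weights.\<close>

lemma sum_config_inc:
  assumes "x < L"
  shows "(\<Sum>\<eta>\<in>config_space L (Suc n). wt L \<alpha> \<eta> * zrp_g \<alpha> (\<eta> x) * \<Psi> \<eta>)
       = (\<Sum>\<xi>\<in>config_space L n. wt L \<alpha> \<xi> * \<Psi> (inc x \<xi>))"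
proof -
  have "(\<Sum>\<eta>\<in>config_space L (Suc n). wt L \<alpha> \<eta> * zrp_g \<alpha> (\<eta> x) * \<Psi> \<eta>)
      = (\<Sum>\<eta>\<in>{\<eta>\<in>config_space L (Suc n). \<eta> x > 0}. wt L \<alpha> \<eta> * zrp_g \<alpha> (\<eta> x) * \<Psi> \<eta>)"
    by (rule sum.mono_neutral_right) (auto simp: zrp_g_def)
  also have "\<dots> = (\<Sum>\<xi>\<in>config_space L n. wt L \<alpha> \<xi> * \<Psi> (inc x \<xi>))"
  proof (rule sum.reindex_bij_witness[of _ "inc x" "\<lambda>\<eta>. \<eta>(x := \<eta> x - 1)"])
    fix \<eta> assume e: "\<eta> \<in> {\<eta>\<in>config_space L (Suc n). \<eta> x > 0}"
    show i: "inc x (\<eta>(x := \<eta> x - 1)) = \<eta>"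
      using e by (auto simp: inc_def)
    show "\<eta>(x := \<eta> x - 1) \<in> config_space L n"
      using e sum_inc[of "{..<L}" x "\<eta>(x := \<eta> x - 1)"] assms unfolding i
      by (auto simp: config_space_def)
    show "wt L \<alpha> (\<eta>(x := \<eta> x - 1)) * \<Psi> (inc x (\<eta>(x := \<eta> x - 1))) = wt L \<alpha> \<eta> * zrp_g \<alpha> (\<eta> x) * \<Psi> \<eta>"
      using wt_inc[OF assms, of \<alpha> "\<eta>(x := \<eta> x - 1)"] unfolding i by simp
  next
    fix \<xi> assume "\<xi> \<in> config_space L n"
    then show "inc x \<xi> \<in> {\<eta>\<in>config_space L (Suc n). \<eta> x > 0}"
      using inc_config assms by (auto simp: inc_def)
  qed (auto simp: inc_def)
  finally show ?thesis .
qed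

lemma zrp_W_eq: "zrp_W L \<alpha> N = (\<Sum>\<zeta>\<in>config_space L N. wt L \<alpha> \<zeta>)"
  by (simp add: zrp_W_def wt_def)

lemma zrp_mu_eq: "zrp_mu L \<alpha> N \<eta> = wt L \<alpha> \<eta> / zrp_W L \<alpha> N"
  by (simp add: zrp_mu_def wt_def)

lemma config_space_single:
  assumes "x < L"
  shows "(\<lambda>z. 0)(x := N) \<in> config_space L N"
proof -
  have "(\<Sum>z<L. if z = x then N else 0) = N"
    using assms by (subst sum.delta) auto
  then show ?thesis
    using assms by (auto simp: config_space_def fun_upd_def)
qed

lemma zrp_W_pos: "L > 0 \<Longrightarrow> zrp_W L \<alpha> N > 0"
  unfolding zrp_W_eq using config_space_single[of 0 L N]
  by (intro sum_pos) auto

section \<open>The Dirichlet form and the equilibrium potential\<close>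

text \<open>The configurations \<open>inc z \<xi>\<close> form a cycle of the dynamics on which all
  weighted rates equal \<open>wt L \<alpha> \<xi>\<close>. This is the share of that cycle in the
  bilinear form of \<open>F\<close> against minus the generator of \<open>V\<close>.\<close>

definition flow :: "nat \<Rightarrow> ((nat \<Rightarrow> nat) \<Rightarrow> real) \<Rightarrow> ((nat \<Rightarrow> nat) \<Rightarrow> real) \<Rightarrow> (nat \<Rightarrow> nat) \<Rightarrow> real" where
  "flow L F V \<xi> = (\<Sum>z<L. F (inc z \<xi>) * (V (inc z \<xi>) - V (inc ((z + 1) mod L) \<xi>)))"

lemma sum_gen_eq_flow:
  "(\<Sum>\<eta>\<in>config_space L (Suc n). wt L \<alpha> \<eta> * F \<eta> * zrp_gen L \<alpha> V \<eta>)
     = - (\<Sum>\<xi>\<in>config_space L n. wt L \<alpha> \<xi> * flow L F V \<xi>)"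
proof -
  have "(\<Sum>\<eta>\<in>config_space L (Suc n). wt L \<alpha> \<eta> * F \<eta> * zrp_gen L \<alpha> V \<eta>)
      = (\<Sum>x<L. \<Sum>\<eta>\<in>config_space L (Suc n).
           wt L \<alpha> \<eta> * zrp_g \<alpha> (\<eta> x) * (F \<eta> * (V (move x ((x + 1) mod L) \<eta>) - V \<eta>)))"
    unfolding zrp_gen_def sum_distrib_left by (subst sum.swap) (simp add: mult_ac)
  also have "\<dots> = (\<Sum>x<L. \<Sum>\<xi>\<in>config_space L n.
           wt L \<alpha> \<xi> * (F (inc x \<xi>) * (V (inc ((x + 1) mod L) \<xi>) - V (inc x \<xi>))))"
    by (rule sum.cong[OF refl], subst sum_config_inc) (auto simp: move_inc)
  also have "\<dots> = - (\<Sum>\<xi>\<in>config_space L n. wt L \<alpha> \<xi> * flow L F V \<xi>)"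
    unfolding flow_def sum_distrib_left
    by (subst sum.swap) (simp add: sum_negf[symmetric] algebra_simps)
  finally show ?thesis .
qed

lemma bij_betw_rotate:
  fixes L :: nat
  assumes "L > 0"
  shows "bij_betw (\<lambda>z. (z + 1) mod L) {..<L} {..<L}"
proof -
  have "z \<in> (\<lambda>z. (z + 1) mod L) ` {..<L}" if "z < L" for z
  proof (cases "z = 0")
    case True
    then show ?thesis using assms by (intro image_eqI[of _ _ "L - 1"]) auto
  next
    case False
    then show ?thesis using that by (intro image_eqI[of _ _ "z - 1"]) auto
  qed
  then have "(\<lambda>z. (z + 1) mod L) ` {..<L} = {..<L}"
    using assms by auto
  then show ?thesis
    by (simp add: bij_betw_def eq_card_imp_inj_on)
qed

lemma sum_rotate:
  fixes L :: nat
  assumes "L > 0"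
  shows "(\<Sum>z<L. f ((z + 1) mod L)) = (\<Sum>z<L. f z)"
  using sum.reindex_bij_betw[OF bij_betw_rotate[OF assms]] by simp

text \<open>\<open>a (a - b)\<close> is half of \<open>(a - b)^2\<close> plus half of
  \<open>a^2 - b^2\<close>, and the second part sums to zero around the cycle. Thus the
  nonreversible generator still yields the Dirichlet form.\<close>

lemma flow_self:
  assumes "L > 0"
  shows "flow L V V \<xi> = 1/2 * (\<Sum>z<L. (V (inc ((z + 1) mod L) \<xi>) - V (inc z \<xi>))\<^sup>2)"
proof -
  have "(\<Sum>z<L. (V (inc ((z + 1) mod L) \<xi>))\<^sup>2) = (\<Sum>z<L. (V (inc z \<xi>))\<^sup>2)"
    by (rule sum_rotate[OF assms])
  then show ?thesis
    unfolding flow_def power2_diff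
    by (simp add: sum.distrib sum_subtractf algebra_simps power2_eq_square sum_distrib_left)
qed

text \<open>The increments of \<open>V\<close> sum to zero around the cycle. Later estimates use
  this to subtract a constant from \<open>F\<close> first.\<close>

lemma flow_const:
  assumes "L > 0" "\<And>z. z < L \<Longrightarrow> F (inc z \<xi>) = c"
  shows "flow L F V \<xi> = 0"
proof -
  have "flow L F V \<xi> = c * (\<Sum>z<L. V (inc z \<xi>) - V (inc ((z + 1) mod L) \<xi>))"
    unfolding flow_def sum_distrib_left using assms by (intro sum.cong) auto
  also have "\<dots> = 0"
    using sum_rotate[OF assms(1), of "\<lambda>z. V (inc z \<xi>)"] by (simp add: sum_subtractf)
  finally show ?thesis .
qed

lemma dirichlet_eq_flow:
  assumes "L > 0"
  shows "zrp_dirichlet L \<alpha> (Suc n) V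
     = (\<Sum>\<xi>\<in>config_space L n. wt L \<alpha> \<xi> * flow L V V \<xi>) / zrp_W L \<alpha> (Suc n)"
proof -
  have "zrp_dirichlet L \<alpha> (Suc n) V = 1/2 * (\<Sum>x<L. (\<Sum>\<eta>\<in>config_space L (Suc n).
      wt L \<alpha> \<eta> * zrp_g \<alpha> (\<eta> x) * (V (move x ((x + 1) mod L) \<eta>) - V \<eta>)\<^sup>2) / zrp_W L \<alpha> (Suc n))"
    unfolding zrp_dirichlet_def zrp_mu_eq sum_divide_distrib by (simp add: field_simps)
  also have "\<dots> = 1/2 * (\<Sum>x<L. (\<Sum>\<xi>\<in>config_space L n.
      wt L \<alpha> \<xi> * (V (inc ((x + 1) mod L) \<xi>) - V (inc x \<xi>))\<^sup>2) / zrp_W L \<alpha> (Suc n))"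
    by (intro arg_cong2[where f = "(*)"] refl sum.cong, subst sum_config_inc) (auto simp: move_inc)
  also have "\<dots> = (\<Sum>\<xi>\<in>config_space L n. wt L \<alpha> \<xi> * flow L V V \<xi>) / zrp_W L \<alpha> (Suc n)"
    unfolding flow_self[OF assms] sum_divide_distrib[symmetric] sum_distrib_left
    by (subst sum.swap) (simp add: sum_distrib_left mult_ac)
  finally show ?thesis .
qed

lemma dirichlet_eq_gen:
  assumes "L > 0"
  shows "zrp_W L \<alpha> (Suc n) * zrp_dirichlet L \<alpha> (Suc n) V
     = - (\<Sum>\<eta>\<in>config_space L (Suc n). wt L \<alpha> \<eta> * V \<eta> * zrp_gen L \<alpha> V \<eta>)"
  using zrp_W_pos[OF assms, of \<alpha> "Suc n"]
  unfolding dirichlet_eq_flow[OF assms] sum_gen_eq_flow by simp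

section \<open>Uniqueness and existence of the equilibrium potential\<close>

text \<open>Energy argument: \<open>U\<close> times its generator vanishes everywhere, so every
  cycle has zero energy and \<open>U\<close> is constant on it; the cycles connect all
  configurations.\<close>

lemma harmonic_zero:
  assumes L: "L > 0" and ne: "\<A> \<noteq> {}" "\<A> \<subseteq> config_space L (Suc n)"
    and U: "\<And>\<eta>. \<eta> \<in> \<A> \<union> \<B> \<Longrightarrow> U \<eta> = 0"
    and h: "\<And>\<eta>. \<eta> \<in> config_space L (Suc n) - (\<A> \<union> \<B>) \<Longrightarrow> zrp_gen L \<alpha> U \<eta> = 0"
    and \<eta>: "\<eta> \<in> config_space L (Suc n)"
  shows "U \<eta> = 0"
proof -
  have nn: "wt L \<alpha> \<xi> * flow L U U \<xi> \<ge> 0" for \<xi>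
    unfolding flow_self[OF L] by (intro mult_nonneg_nonneg sum_nonneg) auto
  have "(\<Sum>\<eta>\<in>config_space L (Suc n). wt L \<alpha> \<eta> * U \<eta> * zrp_gen L \<alpha> U \<eta>) = 0"
    using U h by (intro sum.neutral) auto
  then have "(\<Sum>\<xi>\<in>config_space L n. wt L \<alpha> \<xi> * flow L U U \<xi>) = 0"
    unfolding sum_gen_eq_flow by simp
  then have "wt L \<alpha> \<xi> * flow L U U \<xi> = 0" if "\<xi> \<in> config_space L n" for \<xi>
    using sum_nonneg_eq_0_iff[of "config_space L n" "\<lambda>\<xi>. wt L \<alpha> \<xi> * flow L U U \<xi>"] nn that by simp
  then have fl: "flow L U U \<xi> = 0" if "\<xi> \<in> config_space L n" for \<xi>
    using that wt_pos[of L \<alpha> \<xi>] by (metis less_irrefl mult_eq_0_iff)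
  have step: "U (inc ((z + 1) mod L) \<xi>) = U (inc z \<xi>)" if "\<xi> \<in> config_space L n" "z < L" for \<xi> z
    using fl[OF that(1)] that(2) unfolding flow_self[OF L] by (simp add: sum_nonneg_eq_0_iff)
  have zero: "U (inc z \<xi>) = U (inc 0 \<xi>)" if "\<xi> \<in> config_space L n" "z < L" for \<xi> z
    using that(2)
  proof (induction z)
    case (Suc z)
    then show ?case using step[OF that(1), of z] by simp
  qed simp
  \<comment> \<open>All particles are brought to site 0 one by one, each move staying inside one
    cycle; the induction counts the particles still elsewhere.\<close>
  have const: "U \<eta> = U ((\<lambda>z. 0)(0 := Suc n))" if "\<eta> \<in> config_space L (Suc n)" for \<eta>
    using that
  proof (induction "Suc n - \<eta> 0" arbitrary: \<eta> rule: less_induct)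
    case less
    show ?case
    proof (cases "\<exists>z<L. z \<noteq> 0 \<and> \<eta> z > 0")
      case True
      then obtain z where z: "z < L" "z \<noteq> 0" "\<eta> z > 0" by blast
      define \<xi> where "\<xi> = \<eta>(z := \<eta> z - 1)"
      have i: "inc z \<xi> = \<eta>" using z by (auto simp: inc_def \<xi>_def)
      have x: "\<xi> \<in> config_space L n"
        using less.prems sum_inc[of "{..<L}" z \<xi>] z unfolding i by (auto simp: config_space_def \<xi>_def)
      have "inc 0 \<xi> 0 = Suc (\<eta> 0)" using z by (simp add: inc_def \<xi>_def)
      moreover have "inc 0 \<xi> \<in> config_space L (Suc n)" using inc_config L x by blast
      moreover have "\<eta> 0 < Suc n"
        using config_space_le[OF calculation(2), of 0] calculation(1) by simp
      ultimately have "U (inc 0 \<xi>) = U ((\<lambda>z. 0)(0 := Suc n))"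
        by (intro less.hyps) auto
      then show ?thesis using zero[OF x z(1)] i by simp
    next
      case False
      then have z: "\<eta> z = 0" if "z \<noteq> 0" for z
        using that config_spaceD(1)[OF less.prems, of z] by (cases "z < L") auto
      have "(\<Sum>z<L. \<eta> z) = (\<Sum>z<L. if z = 0 then \<eta> 0 else 0)"
        by (rule sum.cong) (auto simp: z)
      then have "\<eta> 0 = Suc n"
        using config_spaceD(2)[OF less.prems] L by (simp add: sum.delta)
      then have "\<eta> = (\<lambda>z. 0)(0 := Suc n)" using z by auto
      then show ?thesis by simp
    qed
  qed
  obtain \<zeta> where "\<zeta> \<in> \<A>" using ne by blast
  then show ?thesis using const[OF \<eta>] const[of \<zeta>] ne U[of \<zeta>] by auto
qed

text \<open>Existence is obtained from monotone iteration of the jump chain, started at the indicator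
  of \<open>\<A>\<close> and frozen on \<open>\<A> \<union> \<B>\<close>.\<close>

lemma harmonic_exists:
  assumes L: "L > 0" and AB: "\<A> \<union> \<B> \<subseteq> config_space L (Suc n)" "\<A> \<inter> \<B> = {}"
  shows "\<exists>V. (\<forall>\<eta>\<in>\<A>. V \<eta> = 1) \<and> (\<forall>\<eta>\<in>\<B>. V \<eta> = 0) \<and>
     (\<forall>\<eta>\<in>config_space L (Suc n) - (\<A> \<union> \<B>). zrp_gen L \<alpha> V \<eta> = 0) \<and>
     (\<forall>\<eta>. \<eta> \<notin> config_space L (Suc n) \<longrightarrow> V \<eta> = 0) \<and> (\<forall>\<eta>. 0 \<le> V \<eta> \<and> V \<eta> \<le> 1)"
proof -
  define S where "S = config_space L (Suc n)"
  define tot where "tot \<eta> = (\<Sum>x<L. zrp_g \<alpha> (\<eta> x))" for \<eta>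
  define P where "P V \<eta> = (if \<eta> \<in> S - (\<A> \<union> \<B>)
     then (\<Sum>x<L. zrp_g \<alpha> (\<eta> x) * V (move x ((x + 1) mod L) \<eta>)) / tot \<eta>
     else if \<eta> \<in> \<A> then 1 else 0)" for V :: "(nat \<Rightarrow> nat) \<Rightarrow> real" and \<eta>
  define v where "v k = (P ^^ k) (\<lambda>\<eta>. if \<eta> \<in> \<A> then 1 else 0)" for k
  have g0: "zrp_g \<alpha> m \<ge> 0" for m by (simp add: zrp_g_def)
  have tot: "tot \<eta> > 0" if "\<eta> \<in> S" for \<eta>
  proof -
    have "\<exists>x<L. \<eta> x > 0"
    proof (rule ccontr)
      assume "\<not> ?thesis"
      then have "(\<Sum>x<L. \<eta> x) = 0" by simp
      then show False using that config_spaceD(2)[of \<eta> L "Suc n"] by (simp add: S_def)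
    qed
    then obtain x where "x < L" "\<eta> x > 0" by blast
    then show ?thesis
      unfolding tot_def using g0 by (intro sum_pos2[of _ x]) (auto simp: zrp_g_def)
  qed
  have P01: "0 \<le> P V \<eta> \<and> P V \<eta> \<le> 1" if "\<And>\<eta>. 0 \<le> V \<eta> \<and> V \<eta> \<le> 1" for V \<eta>
  proof (cases "\<eta> \<in> S - (\<A> \<union> \<B>)")
    case True
    have "(\<Sum>x<L. zrp_g \<alpha> (\<eta> x) * V (move x ((x + 1) mod L) \<eta>)) \<le> tot \<eta>"
      unfolding tot_def using that g0 by (intro sum_mono) (simp add: mult_left_le)
    moreover have "(\<Sum>x<L. zrp_g \<alpha> (\<eta> x) * V (move x ((x + 1) mod L) \<eta>)) \<ge> 0"
      using that g0 by (intro sum_nonneg) simp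
    ultimately show ?thesis using True tot[of \<eta>] by (simp add: P_def)
  qed (auto simp: P_def)
  have Pmono: "P V \<eta> \<le> P V' \<eta>" if "\<And>\<eta>. V \<eta> \<le> V' \<eta>" for V V' \<eta>
    using that g0 tot[of \<eta>] unfolding P_def
    by (auto intro!: divide_right_mono sum_mono mult_left_mono)
  have v01: "0 \<le> v k \<eta> \<and> v k \<eta> \<le> 1" for k \<eta>
  proof (induction k arbitrary: \<eta>)
    case (Suc k)
    then show ?case using P01[of "v k"] by (simp add: v_def)
  qed (auto simp: v_def)
  have "v k \<eta> \<le> v (Suc k) \<eta>" for k \<eta>
  proof (induction k arbitrary: \<eta>)
    case 0
    have "0 \<le> P (v 0) \<eta>" using P01[of "v 0"] v01 by blast
    then show ?case using AB by (auto simp: v_def P_def)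
  next
    case (Suc k)
    then show ?case using Pmono[of "v k" "v (Suc k)"] by (simp add: v_def)
  qed
  then have inc: "incseq (\<lambda>k. v k \<eta>)" for \<eta> by (rule incseq_SucI)
  have "convergent (\<lambda>k. v k \<eta>)" for \<eta>
  proof (rule Bseq_monoseq_convergent)
    show "Bseq (\<lambda>k. v k \<eta>)"
      using v01[of _ \<eta>] by (intro BseqI'[of _ 1]) (simp add: abs_of_nonneg)
    show "monoseq (\<lambda>k. v k \<eta>)" using inc by (rule incseq_imp_monoseq)
  qed
  then obtain V where V: "\<And>\<eta>. (\<lambda>k. v k \<eta>) \<longlonglongrightarrow> V \<eta>"
    unfolding convergent_def by metis
  have fix_pt: "V \<eta> = P V \<eta>" for \<eta>
  proof (rule LIMSEQ_unique)
    show "(\<lambda>k. v (Suc k) \<eta>) \<longlonglongrightarrow> V \<eta>" using V[of \<eta>] by (rule LIMSEQ_Suc)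
    have "(\<lambda>k. P (v k) \<eta>) \<longlonglongrightarrow> P V \<eta>"
      using tot[of \<eta>] by (cases "\<eta> \<in> S - (\<A> \<union> \<B>)") (auto simp: P_def intro!: tendsto_intros V)
    then show "(\<lambda>k. v (Suc k) \<eta>) \<longlonglongrightarrow> P V \<eta>" by (simp add: v_def)
  qed
  have "zrp_gen L \<alpha> V \<eta> = 0" if "\<eta> \<in> S - (\<A> \<union> \<B>)" for \<eta>
  proof -
    have "V \<eta> * tot \<eta> = (\<Sum>x<L. zrp_g \<alpha> (\<eta> x) * V (move x ((x + 1) mod L) \<eta>))"
      using fix_pt[of \<eta>] that tot[of \<eta>] by (simp add: P_def)
    then show ?thesis
      by (simp add: zrp_gen_def tot_def right_diff_distrib sum_subtractf sum_distrib_left mult.commute)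
  qed
  moreover have "V \<eta> = 1" if "\<eta> \<in> \<A>" for \<eta> using fix_pt[of \<eta>] that by (simp add: P_def)
  moreover have "V \<eta> = 0" if "\<eta> \<in> \<B>" for \<eta> using fix_pt[of \<eta>] that AB by (auto simp: P_def)
  moreover have "V \<eta> = 0" if "\<eta> \<notin> S" for \<eta> using fix_pt[of \<eta>] that AB by (auto simp: P_def S_def)
  moreover have "0 \<le> V \<eta> \<and> V \<eta> \<le> 1" for \<eta>
    using V[of \<eta>] v01[of _ \<eta>] by (meson LIMSEQ_le_const LIMSEQ_le_const2)
  ultimately show ?thesis unfolding S_def by (intro exI[of _ V]) auto
qed

text \<open>The definite description is opened here once and for all. The bounds 0 and 1 come from
  the iteration that constructs a solution and pass to \<open>V\<close> by uniqueness.\<close>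

lemma eq_pot_zrp:
  fixes \<alpha> :: real
  assumes L: "L > 0" and ne: "\<A> \<noteq> {}"
    and AB: "\<A> \<union> \<B> \<subseteq> config_space L (Suc n)" "\<A> \<inter> \<B> = {}"
  defines "V \<equiv> eq_pot (config_space L (Suc n)) (zrp_gen L \<alpha>) \<A> \<B>"
  shows "\<And>\<eta>. \<eta> \<in> \<A> \<Longrightarrow> V \<eta> = 1" "\<And>\<eta>. \<eta> \<in> \<B> \<Longrightarrow> V \<eta> = 0"
    "\<And>\<eta>. \<eta> \<in> config_space L (Suc n) - (\<A> \<union> \<B>) \<Longrightarrow> zrp_gen L \<alpha> V \<eta> = 0"
    "\<And>\<eta>. 0 \<le> V \<eta>" "\<And>\<eta>. V \<eta> \<le> 1"
proof -
  let ?P = "\<lambda>V. (\<forall>\<eta>\<in>\<A>. V \<eta> = 1) \<and> (\<forall>\<eta>\<in>\<B>. V \<eta> = 0) \<and>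
     (\<forall>\<eta>\<in>config_space L (Suc n) - (\<A> \<union> \<B>). zrp_gen L \<alpha> V \<eta> = 0) \<and>
     (\<forall>\<eta>. \<eta> \<notin> config_space L (Suc n) \<longrightarrow> V \<eta> = 0)"
  obtain U where U: "?P U" "\<forall>\<eta>. 0 \<le> U \<eta> \<and> U \<eta> \<le> 1"
    using harmonic_exists[OF L AB, of \<alpha>] by blast
  have "T = U" if "?P T" for T
  proof
    fix \<eta>
    show "T \<eta> = U \<eta>"
    proof (cases "\<eta> \<in> config_space L (Suc n)")
      case True
      have gen: "zrp_gen L \<alpha> (\<lambda>\<eta>. T \<eta> - U \<eta>) \<zeta> = zrp_gen L \<alpha> T \<zeta> - zrp_gen L \<alpha> U \<zeta>" for \<zeta>
        unfolding zrp_gen_def by (simp add: sum_subtractf[symmetric] algebra_simps)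
      have "T \<eta> - U \<eta> = 0"
      proof (rule harmonic_zero[OF L ne _ _ _ True, where \<B> = \<B> and \<alpha> = \<alpha> and U = "\<lambda>\<eta>. T \<eta> - U \<eta>"])
        show "\<A> \<subseteq> config_space L (Suc n)" using AB by blast
        show "T \<zeta> - U \<zeta> = 0" if "\<zeta> \<in> \<A> \<union> \<B>" for \<zeta>
          using U(1) \<open>?P T\<close> that by (metis Un_iff diff_self)
        show "zrp_gen L \<alpha> (\<lambda>\<eta>. T \<eta> - U \<eta>) \<zeta> = 0"
          if "\<zeta> \<in> config_space L (Suc n) - (\<A> \<union> \<B>)" for \<zeta>
          unfolding gen using U(1) \<open>?P T\<close> that by (metis diff_self)
      qed
      then show ?thesis by simp
    next
      case False
      then show ?thesis using U(1) \<open>?P T\<close> by metis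
    qed
  qed
  then have VU: "V = U"
    unfolding V_def eq_pot_def by (rule the_equality[where P = ?P, OF U(1)])
  show "V \<eta> = 1" if "\<eta> \<in> \<A>" for \<eta> unfolding VU using U(1) that by blast
  show "V \<eta> = 0" if "\<eta> \<in> \<B>" for \<eta> unfolding VU using U(1) that by blast
  show "zrp_gen L \<alpha> V \<eta> = 0" if "\<eta> \<in> config_space L (Suc n) - (\<A> \<union> \<B>)" for \<eta>
    unfolding VU using U(1) that by blast
  show "0 \<le> V \<eta>" "V \<eta> \<le> 1" for \<eta> unfolding VU using U(2) by auto
qed

text \<open>Summation by parts against an arbitrary \<open>F\<close>: the signs of \<open>zrp_gen V\<close> on \<open>\<A>\<close> and on \<open>\<B>\<close>
  are known, and both carry total mass equal to the capacity, so boundary values of \<open>F\<close> that are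
  only approximately right cost a relative error.\<close>

lemma cap_flow_bound:
  fixes \<alpha> :: real
  assumes L: "L > 0" and ne: "\<A> \<noteq> {}"
    and AB: "\<A> \<union> \<B> \<subseteq> config_space L (Suc n)" "\<A> \<inter> \<B> = {}"
    and F: "\<And>\<eta>. \<eta> \<in> \<A> \<Longrightarrow> \<bar>F \<eta> - 1\<bar> \<le> \<epsilon>" "\<And>\<eta>. \<eta> \<in> \<B> \<Longrightarrow> \<bar>F \<eta>\<bar> \<le> \<epsilon>"
  defines "V \<equiv> eq_pot (config_space L (Suc n)) (zrp_gen L \<alpha>) \<A> \<B>"
  defines "C \<equiv> zrp_W L \<alpha> (Suc n) * zrp_cap L \<alpha> (Suc n) \<A> \<B>"
  shows "\<bar>(\<Sum>\<xi>\<in>config_space L n. wt L \<alpha> \<xi> * flow L F V \<xi>) - C\<bar> \<le> 2 * \<epsilon> * C"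
proof -
  let ?S = "config_space L (Suc n)"
  note V = eq_pot_zrp[OF L ne AB, where \<alpha> = \<alpha>, folded V_def]
  have g0: "zrp_g \<alpha> m \<ge> 0" for m by (simp add: zrp_g_def)
  have fin: "finite \<A>" "finite \<B>" using AB finite_subset[OF _ finite_config_space] by blast+
  have split: "(\<Sum>\<eta>\<in>?S. wt L \<alpha> \<eta> * G \<eta> * zrp_gen L \<alpha> V \<eta>) =
      (\<Sum>\<eta>\<in>\<A>. wt L \<alpha> \<eta> * G \<eta> * zrp_gen L \<alpha> V \<eta>) + (\<Sum>\<eta>\<in>\<B>. wt L \<alpha> \<eta> * G \<eta> * zrp_gen L \<alpha> V \<eta>)" for G
  proof -
    have "(\<Sum>\<eta>\<in>?S. wt L \<alpha> \<eta> * G \<eta> * zrp_gen L \<alpha> V \<eta>) = (\<Sum>\<eta>\<in>\<A> \<union> \<B>. wt L \<alpha> \<eta> * G \<eta> * zrp_gen L \<alpha> V \<eta>)"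
      using AB V(3) by (intro sum.mono_neutral_right) auto
    then show ?thesis using sum.union_disjoint[OF fin AB(2)] by simp
  qed
  have CA: "C = (\<Sum>\<eta>\<in>\<A>. wt L \<alpha> \<eta> * - zrp_gen L \<alpha> V \<eta>)"
    unfolding C_def zrp_cap_def V_def[symmetric] dirichlet_eq_gen[OF L] split
    using V(1,2) by (simp add: sum_negf[symmetric])
  \<comment> \<open>Testing against the constant 1 shows that the generator of \<open>V\<close> has
    total mass zero, so \<open>\<A>\<close> and \<open>\<B>\<close> carry opposite masses of size
    \<open>C\<close>.\<close>
  have "(\<Sum>\<eta>\<in>?S. wt L \<alpha> \<eta> * 1 * zrp_gen L \<alpha> V \<eta>) = 0"
    unfolding sum_gen_eq_flow using flow_const[OF L, of "\<lambda>_. 1"] by simp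
  then have CB: "C = (\<Sum>\<eta>\<in>\<B>. wt L \<alpha> \<eta> * zrp_gen L \<alpha> V \<eta>)"
    unfolding split CA by (simp add: sum_negf)
  have bnd: "\<bar>\<Sum>\<eta>\<in>X. c \<eta> * d \<eta>\<bar> \<le> (\<Sum>\<eta>\<in>X. c \<eta> * \<epsilon>)"
    if "\<And>\<eta>. \<eta> \<in> X \<Longrightarrow> c \<eta> \<ge> 0" "\<And>\<eta>. \<eta> \<in> X \<Longrightarrow> \<bar>d \<eta>\<bar> \<le> \<epsilon>"
    for X :: "(nat \<Rightarrow> nat) set" and c d
    using that by (intro order_trans[OF sum_abs] sum_mono) (simp add: abs_mult mult_left_mono)
  \<comment> \<open>\<open>V\<close> takes its maximum 1 on \<open>\<A>\<close> and its minimum 0 on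
    \<open>\<B>\<close>, which fixes the sign of the generator there.\<close>
  have gA: "zrp_gen L \<alpha> V \<eta> \<le> 0" if "\<eta> \<in> \<A>" for \<eta>
    unfolding zrp_gen_def using V(1)[OF that] V(5) g0 by (intro sum_nonpos) (simp add: mult_nonneg_nonpos)
  have gB: "zrp_gen L \<alpha> V \<eta> \<ge> 0" if "\<eta> \<in> \<B>" for \<eta>
    unfolding zrp_gen_def using V(2)[OF that] V(4) g0 by (intro sum_nonneg) simp
  have "(\<Sum>\<xi>\<in>config_space L n. wt L \<alpha> \<xi> * flow L F V \<xi>) - C
     = (\<Sum>\<eta>\<in>\<A>. wt L \<alpha> \<eta> * - zrp_gen L \<alpha> V \<eta> * (F \<eta> - 1)) - (\<Sum>\<eta>\<in>\<B>. wt L \<alpha> \<eta> * zrp_gen L \<alpha> V \<eta> * F \<eta>)"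
    using sum_gen_eq_flow[of L \<alpha> F V n, unfolded split] unfolding CA
    by (simp add: sum_subtractf algebra_simps sum_negf)
  moreover have "\<bar>\<Sum>\<eta>\<in>\<A>. wt L \<alpha> \<eta> * - zrp_gen L \<alpha> V \<eta> * (F \<eta> - 1)\<bar> \<le> (\<Sum>\<eta>\<in>\<A>. (wt L \<alpha> \<eta> * - zrp_gen L \<alpha> V \<eta>) * \<epsilon>)"
    by (rule bnd) (use F(1) gA in \<open>auto simp: mult_nonneg_nonpos\<close>)
  moreover have "\<bar>\<Sum>\<eta>\<in>\<B>. wt L \<alpha> \<eta> * zrp_gen L \<alpha> V \<eta> * F \<eta>\<bar> \<le> (\<Sum>\<eta>\<in>\<B>. (wt L \<alpha> \<eta> * zrp_gen L \<alpha> V \<eta>) * \<epsilon>)"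
    by (rule bnd) (use F(2) gB in auto)
  ultimately show ?thesis
    unfolding sum_distrib_right[symmetric] CA[symmetric] CB[symmetric]
    by (simp add: mult.commute mult.left_commute abs_le_iff)
qed

section \<open>Dominated convergence over occupation profiles\<close>

text \<open>Tannery's theorem with varying index sets: on a finite \<open>G\<close> carrying almost
  all of \<open>P\<close> the limit is taken termwise, outside it the majorant takes over. Main
  terms use \<open>c = 1\<close>, error terms \<open>c = 0\<close>.\<close>

lemma dominated_finite_sums:
  fixes h :: "nat \<Rightarrow> 'a \<Rightarrow> real"
  assumes p: "(p has_sum P) X" "\<And>\<kappa>. \<kappa> \<in> X \<Longrightarrow> p \<kappa> \<ge> 0"
    and S: "\<And>n. finite (S n)" "\<And>n. S n \<subseteq> X"
    and bound: "eventually (\<lambda>n. \<forall>\<kappa>\<in>S n. \<bar>h n \<kappa>\<bar> \<le> C * p \<kappa>) sequentially"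
    and lim: "\<And>\<kappa>. \<kappa> \<in> X \<Longrightarrow> (\<lambda>n. if \<kappa> \<in> S n then h n \<kappa> else 0) \<longlonglongrightarrow> c * p \<kappa>"
  shows "(\<lambda>n. \<Sum>\<kappa>\<in>S n. h n \<kappa>) \<longlonglongrightarrow> c * P"
proof (rule LIMSEQ_I)
  fix e :: real assume e: "e > 0"
  \<comment> \<open>Three errors must fit into \<open>e\<close>: \<open>d\<close> from the terms in
    \<open>G\<close>, \<open>\<bar>C\<bar> * d\<close> from the tail, and
    \<open>\<bar>c\<bar> * d\<close> from replacing \<open>P\<close> by
    \<open>sum p G\<close>.\<close>
  define d where "d = e / (2 * (2 + \<bar>c\<bar> + \<bar>C\<bar>))"
  have d: "d > 0" using e by (simp add: d_def)
  have de: "(1 + \<bar>c\<bar> + \<bar>C\<bar>) * d < e"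
  proof -
    have "(1 + \<bar>c\<bar> + \<bar>C\<bar>) * d \<le> (2 + \<bar>c\<bar> + \<bar>C\<bar>) * d" using d by simp
    also have "\<dots> = e / 2" by (simp add: d_def field_simps)
    finally show ?thesis using e by linarith
  qed
  obtain G where G: "finite G" "G \<subseteq> X" "dist (sum p G) P \<le> d"
    using has_sum_finite_approximation[OF p(1) d] by blast
  have tail: "sum p T \<le> d" if "finite T" "T \<subseteq> X - G" for T
  proof -
    have "sum p (G \<union> T) \<le> P"
      using that G p by (intro has_sum_mono2[OF has_sum_finite p(1)]) auto
    moreover have "sum p (G \<union> T) = sum p G + sum p T"
      using that G by (intro sum.union_disjoint) auto
    ultimately show ?thesis using G(3) by (simp add: dist_real_def)
  qed
  have "(\<lambda>n. \<Sum>\<kappa>\<in>G. if \<kappa> \<in> S n then h n \<kappa> else 0) \<longlonglongrightarrow> (\<Sum>\<kappa>\<in>G. c * p \<kappa>)"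
    using lim G by (intro tendsto_sum) auto
  then have "eventually (\<lambda>n. dist (\<Sum>\<kappa>\<in>G. if \<kappa> \<in> S n then h n \<kappa> else 0) (\<Sum>\<kappa>\<in>G. c * p \<kappa>) < d) sequentially"
    using d by (rule tendstoD)
  then have "eventually (\<lambda>n. norm ((\<Sum>\<kappa>\<in>S n. h n \<kappa>) - c * P) < e) sequentially"
    using bound
  proof eventually_elim
    case (elim n)
    have "(\<Sum>\<kappa>\<in>S n. h n \<kappa>) = (\<Sum>\<kappa>\<in>S n \<inter> G. h n \<kappa>) + (\<Sum>\<kappa>\<in>S n - G. h n \<kappa>)"
      using S(1) by (metis sum.Int_Diff)
    also have "(\<Sum>\<kappa>\<in>S n \<inter> G. h n \<kappa>) = (\<Sum>\<kappa>\<in>G. if \<kappa> \<in> S n then h n \<kappa> else 0)"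
      using G(1) by (subst Int_commute, subst sum.inter_restrict) auto
    finally have 1: "(\<Sum>\<kappa>\<in>S n. h n \<kappa>) = (\<Sum>\<kappa>\<in>G. if \<kappa> \<in> S n then h n \<kappa> else 0) + (\<Sum>\<kappa>\<in>S n - G. h n \<kappa>)" .
    have "\<bar>\<Sum>\<kappa>\<in>S n - G. h n \<kappa>\<bar> \<le> (\<Sum>\<kappa>\<in>S n - G. C * p \<kappa>)"
      using elim(2) by (intro order_trans[OF sum_abs] sum_mono) auto
    also have "\<dots> = C * sum p (S n - G)" by (simp add: sum_distrib_left)
    also have "\<dots> \<le> \<bar>C\<bar> * d"
      using tail[of "S n - G"] S p(2) by (intro mult_mono sum_nonneg) auto
    finally have 2: "\<bar>\<Sum>\<kappa>\<in>S n - G. h n \<kappa>\<bar> \<le> \<bar>C\<bar> * d" .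
    have "\<bar>c * sum p G - c * P\<bar> = \<bar>c\<bar> * dist (sum p G) P"
      by (simp add: dist_real_def abs_mult[symmetric] right_diff_distrib)
    also have "\<dots> \<le> \<bar>c\<bar> * d" using G(3) by (intro mult_left_mono) auto
    finally have 3: "\<bar>(\<Sum>\<kappa>\<in>G. c * p \<kappa>) - c * P\<bar> \<le> \<bar>c\<bar> * d" by (simp add: sum_distrib_left)
    show ?case
      using 1 2 3 elim(1) de unfolding dist_real_def real_norm_def by (simp add: algebra_simps)
  qed
  then show "\<exists>no. \<forall>n\<ge>no. norm ((\<Sum>\<kappa>\<in>S n. h n \<kappa>) - c * P) < e"
    by (simp add: eventually_sequentially)
qed

section \<open>Summation over occupation profiles\<close>

definition supported :: "nat set \<Rightarrow> (nat \<Rightarrow> nat) set" where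
  "supported I = {\<kappa>. \<forall>z. z \<notin> I \<longrightarrow> \<kappa> z = 0}"

lemma finite_supported_le:
  assumes "finite I"
  shows "finite {\<kappa>\<in>supported I. (\<Sum>z\<in>I. \<kappa> z) \<le> n}"
proof (rule finite_subset)
  have "\<kappa> x \<le> n" if "(\<Sum>z\<in>I. \<kappa> z) \<le> n" "x \<in> I" for \<kappa> :: "nat \<Rightarrow> nat" and x
    using that member_le_sum[OF that(2) _ assms, of \<kappa>] by simp
  then show "{\<kappa>\<in>supported I. (\<Sum>z\<in>I. \<kappa> z) \<le> n}
      \<subseteq> {f. \<forall>x. (x \<in> I \<longrightarrow> f x \<in> {..n}) \<and> (x \<notin> I \<longrightarrow> f x = 0)}"
    by (simp add: supported_def subset_iff)
  show "finite {f. \<forall>x. (x \<in> I \<longrightarrow> f x \<in> {..n}) \<and> (x \<notin> I \<longrightarrow> f x = (0::nat))}"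
    using assms by (rule finite_set_of_finite_funs) auto
qed

lemma summable_inverse_zrp_a:
  assumes "s > 1"
  shows "summable (\<lambda>j. 1 / zrp_a s j)"
proof -
  have "summable (\<lambda>j. real j powr (- s))"
    using assms by (simp add: summable_real_powr_iff)
  moreover have "eventually (\<lambda>j. real j powr (- s) = 1 / zrp_a s j) sequentially"
    using eventually_gt_at_top[of 0] by eventually_elim (simp add: zrp_a_eq powr_minus divide_inverse)
  ultimately show ?thesis
    using summable_cong[of "\<lambda>j. real j powr (- s)" "\<lambda>j. 1 / zrp_a s j"] by simp
qed

lemma Gamma_const_pos:
  assumes "s > 1"
  shows "Gamma_const s > 0"
  unfolding Gamma_const_def by (intro suminf_pos summable_inverse_zrp_a assms) auto

text \<open>This supplies the summable majorants and the limits of all later dominated convergence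
  arguments: the sites are independent, so the sum over profiles factorises.\<close>

lemma has_sum_profile_weight:
  assumes "s > 1" "finite I"
  shows "((\<lambda>\<kappa>. \<Prod>z\<in>I. 1 / zrp_a s (\<kappa> z)) has_sum Gamma_const s ^ card I) (supported I)"
proof -
  let ?p = "\<lambda>\<kappa>. \<Prod>z\<in>I. 1 / zrp_a s (\<kappa> z)"
  have 1: "(\<lambda>j. norm (1 / zrp_a s j)) summable_on UNIV"
    using summable_inverse_zrp_a[OF assms(1)]
    by (subst summable_on_UNIV_nonneg_real_iff) auto
  have "((\<lambda>j. 1 / zrp_a s j) has_sum Gamma_const s) UNIV"
    unfolding Gamma_const_def using summable_inverse_zrp_a[OF assms(1)]
    by (intro norm_summable_imp_has_sum) (auto intro: summable_sums)
  then have 2: "infsum (\<lambda>j. 1 / zrp_a s j) UNIV = Gamma_const s" by (rule infsumI)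
  have "infsum ?p (PiE I (\<lambda>_. UNIV)) = (\<Prod>z\<in>I. infsum (\<lambda>j. 1 / zrp_a s j) UNIV)"
    using assms 1 by (intro infsum_prod_PiE_abs) auto
  then have 3: "infsum ?p (PiE I (\<lambda>_. UNIV)) = Gamma_const s ^ card I" by (simp add: 2)
  \<comment> \<open>A non-summable family has \<open>infsum\<close> equal to the default 0, so a
    nonzero value proves summability.\<close>
  moreover have "Gamma_const s ^ card I \<noteq> 0" using Gamma_const_pos[OF assms(1)] by simp
  ultimately have "?p summable_on PiE I (\<lambda>_. UNIV)"
    using infsum_not_exists by metis
  then have "(?p has_sum Gamma_const s ^ card I) (PiE I (\<lambda>_. UNIV))"
    using 3 has_sum_infsum by metis
  moreover have "(?p has_sum Gamma_const s ^ card I) (PiE I (\<lambda>_. UNIV))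
      = (?p has_sum Gamma_const s ^ card I) (supported I)"
    by (rule has_sum_reindex_bij_witness[of _ "\<lambda>\<kappa>. restrict \<kappa> I" "\<lambda>f z. if z \<in> I then f z else 0"])
      (auto simp: supported_def restrict_def PiE_def extensional_def)
  ultimately show ?thesis by simp
qed

lemma wt_upd1:
  assumes "x < L"
  shows "wt L \<alpha> (\<kappa>(x := m)) = 1 / zrp_a \<alpha> m * (\<Prod>z\<in>{..<L} - {x}. 1 / zrp_a \<alpha> (\<kappa> z))"
  unfolding wt_def using assms by (subst prod.remove[of _ x]) auto

lemma wt_upd2:
  assumes "x < L" "y < L" "x \<noteq> y"
  shows "wt L \<alpha> (\<kappa>(x := m, y := m')) =
    1 / (zrp_a \<alpha> m * zrp_a \<alpha> m') * (\<Prod>z\<in>{..<L} - {x, y}. 1 / zrp_a \<alpha> (\<kappa> z))"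
proof -
  have "(\<Prod>z\<in>{..<L} - {y}. 1 / zrp_a \<alpha> ((\<kappa>(x := m)) z)) =
      1 / zrp_a \<alpha> m * (\<Prod>z\<in>{..<L} - {y} - {x}. 1 / zrp_a \<alpha> (\<kappa> z))"
    using assms by (subst prod.remove[of _ x]) auto
  moreover have "{..<L} - {y} - {x} = {..<L} - {x, y}" by auto
  ultimately show ?thesis using wt_upd1[OF assms(2), of \<alpha> "\<kappa>(x := m)" m'] by simp
qed

text \<open>Particles are conserved, so the occupation of \<open>x\<close> is what the other sites
  leave over; the natural subtraction is exact on the summation range.\<close>

lemma sum_config_profile1:
  assumes x: "x < L"
  defines "I \<equiv> {..<L} - {x}"
  shows "(\<Sum>\<xi> | \<xi> \<in> config_space L n \<and> P \<xi>. f \<xi>) =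
    (\<Sum>\<kappa> | \<kappa> \<in> supported I \<and> (\<Sum>z\<in>I. \<kappa> z) \<le> n \<and> P (\<kappa>(x := n - (\<Sum>z\<in>I. \<kappa> z))).
        f (\<kappa>(x := n - (\<Sum>z\<in>I. \<kappa> z))))"
proof -
  have I: "finite I" "x \<notin> I" "{..<L} = insert x I" using x by (auto simp: I_def)
  have upd: "(\<Sum>z\<in>I. (\<kappa>(x := m)) z) = (\<Sum>z\<in>I. \<kappa> z)" for \<kappa> and m :: nat
    using I by (intro sum.cong) auto
  have tot: "(\<Sum>z<L. \<kappa> z) = \<kappa> x + (\<Sum>z\<in>I. \<kappa> z)" for \<kappa> :: "nat \<Rightarrow> nat" using I by simp
  have eq: "\<xi>(x := n - (\<Sum>z\<in>I. \<xi> z)) = \<xi>" if "\<xi> \<in> config_space L n" for \<xi>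
    using that by (auto simp: config_space_def tot)
  show ?thesis
  proof (rule sum.reindex_bij_witness[of _ "\<lambda>\<kappa>. \<kappa>(x := n - (\<Sum>z\<in>I. \<kappa> z))" "\<lambda>\<xi>. \<xi>(x := 0)"])
    fix \<xi> assume "\<xi> \<in> {\<xi>. \<xi> \<in> config_space L n \<and> P \<xi>}"
    then have c: "\<xi> \<in> config_space L n" "P \<xi>" by auto
    show 1: "(\<xi>(x := 0))(x := n - (\<Sum>z\<in>I. (\<xi>(x := 0)) z)) = \<xi>"
      using eq[OF c(1)] unfolding upd by simp
    have "\<xi>(x := 0) \<in> supported I" "(\<Sum>z\<in>I. (\<xi>(x := 0)) z) \<le> n"
      using c(1) unfolding upd by (auto simp: config_space_def tot supported_def I_def)
    then show "\<xi>(x := 0) \<in> {\<kappa>. \<kappa> \<in> supported I \<and> (\<Sum>z\<in>I. \<kappa> z) \<le> n \<and> P (\<kappa>(x := n - (\<Sum>z\<in>I. \<kappa> z)))}"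
      unfolding mem_Collect_eq 1 using c(2) by blast
    show "f ((\<xi>(x := 0))(x := n - (\<Sum>z\<in>I. (\<xi>(x := 0)) z))) = f \<xi>"
      unfolding 1 ..
  next
    fix \<kappa> assume k: "\<kappa> \<in> {\<kappa>. \<kappa> \<in> supported I \<and> (\<Sum>z\<in>I. \<kappa> z) \<le> n \<and> P (\<kappa>(x := n - (\<Sum>z\<in>I. \<kappa> z)))}"
    have "\<kappa> x = 0" using k I by (simp add: supported_def)
    then show "(\<kappa>(x := n - (\<Sum>z\<in>I. \<kappa> z)))(x := 0) = \<kappa>" by auto
    show "\<kappa>(x := n - (\<Sum>z\<in>I. \<kappa> z)) \<in> {\<xi>. \<xi> \<in> config_space L n \<and> P \<xi>}"
      using k x by (simp add: config_space_def tot upd) (simp add: supported_def I_def)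
  qed
qed

text \<open>Two sites now share what the profile leaves over, with one free parameter
  \<open>m\<close>: the position along the tube from \<open>y\<close> to \<open>x\<close>.\<close>

lemma sum_config_profile2:
  assumes x: "x < L" "y < L" "x \<noteq> y"
  defines "I \<equiv> {..<L} - {x, y}"
  shows "(\<Sum>\<xi> | \<xi> \<in> config_space L n \<and> P \<xi>. f \<xi>) =
    (\<Sum>\<kappa> | \<kappa> \<in> supported I \<and> (\<Sum>z\<in>I. \<kappa> z) \<le> n.
      \<Sum>m | m + (\<Sum>z\<in>I. \<kappa> z) \<le> n \<and> P (\<kappa>(x := m, y := n - (\<Sum>z\<in>I. \<kappa> z) - m)).
        f (\<kappa>(x := m, y := n - (\<Sum>z\<in>I. \<kappa> z) - m)))"
proof -
  have I: "finite I" "x \<notin> I" "y \<notin> I" "{..<L} = insert x (insert y I)" using x by (auto simp: I_def)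
  have upd: "(\<Sum>z\<in>I. (\<kappa>(x := m, y := m')) z) = (\<Sum>z\<in>I. \<kappa> z)" for \<kappa> and m m' :: nat
    using I by (intro sum.cong) auto
  have tot: "(\<Sum>z<L. \<kappa> z) = \<kappa> x + \<kappa> y + (\<Sum>z\<in>I. \<kappa> z)" for \<kappa> :: "nat \<Rightarrow> nat" using I x by simp
  have eq: "\<xi>(x := \<xi> x, y := n - (\<Sum>z\<in>I. \<xi> z) - \<xi> x) = \<xi>" if "\<xi> \<in> config_space L n" for \<xi>
    using that by (auto simp: config_space_def tot)
  have fin: "finite {m. m + (\<Sum>z\<in>I. \<kappa> z) \<le> n \<and> P (\<kappa>(x := m, y := n - (\<Sum>z\<in>I. \<kappa> z) - m))}" for \<kappa>
    by (rule finite_subset[of _ "{..n}"]) auto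
  have "(\<Sum>\<xi> | \<xi> \<in> config_space L n \<and> P \<xi>. f \<xi>) =
    (\<Sum>(\<kappa>, m) \<in> (SIGMA \<kappa>:{\<kappa>. \<kappa> \<in> supported I \<and> (\<Sum>z\<in>I. \<kappa> z) \<le> n}.
       {m. m + (\<Sum>z\<in>I. \<kappa> z) \<le> n \<and> P (\<kappa>(x := m, y := n - (\<Sum>z\<in>I. \<kappa> z) - m))}).
        f (\<kappa>(x := m, y := n - (\<Sum>z\<in>I. \<kappa> z) - m)))"
  proof (rule sum.reindex_bij_witness[of _ "\<lambda>(\<kappa>, m). \<kappa>(x := m, y := n - (\<Sum>z\<in>I. \<kappa> z) - m)"
        "\<lambda>\<xi>. (\<xi>(x := 0, y := 0), \<xi> x)"])
    fix \<xi> assume "\<xi> \<in> {\<xi>. \<xi> \<in> config_space L n \<and> P \<xi>}"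
    then have c: "\<xi> \<in> config_space L n" "P \<xi>" by auto
    show 1: "(case (\<xi>(x := 0, y := 0), \<xi> x) of (\<kappa>, m) \<Rightarrow> \<kappa>(x := m, y := n - (\<Sum>z\<in>I. \<kappa> z) - m)) = \<xi>"
      using eq[OF c(1)] x unfolding prod.case upd by (simp add: fun_upd_twist)
    show "(\<xi>(x := 0, y := 0), \<xi> x) \<in> (SIGMA \<kappa>:{\<kappa>. \<kappa> \<in> supported I \<and> (\<Sum>z\<in>I. \<kappa> z) \<le> n}.
       {m. m + (\<Sum>z\<in>I. \<kappa> z) \<le> n \<and> P (\<kappa>(x := m, y := n - (\<Sum>z\<in>I. \<kappa> z) - m))})"
      using 1 c x by (auto simp: upd supported_def I_def[symmetric]) (auto simp: config_space_def tot I_def)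
    show "(case (\<xi>(x := 0, y := 0), \<xi> x) of (\<kappa>, m) \<Rightarrow> f (\<kappa>(x := m, y := n - (\<Sum>z\<in>I. \<kappa> z) - m))) = f \<xi>"
      using 1 by simp
  next
    fix b assume b: "b \<in> (SIGMA \<kappa>:{\<kappa>. \<kappa> \<in> supported I \<and> (\<Sum>z\<in>I. \<kappa> z) \<le> n}.
       {m. m + (\<Sum>z\<in>I. \<kappa> z) \<le> n \<and> P (\<kappa>(x := m, y := n - (\<Sum>z\<in>I. \<kappa> z) - m))})"
    obtain \<kappa> m where km: "b = (\<kappa>, m)" by (cases b)
    have k0: "\<kappa> x = 0" "\<kappa> y = 0" using b I by (auto simp: km supported_def)
    show "((case b of (\<kappa>, m) \<Rightarrow> \<kappa>(x := m, y := n - (\<Sum>z\<in>I. \<kappa> z) - m))(x := 0, y := 0),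
         (case b of (\<kappa>, m) \<Rightarrow> \<kappa>(x := m, y := n - (\<Sum>z\<in>I. \<kappa> z) - m)) x) = b"
      using k0 x by (auto simp: km)
    show "(case b of (\<kappa>, m) \<Rightarrow> \<kappa>(x := m, y := n - (\<Sum>z\<in>I. \<kappa> z) - m)) \<in> {\<xi>. \<xi> \<in> config_space L n \<and> P \<xi>}"
      using b x by (auto simp: km config_space_def tot upd) (auto simp: supported_def I_def)
  qed
  also have "\<dots> = (\<Sum>\<kappa> | \<kappa> \<in> supported I \<and> (\<Sum>z\<in>I. \<kappa> z) \<le> n.
      \<Sum>m | m + (\<Sum>z\<in>I. \<kappa> z) \<le> n \<and> P (\<kappa>(x := m, y := n - (\<Sum>z\<in>I. \<kappa> z) - m)).
        f (\<kappa>(x := m, y := n - (\<Sum>z\<in>I. \<kappa> z) - m)))"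
    using finite_supported_le[OF I(1)] fin by (subst sum.Sigma) auto
  finally show ?thesis .
qed

section \<open>Asymptotics of the normalising constants\<close>

lemma riemann_sum_tendsto_integral:
  fixes f :: "real \<Rightarrow> real"
  assumes cont: "continuous_on {0..1} f"
  shows "(\<lambda>n. (\<Sum>i<n. f (real i / real n)) / real n) \<longlonglongrightarrow> integral {0..1} f"
proof (rule LIMSEQ_I)
  fix e :: real assume e: "e > 0"
  have "uniformly_continuous_on {0..1} f"
    using cont by (rule compact_uniformly_continuous) auto
  then obtain d where d: "d > 0" "\<And>x y. x \<in> {0..1} \<Longrightarrow> y \<in> {0..1} \<Longrightarrow> dist y x < d \<Longrightarrow> dist (f y) (f x) < e / 2"
    using e unfolding uniformly_continuous_on_def by (metis half_gt_zero)
  obtain n0 :: nat where n0: "1 / d < real n0" using reals_Archimedean2 by blast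
  have "norm ((\<Sum>i<n. f (real i / real n)) / real n - integral {0..1} f) < e" if n: "n \<ge> Suc n0" for n
  proof -
    have n1: "1 / real n < d"
      using n n0 d(1) by (simp add: field_simps) (smt (verit) mult_left_mono of_nat_le_iff of_nat_Suc)
    have npos: "real n > 0" using n by simp
    have int: "f integrable_on {a..b}" if "0 \<le> a" "b \<le> 1" for a b
      using that cont by (intro integrable_continuous_real continuous_on_subset[OF cont]) auto
    \<comment> \<open>Uniform continuity costs at most \<open>e / 2\<close> times the cell length
      \<open>1 / n\<close> on each cell; adding the cells one at a time gives \<open>e / 2\<close>
      at \<open>k = n\<close>.\<close>
    have part: "\<bar>integral {0..real k / real n} f - (\<Sum>i<k. f (real i / real n)) / real n\<bar> \<le> real k * (e / (2 * real n))"
      if "k \<le> n" for k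
      using that
    proof (induction k)
      case (Suc k)
      let ?a = "real k / real n" and ?b = "real (Suc k) / real n"
      have ab: "0 \<le> ?a" "?a \<le> ?b" "?b \<le> 1" "?b - ?a = 1 / real n"
        using Suc.prems npos by (auto simp: field_simps)
      have 1: "integral {0..?a} f + integral {?a..?b} f = integral {0..?b} f"
        using ab int[of 0 ?b] by (intro Henstock_Kurzweil_Integration.integral_combine) auto
      have "integral {?a..?b} (\<lambda>u. f u - f ?a) = integral {?a..?b} f - f ?a * (?b - ?a)"
        using ab int[of ?a ?b] by (subst Henstock_Kurzweil_Integration.integral_diff) auto
      moreover have "norm (integral {?a..?b} (\<lambda>u. f u - f ?a)) \<le> e / 2 * (?b - ?a)"
      proof (rule integral_bound)
        show "continuous_on {?a..?b} (\<lambda>u. f u - f ?a)"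
          using ab by (intro continuous_intros continuous_on_subset[OF cont]) auto
        show "norm (f u - f ?a) \<le> e / 2" if u: "u \<in> {?a..?b}" for u
        proof -
          have "\<bar>u - ?a\<bar> \<le> ?b - ?a" using u unfolding atLeastAtMost_iff by linarith
          then have "dist u ?a < d" using n1 unfolding ab(4) dist_real_def by linarith
          moreover have "u \<in> {0..1}" "?a \<in> {0..1}" using u ab unfolding atLeastAtMost_iff by linarith+
          ultimately show ?thesis using d(2)[of ?a u] by (simp add: dist_real_def)
        qed
      qed (use ab in auto)
      ultimately have "\<bar>integral {?a..?b} f - f ?a / real n\<bar> \<le> e / (2 * real n)"
        unfolding ab(4) by simp
      then show ?case
        using Suc.IH Suc.prems 1 by (simp add: add_divide_distrib algebra_simps abs_le_iff)
    qed simp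
    show ?thesis using part[of n] npos e by (simp add: abs_minus_commute)
  qed
  then show "\<exists>no. \<forall>n\<ge>no. norm ((\<Sum>i<n. f (real i / real n)) / real n - integral {0..1} f) < e" by blast
qed

text \<open>The total resistance of the two-site chain: \<open>a(i) a(n - i)\<close> is the inverse
  weight of \<open>i\<close> and \<open>n - i\<close> particles on two sites. Suitably scaled it is
  a Riemann sum for \<open>I_const\<close>.\<close>

definition Zsum :: "real \<Rightarrow> nat \<Rightarrow> real" where
  "Zsum \<alpha> n = (\<Sum>i<Suc n. zrp_a \<alpha> i * zrp_a \<alpha> (n - i))"

lemma Zsum_pos: "Zsum \<alpha> n > 0"
  unfolding Zsum_def by (intro sum_pos) auto

lemma continuous_beta_integrand:
  assumes "\<alpha> > 0"
  shows "continuous_on {0..1} (\<lambda>u::real. u powr \<alpha> * (1 - u) powr \<alpha>)"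
  using assms by (intro continuous_intros continuous_on_powr') auto

lemma I_const_pos:
  assumes "\<alpha> > 0"
  shows "I_const \<alpha> > 0"
proof -
  let ?f = "\<lambda>u::real. u powr \<alpha> * (1 - u) powr \<alpha>"
  have "I_const \<alpha> \<noteq> 0"
  proof
    assume "I_const \<alpha> = 0"
    then have "\<forall>u\<in>{0..1}. ?f u = 0"
      unfolding I_const_def
      using integral_eq_0_iff[OF continuous_beta_integrand[OF assms]] by simp
    then have "?f (1/2) = 0" by (rule bspec) auto
    then show False by simp
  qed
  moreover have "I_const \<alpha> \<ge> 0"
    unfolding I_const_def using continuous_beta_integrand[OF assms]
    by (intro integral_nonneg integrable_continuous_real) auto
  ultimately show ?thesis by simp
qed

lemma Zsum_asymp:
  assumes "\<alpha> > 0"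
  shows "(\<lambda>n. Zsum \<alpha> n / real n powr (2 * \<alpha> + 1)) \<longlonglongrightarrow> I_const \<alpha>"
proof -
  let ?f = "\<lambda>u::real. u powr \<alpha> * (1 - u) powr \<alpha>"
  \<comment> \<open>Because \<open>a(0) = 1\<close> while \<open>0 powr \<alpha> = 0\<close>, the
    two end terms of \<open>Zsum\<close> are absent from the Riemann sum; each equals
    \<open>n powr \<alpha>\<close>, hence the correction.\<close>
  have "(\<lambda>n. 2 * real n powr (- \<alpha> - 1) + (\<Sum>i<n. ?f (real i / real n)) / real n) \<longlonglongrightarrow> 2 * 0 + integral {0..1} ?f"
  proof (intro tendsto_add tendsto_mult tendsto_const)
    show "(\<lambda>n. real n powr (- \<alpha> - 1)) \<longlonglongrightarrow> 0"
      using assms by (intro tendsto_neg_powr filterlim_real_sequentially) auto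
    show "(\<lambda>n. (\<Sum>i<n. ?f (real i / real n)) / real n) \<longlonglongrightarrow> integral {0..1} ?f"
      using assms by (intro riemann_sum_tendsto_integral continuous_beta_integrand)
  qed
  moreover have "eventually (\<lambda>n. 2 * real n powr (- \<alpha> - 1) + (\<Sum>i<n. ?f (real i / real n)) / real n
     = Zsum \<alpha> n / real n powr (2 * \<alpha> + 1)) sequentially"
    using eventually_gt_at_top[of 0]
  proof eventually_elim
    case (elim n)
    have t: "zrp_a \<alpha> i * zrp_a \<alpha> (n - i) = real n powr (2 * \<alpha>) * ?f (real i / real n) + (if i = 0 then real n powr \<alpha> else 0)"
      if "i < n" for i
    proof (cases "i = 0")
      case True
      then show ?thesis using elim by (simp add: zrp_a_def)
    next
      case False
      have "1 - real i / real n = real (n - i) / real n" using that by (simp add: field_simps of_nat_diff)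
      moreover have "real n powr (2 * \<alpha>) = real n powr \<alpha> * real n powr \<alpha>" by (simp add: powr_add[symmetric])
      ultimately show ?thesis using False that by (simp add: zrp_a_eq powr_divide)
    qed
    have "Zsum \<alpha> n = (\<Sum>i<n. real n powr (2 * \<alpha>) * ?f (real i / real n) + (if i = 0 then real n powr \<alpha> else 0)) + real n powr \<alpha>"
      unfolding Zsum_def sum.lessThan_Suc using t elim by (simp add: zrp_a_def)
    also have "\<dots> = real n powr (2 * \<alpha>) * (\<Sum>i<n. ?f (real i / real n)) + 2 * real n powr \<alpha>"
      using elim by (simp add: sum.distrib sum_distrib_left sum.delta)
    finally have Z: "Zsum \<alpha> n = real n powr (2 * \<alpha>) * (\<Sum>i<n. ?f (real i / real n)) + 2 * real n powr \<alpha>" .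
    have e1: "real n powr \<alpha> / real n powr (2 * \<alpha> + 1) = real n powr (- \<alpha> - 1)"
      by (simp add: powr_diff[symmetric])
    have e2: "real n powr (2 * \<alpha>) / real n powr (2 * \<alpha> + 1) = 1 / real n"
      using elim by (simp add: powr_add)
    have "Zsum \<alpha> n / real n powr (2 * \<alpha> + 1) = (real n powr (2 * \<alpha>) / real n powr (2 * \<alpha> + 1)) * (\<Sum>i<n. ?f (real i / real n))
        + 2 * (real n powr \<alpha> / real n powr (2 * \<alpha> + 1))"
      unfolding Z by (simp add: add_divide_distrib)
    then show ?case unfolding e1 e2 by simp
  qed
  ultimately show ?thesis
    unfolding I_const_def using Lim_transform_eventually by fastforce
qed

section \<open>The partition function of the invariant measure\<close>

lemma powr_ratio_tendsto_1:
  fixes k :: nat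
  assumes "\<alpha> \<ge> 0"
  shows "(\<lambda>n. real n powr \<alpha> / zrp_a \<alpha> (n - k)) \<longlonglongrightarrow> 1"
proof -
  have "(\<lambda>n. (1 + real k / real n) powr \<alpha>) \<longlonglongrightarrow> (1 + 0) powr \<alpha>"
    by (intro tendsto_intros tendsto_divide_0[OF tendsto_const] filterlim_real_at_infinity_sequentially) auto
  then have "(\<lambda>n. (1 + real k / real n) powr \<alpha>) \<longlonglongrightarrow> 1" by simp
  moreover have "eventually (\<lambda>n. (1 + real k / real n) powr \<alpha> = real (n + k) powr \<alpha> / zrp_a \<alpha> (n + k - k)) sequentially"
    using eventually_gt_at_top[of 0]
    by eventually_elim (auto simp: zrp_a_eq powr_divide[symmetric] add_divide_distrib add.commute)
  ultimately have "(\<lambda>n. real (n + k) powr \<alpha> / zrp_a \<alpha> (n + k - k)) \<longlonglongrightarrow> 1"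
    by (rule Lim_transform_eventually)
  then show ?thesis using LIMSEQ_offset[of "\<lambda>n. real n powr \<alpha> / zrp_a \<alpha> (n - k)" k 1] by simp
qed

lemma config_max_ge:
  assumes "\<xi> \<in> config_space L n" "\<And>y. y < L \<Longrightarrow> \<xi> y \<le> m"
  shows "n \<le> L * m"
proof -
  have "(\<Sum>y<L. \<xi> y) \<le> (\<Sum>y<L. m)" using assms(2) by (intro sum_mono) auto
  then show ?thesis using config_spaceD(2)[OF assms(1)] by simp
qed

text \<open>The most occupied site holds at least a fraction \<open>1 / L\<close> of the particles.
  This removes its weight from a sum uniformly in the profile of the other sites.\<close>

lemma inverse_zrp_a_bound:
  assumes "\<alpha> \<ge> 0" "n \<le> L * m" "n > 0"
  shows "real n powr \<alpha> / zrp_a \<alpha> m \<le> real L powr \<alpha>"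
proof -
  have m: "m > 0" using assms by (cases m) auto
  have "real n powr \<alpha> \<le> (real L * real m) powr \<alpha>"
    using assms by (intro powr_mono2) (auto simp flip: of_nat_mult)
  then show ?thesis using m by (simp add: zrp_a_eq powr_mult divide_le_eq)
qed

lemma ex_argmax:
  fixes f :: "'a \<Rightarrow> nat"
  assumes "finite B" "B \<noteq> {}"
  shows "\<exists>x\<in>B. \<forall>y\<in>B. f y \<le> f x"
  using Max_in[of "f ` B"] Max_ge[of "f ` B"] assms by fastforce

text \<open>The mass concentrates on configurations with all but finitely many particles at one of
  \<open>L\<close> sites. That site has weight about \<open>n powr (- \<alpha>)\<close>, and the
  other \<open>L - 1\<close> become independent in the limit.\<close>

lemma zrp_W_asymp:
  assumes "\<alpha> > 1" "L > 0"
  shows "(\<lambda>n. real n powr \<alpha> * zrp_W L \<alpha> n) \<longlonglongrightarrow> real L * Gamma_const \<alpha> ^ (L - 1)"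
proof -
  \<comment> \<open>The first of the most occupied sites: breaking ties by index assigns each
    configuration to exactly one site.\<close>
  define am where "am \<xi> x \<longleftrightarrow> x < L \<and> (\<forall>y<L. \<xi> y \<le> \<xi> x) \<and> (\<forall>y<x. \<xi> y < \<xi> x)" for \<xi> :: "nat \<Rightarrow> nat" and x
  have ex: "\<exists>!x. am \<xi> x" for \<xi>
  proof -
    define Q where "Q x \<longleftrightarrow> x < L \<and> (\<forall>y<L. \<xi> y \<le> \<xi> x)" for x
    define x where "x = (LEAST x. Q x)"
    obtain x0 where "Q x0"
      using ex_argmax[of "{..<L}" \<xi>] assms(2) by (auto simp: Q_def)
    then have x: "x < L \<and> (\<forall>y<L. \<xi> y \<le> \<xi> x)" "\<And>x'. x' < x \<Longrightarrow> \<not> Q x'"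
      using LeastI[of Q x0] not_less_Least[of _ Q] by (auto simp: x_def Q_def)
    have "\<xi> y < \<xi> x" if "y < x" for y
      using x(2)[OF that] x(1) that unfolding Q_def by (meson le_trans less_trans not_le)
    then have "am \<xi> x" using x by (simp add: am_def)
    moreover have "x' = x''" if "am \<xi> x'" "am \<xi> x''" for x' x''
      using that by (metis am_def leD linorder_neqE_nat)
    ultimately show ?thesis by blast
  qed
  have W: "zrp_W L \<alpha> n = (\<Sum>x<L. \<Sum>\<xi> | \<xi> \<in> config_space L n \<and> am \<xi> x. wt L \<alpha> \<xi>)" for n
  proof -
    have "(\<Sum>x<L. \<Sum>\<xi> | \<xi> \<in> config_space L n \<and> am \<xi> x. wt L \<alpha> \<xi>)
       = (\<Sum>x<L. \<Sum>\<xi>\<in>config_space L n. if am \<xi> x then wt L \<alpha> \<xi> else 0)"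
      by (simp add: sum.inter_filter)
    also have "\<dots> = (\<Sum>\<xi>\<in>config_space L n. \<Sum>x<L. if am \<xi> x then wt L \<alpha> \<xi> else 0)"
      by (rule sum.swap)
    also have "\<dots> = (\<Sum>\<xi>\<in>config_space L n. wt L \<alpha> \<xi>)"
    proof (rule sum.cong[OF refl])
      fix \<xi>
      obtain x where x: "am \<xi> x" using ex by blast
      then have "(\<Sum>x<L. if am \<xi> x then wt L \<alpha> \<xi> else 0) = (\<Sum>x'<L. if x' = x then wt L \<alpha> \<xi> else 0)"
        using ex by (intro sum.cong) auto
      then show "(\<Sum>x<L. if am \<xi> x then wt L \<alpha> \<xi> else 0) = wt L \<alpha> \<xi>"
        using x by (simp add: am_def)
    qed
    finally show ?thesis by (simp add: zrp_W_eq)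
  qed
  have "(\<lambda>n. \<Sum>\<xi> | \<xi> \<in> config_space L n \<and> am \<xi> x. real n powr \<alpha> * wt L \<alpha> \<xi>) \<longlonglongrightarrow> 1 * Gamma_const \<alpha> ^ (L - 1)"
    if x: "x < L" for x
  proof -
    define I where "I = {..<L} - {x}"
    have I: "finite I" "card I = L - 1" using x by (auto simp: I_def)
    let ?k = "\<lambda>\<kappa>. (\<Sum>z\<in>I. \<kappa> z) :: nat"
    let ?p = "\<lambda>\<kappa>. \<Prod>z\<in>I. 1 / zrp_a \<alpha> (\<kappa> z)"
    define S where "S n = {\<kappa>. \<kappa> \<in> supported I \<and> ?k \<kappa> \<le> n \<and> am (\<kappa>(x := n - ?k \<kappa>)) x}" for n
    define h where "h n \<kappa> = real n powr \<alpha> / zrp_a \<alpha> (n - ?k \<kappa>) * ?p \<kappa>" for n \<kappa>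
    have "(\<lambda>n. \<Sum>\<kappa>\<in>S n. h n \<kappa>) \<longlonglongrightarrow> 1 * Gamma_const \<alpha> ^ card I"
    proof (rule dominated_finite_sums[OF has_sum_profile_weight[OF assms(1) I(1)], where C = "real L powr \<alpha>"])
      show "finite (S n)" for n
        by (rule finite_subset[OF _ finite_supported_le[OF I(1), of n]]) (auto simp: S_def)
      show "eventually (\<lambda>n. \<forall>\<kappa>\<in>S n. \<bar>h n \<kappa>\<bar> \<le> real L powr \<alpha> * ?p \<kappa>) sequentially"
        using eventually_gt_at_top[of 0]
      proof eventually_elim
        case (elim n)
        show ?case
        proof
          fix \<kappa> assume k: "\<kappa> \<in> S n"
          let ?\<xi> = "\<kappa>(x := n - ?k \<kappa>)"
          have "(\<Sum>z<L. ?\<xi> z) = (n - ?k \<kappa>) + ?k \<kappa>"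
            using x by (subst sum.remove[of _ x]) (auto simp: I_def intro!: sum.cong)
          then have "?\<xi> \<in> config_space L n"
            using k x by (auto simp: config_space_def S_def supported_def I_def)
          then have "n \<le> L * (n - ?k \<kappa>)"
            using k by (intro config_max_ge) (auto simp: S_def am_def split: if_splits)
          then have "real n powr \<alpha> / zrp_a \<alpha> (n - ?k \<kappa>) \<le> real L powr \<alpha>"
            using assms elim by (intro inverse_zrp_a_bound) auto
          moreover have p0: "?p \<kappa> \<ge> 0" by (intro prod_nonneg) auto
          ultimately have "h n \<kappa> \<le> real L powr \<alpha> * ?p \<kappa>"
            unfolding h_def by (rule mult_right_mono)
          moreover have "h n \<kappa> \<ge> 0" unfolding h_def using p0 by (intro mult_nonneg_nonneg) auto
          ultimately show "\<bar>h n \<kappa>\<bar> \<le> real L powr \<alpha> * ?p \<kappa>" by simp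
        qed
      qed
      show "(\<lambda>n. if \<kappa> \<in> S n then h n \<kappa> else 0) \<longlonglongrightarrow> 1 * ?p \<kappa>" if "\<kappa> \<in> supported I" for \<kappa>
      proof -
        have "(\<lambda>n. h n \<kappa>) \<longlonglongrightarrow> 1 * ?p \<kappa>"
          unfolding h_def using assms by (intro tendsto_mult powr_ratio_tendsto_1 tendsto_const) auto
        moreover have "eventually (\<lambda>n. h n \<kappa> = (if \<kappa> \<in> S n then h n \<kappa> else 0)) sequentially"
          \<comment> \<open>More than half of the particles then sit at \<open>x\<close>, which is
            therefore the strict maximum.\<close>
          using eventually_gt_at_top[of "2 * ?k \<kappa>"]
        proof eventually_elim
          case (elim n)
          have "\<kappa> y \<le> ?k \<kappa>" if "y \<in> I" for y using that I(1) by (intro member_le_sum) auto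
          then have "\<kappa> y < n - ?k \<kappa>" if "y < L" "y \<noteq> x" for y
            using that elim I_def by fastforce
          then have "\<kappa> \<in> S n" using elim that x by (auto simp: S_def am_def intro: less_imp_le)
          then show ?case by simp
        qed
        ultimately show ?thesis by (rule Lim_transform_eventually)
      qed
    qed (auto simp: S_def intro!: prod_nonneg)
    moreover have "(\<Sum>\<xi> | \<xi> \<in> config_space L n \<and> am \<xi> x. real n powr \<alpha> * wt L \<alpha> \<xi>) = (\<Sum>\<kappa>\<in>S n. h n \<kappa>)" for n
      unfolding sum_config_profile1[OF x] I_def[symmetric] S_def h_def
      by (intro sum.cong refl) (simp add: wt_upd1[OF x] I_def)
    ultimately show ?thesis using I by simp
  qed
  then have "(\<lambda>n. \<Sum>x<L. \<Sum>\<xi> | \<xi> \<in> config_space L n \<and> am \<xi> x. real n powr \<alpha> * wt L \<alpha> \<xi>)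
      \<longlonglongrightarrow> (\<Sum>x<L. 1 * Gamma_const \<alpha> ^ (L - 1))"
    by (intro tendsto_sum) auto
  then show ?thesis
    unfolding W sum_distrib_left by simp
qed

text \<open>The product \<open>p m * q m\<close> need not be monotone, but its variation is at most
  \<open>Q\<close> times that of \<open>p\<close> plus \<open>P\<close> times that of
  \<open>q\<close>. Summation by parts gives two boundary and two variation terms, each at most
  \<open>P * Q - 1\<close>.\<close>

lemma abel_sum_bound:
  fixes p q v :: "nat \<Rightarrow> real"
  assumes "lo \<le> hi"
    and p: "\<And>m. lo \<le> m \<Longrightarrow> m < hi \<Longrightarrow> p (Suc m) \<le> p m" "\<And>m. m \<in> {lo..hi} \<Longrightarrow> 1 \<le> p m \<and> p m \<le> P"
    and q: "\<And>m. lo \<le> m \<Longrightarrow> m < hi \<Longrightarrow> q m \<le> q (Suc m)" "\<And>m. m \<in> {lo..hi} \<Longrightarrow> 1 \<le> q m \<and> q m \<le> Q"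
    and v: "\<And>m. 0 \<le> v m \<and> v m \<le> 1"
  shows "\<bar>(\<Sum>m=lo..hi. p m * q m * (v (Suc m) - v m)) - (v (Suc hi) - v lo)\<bar> \<le> 4 * (P * Q - 1)"
proof -
  define R where "R m = p m * q m - 1" for m
  have PQ: "1 \<le> P" "1 \<le> Q" using p(2)[of lo] q(2)[of lo] assms(1) by auto
  have R: "0 \<le> R m" "R m \<le> P * Q - 1" if "m \<in> {lo..hi}" for m
    using p(2)[OF that] q(2)[OF that] PQ mult_mono[of 1 "p m" 1 "q m"] mult_mono[of "p m" P "q m" Q]
    by (auto simp: R_def)
  have part: "\<bar>(\<Sum>m=lo..k. R m * (v (Suc m) - v m)) - R k * v (Suc k)\<bar>
     \<le> R lo + Q * (p lo - p k) + P * (q k - q lo)" if "lo \<le> k" "k \<le> hi" for k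
    using that
  proof (induction k rule: dec_induct)
    case base
    have "R lo * v lo \<le> R lo * 1" "0 \<le> R lo * v lo"
      using R[of lo] base v[of lo] mult_left_mono[of "v lo" 1 "R lo"] by auto
    then show ?case by (simp add: algebra_simps)
  next
    case (step k)
    have "\<bar>R k - R (Suc k)\<bar> = \<bar>q (Suc k) * (p k - p (Suc k)) - p k * (q (Suc k) - q k)\<bar>"
      by (simp add: R_def algebra_simps)
    also have "\<dots> \<le> \<bar>q (Suc k) * (p k - p (Suc k))\<bar> + \<bar>p k * (q (Suc k) - q k)\<bar>"
      by (rule abs_triangle_ineq4)
    also have "\<dots> \<le> Q * (p k - p (Suc k)) + P * (q (Suc k) - q k)"
      using p(1)[of k] q(1)[of k] p(2)[of k] q(2)[of "Suc k"] step
      by (auto simp: abs_mult intro!: add_mono mult_right_mono)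
    finally have "\<bar>R k - R (Suc k)\<bar> \<le> Q * (p k - p (Suc k)) + P * (q (Suc k) - q k)" .
    moreover have "\<bar>(R k - R (Suc k)) * v (Suc k)\<bar> \<le> \<bar>R k - R (Suc k)\<bar>"
      using v[of "Suc k"] by (simp add: abs_mult mult_left_le)
    moreover have "(\<Sum>m=lo..Suc k. R m * (v (Suc m) - v m)) - R (Suc k) * v (Suc (Suc k))
       = ((\<Sum>m=lo..k. R m * (v (Suc m) - v m)) - R k * v (Suc k)) + (R k - R (Suc k)) * v (Suc k)"
      using step by (simp add: algebra_simps)
    moreover have "Q * (p lo - p k) + Q * (p k - p (Suc k)) = Q * (p lo - p (Suc k))"
      "P * (q k - q lo) + P * (q (Suc k) - q k) = P * (q (Suc k) - q lo)"
      by (simp_all add: algebra_simps)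
    moreover have "\<bar>(\<Sum>m=lo..k. R m * (v (Suc m) - v m)) - R k * v (Suc k)\<bar>
        \<le> R lo + Q * (p lo - p k) + P * (q k - q lo)"
      using step by simp
    ultimately show ?case by linarith
  qed
  have tele: "(\<Sum>m=lo..hi. v (Suc m) - v m) = v (Suc hi) - v lo"
    using assms(1) by (simp add: sum_Suc_diff)
  have "(\<Sum>m=lo..hi. p m * q m * (v (Suc m) - v m)) - (v (Suc hi) - v lo)
      = (\<Sum>m=lo..hi. R m * (v (Suc m) - v m))"
    unfolding tele[symmetric] sum_subtractf[symmetric] by (simp add: R_def algebra_simps)
  moreover have "\<bar>\<Sum>m=lo..hi. R m * (v (Suc m) - v m)\<bar> \<le> 4 * (P * Q - 1)"
  proof -
    have 1: "0 \<le> R hi * v (Suc hi)" "R hi * v (Suc hi) \<le> R hi"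
      using R[of hi] assms(1) v[of "Suc hi"] by (auto simp: mult_left_le)
    have "Q * (p lo - p hi) \<le> Q * (P - 1)" "P * (q hi - q lo) \<le> P * (Q - 1)"
      using PQ p(2)[of lo] p(2)[of hi] q(2)[of lo] q(2)[of hi] assms(1)
      by (auto intro!: mult_left_mono diff_mono)
    moreover have "Q * (P - 1) \<le> P * Q - 1" "P * (Q - 1) \<le> P * Q - 1"
      using PQ by (simp_all add: algebra_simps)
    ultimately have 2: "Q * (p lo - p hi) \<le> P * Q - 1" "P * (q hi - q lo) \<le> P * Q - 1" by linarith+
    have 3: "R lo \<le> P * Q - 1" "R hi \<le> P * Q - 1" using R assms(1) by auto
    have 4: "\<bar>(\<Sum>m=lo..hi. R m * (v (Suc m) - v m)) - R hi * v (Suc hi)\<bar>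
      \<le> R lo + Q * (p lo - p hi) + P * (q hi - q lo)"
      using part[of hi] assms(1) by simp
    have "\<bar>X\<bar> \<le> 4 * Y" if "0 \<le> r" "r \<le> rh" "a \<le> Y" "b \<le> Y" "rl \<le> Y" "rh \<le> Y" "\<bar>X - r\<bar> \<le> rl + a + b"
      for X Y r rh a b rl :: real
      using that by linarith
    from this[OF 1 2 3 4] show ?thesis .
  qed
  ultimately show ?thesis by simp
qed

section \<open>The test function\<close>

text \<open>The equilibrium potential of the chain of \<open>n + 1\<close> particles on two sites,
  \<open>m\<close> of them at the first: partial over total resistance. It runs from 0 at
  \<open>m = 0\<close> to 1 at \<open>m = n + 1\<close>.\<close>

definition Hf :: "real \<Rightarrow> nat \<Rightarrow> nat \<Rightarrow> real" where
  "Hf \<alpha> n m = (\<Sum>i<m. zrp_a \<alpha> i * zrp_a \<alpha> (n - i)) / Zsum \<alpha> n"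

lemma Hf_nonneg: "0 \<le> Hf \<alpha> n m"
  unfolding Hf_def using Zsum_pos[of \<alpha> n] by (intro divide_nonneg_pos sum_nonneg) auto

lemma Hf_mono: "m \<le> m' \<Longrightarrow> Hf \<alpha> n m \<le> Hf \<alpha> n m'"
  unfolding Hf_def using Zsum_pos[of \<alpha> n]
  by (intro divide_right_mono sum_mono2) auto

lemma Hf_Suc: "Hf \<alpha> n (Suc m) - Hf \<alpha> n m = zrp_a \<alpha> m * zrp_a \<alpha> (n - m) / Zsum \<alpha> n"
  by (simp add: Hf_def add_divide_distrib)

text \<open>The reversal \<open>i \<mapsto> n - i\<close> exchanges the two sites. It reduces
  estimates near 1 to estimates near 0.\<close>

lemma Hf_complement:
  assumes "m \<le> Suc n"
  shows "1 - Hf \<alpha> n m = Hf \<alpha> n (Suc n - m)"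
proof -
  have "(\<Sum>i<Suc n - m. zrp_a \<alpha> i * zrp_a \<alpha> (n - i)) = (\<Sum>j\<in>{m..<Suc n}. zrp_a \<alpha> j * zrp_a \<alpha> (n - j))"
    using assms by (intro sum.reindex_bij_witness[of _ "\<lambda>j. n - j" "\<lambda>i. n - i"]) auto
  moreover have "Zsum \<alpha> n = (\<Sum>i<m. zrp_a \<alpha> i * zrp_a \<alpha> (n - i)) + (\<Sum>j\<in>{m..<Suc n}. zrp_a \<alpha> j * zrp_a \<alpha> (n - j))"
    unfolding Zsum_def using assms by (metis lessThan_atLeast0 sum.atLeastLessThan_concat zero_le)
  ultimately show ?thesis
    using Zsum_pos[of \<alpha> n] by (simp add: Hf_def field_simps)
qed

lemma Hf_le_1: "m \<le> Suc n \<Longrightarrow> Hf \<alpha> n m \<le> 1"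
  using Hf_complement[of m n \<alpha>] Hf_nonneg[of \<alpha> n "Suc n - m"] by linarith

lemma Zsum_partial_le:
  assumes "\<alpha> > 0"
  shows "(\<Sum>i<m. zrp_a \<alpha> i * zrp_a \<alpha> (n - i)) \<le> real m powr (\<alpha> + 1) * real (Suc n) powr \<alpha>"
proof -
  have "zrp_a \<alpha> i * zrp_a \<alpha> (n - i) \<le> real m powr \<alpha> * real (Suc n) powr \<alpha>" if "i < m" for i
    using zrp_a_mono[of \<alpha> i m] zrp_a_mono[of \<alpha> "n - i" "Suc n"] that assms
    by (intro mult_mono) (auto simp: zrp_a_eq)
  then have "(\<Sum>i<m. zrp_a \<alpha> i * zrp_a \<alpha> (n - i)) \<le> (\<Sum>i<m. real m powr \<alpha> * real (Suc n) powr \<alpha>)"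
    by (intro sum_mono) auto
  then show ?thesis by (cases "m = 0") (auto simp: powr_add algebra_simps)
qed

lemma Zsum_le:
  assumes "\<alpha> > 0"
  shows "Zsum \<alpha> n \<le> real (Suc n) powr (\<alpha> + 1) * real (Suc n) powr \<alpha>"
  unfolding Zsum_def by (rule Zsum_partial_le[OF assms])

lemma Hf_le:
  assumes "\<alpha> > 0"
  shows "Zsum \<alpha> n * Hf \<alpha> n m \<le> real m powr (\<alpha> + 1) * real (Suc n) powr \<alpha>"
  using Zsum_partial_le[OF assms, where m = m and n = n] Zsum_pos[of \<alpha> n] by (simp add: Hf_def)

text \<open>\<open>arc L x y\<close> is the set of sites met when running through the torus from \<open>x\<close> (included)
  to \<open>y\<close> (excluded). A particle sitting there and driven by the time-reversed process, which
  jumps backwards, reaches \<open>x\<close> before \<open>y\<close>.\<close>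

definition arc :: "nat \<Rightarrow> nat \<Rightarrow> nat \<Rightarrow> nat set" where
  "arc L x y = (if x < y then {x..<y} else {..<L} - {y..<x})"

lemma arc_props:
  assumes "x < L" "y < L" "x \<noteq> y"
  shows "finite (arc L x y)" "arc L x y \<subseteq> {..<L}" "x \<in> arc L x y" "y \<notin> arc L x y"
  using assms by (auto simp: arc_def)

text \<open>An arc that wraps around is the complement of an ordinary interval from \<open>y\<close>
  to \<open>x\<close>, and the sum over the full cycle is zero.\<close>

lemma sum_arc_telescope:
  fixes v :: "nat \<Rightarrow> real"
  assumes "x < L" "y < L" "x \<noteq> y"
  shows "(\<Sum>z\<in>arc L x y. v z - v ((z + 1) mod L)) = v x - v y"
proof -
  have up: "(\<Sum>z\<in>{a..<b}. v z - v ((z + 1) mod L)) = v a - v b" if "a < b" "b < L" for a b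
  proof -
    have "(\<Sum>z\<in>{a..<b}. v z - v ((z + 1) mod L)) = - (\<Sum>z\<in>{a..<b}. v (Suc z) - v z)"
      unfolding sum_negf[symmetric] using that by (intro sum.cong) auto
    then show ?thesis using sum_Suc_diff'[of a b v] that by simp
  qed
  show ?thesis
  proof (cases "x < y")
    case True
    then show ?thesis using up assms by (simp add: arc_def)
  next
    case False
    have "(\<Sum>z<L. v z - v ((z + 1) mod L)) = 0"
      using sum_rotate[of L v] assms by (simp add: sum_subtractf)
    moreover have "(\<Sum>z\<in>{..<L} - {y..<x}. v z - v ((z + 1) mod L))
        = (\<Sum>z<L. v z - v ((z + 1) mod L)) - (\<Sum>z\<in>{y..<x}. v z - v ((z + 1) mod L))"
      using assms by (intro sum_diff) auto
    ultimately show ?thesis using up[of y x] assms False by (simp add: arc_def)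
  qed
qed

section \<open>Dominating pairs and the test function\<close>

definition dominate :: "nat \<Rightarrow> nat \<Rightarrow> nat \<Rightarrow> (nat \<Rightarrow> nat) \<Rightarrow> bool" where
  "dominate L x y \<eta> \<longleftrightarrow> (\<forall>z<L. z \<noteq> x \<longrightarrow> z \<noteq> y \<longrightarrow> \<eta> z < \<eta> x \<and> \<eta> z < \<eta> y)"

text \<open>If \<open>u\<close> were outside \<open>{x, y}\<close>, it would lie strictly below both
  \<open>x\<close> and \<open>y\<close>; but one of these is outside \<open>{u, v}\<close> and so
  lies strictly below \<open>u\<close>. The same goes for \<open>v\<close>.\<close>

lemma dominate_unique:
  assumes "dominate L u v \<eta>" "dominate L x y \<eta>" "u < L" "v < L" "x < L" "y < L" "u \<noteq> v" "x \<noteq> y"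
  shows "{u, v} = {x, y}"
proof -
  have "u \<in> {x, y}" using assms unfolding dominate_def by (metis insertCI less_asym)
  moreover have "v \<in> {x, y}" using assms unfolding dominate_def by (metis insertCI less_asym)
  ultimately show ?thesis using assms(7) by auto
qed

text \<open>The fallback value when no pair with one site on each side dominates. It is constant
  along the cycle of a configuration whose two leading sites lie on the same side with a gap to the
  others.\<close>

definition lead :: "nat \<Rightarrow> nat set \<Rightarrow> (nat \<Rightarrow> nat) \<Rightarrow> real" where
  "lead L A \<eta> = (if \<exists>x\<in>A. \<forall>y\<in>{..<L} - A. \<eta> y < \<eta> x then 1 else 0)"

text \<open>The description is well defined: a dominating pair is unique as a set, and membership in
  \<open>A\<close> tells \<open>x\<close> from \<open>y\<close>.\<close>

definition test_fun :: "nat \<Rightarrow> real \<Rightarrow> nat \<Rightarrow> nat set \<Rightarrow> (nat \<Rightarrow> nat) \<Rightarrow> real" where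
  "test_fun L \<alpha> n A \<eta> =
    (if \<exists>x\<in>A. \<exists>y\<in>{..<L} - A. dominate L x y \<eta>
     then (THE h. \<exists>x\<in>A. \<exists>y\<in>{..<L} - A. dominate L x y \<eta> \<and> h = Hf \<alpha> n (\<Sum>z\<in>arc L x y. \<eta> z))
     else lead L A \<eta>)"

lemma test_fun_dominate:
  assumes "A \<subseteq> {..<L}" "x \<in> A" "y \<in> {..<L} - A" "dominate L x y \<eta>"
  shows "test_fun L \<alpha> n A \<eta> = Hf \<alpha> n (\<Sum>z\<in>arc L x y. \<eta> z)"
proof -
  have un: "x' = x \<and> y' = y" if "x' \<in> A" "y' \<in> {..<L} - A" "dominate L x' y' \<eta>" for x' y'
  proof -
    have "{x', y'} = {x, y}"
      using assms that by (intro dominate_unique[of L _ _ \<eta>]) auto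
    then show ?thesis using assms(2,3) that(1,2) by (metis DiffD2 doubleton_eq_iff)
  qed
  have "(THE h. \<exists>x\<in>A. \<exists>y\<in>{..<L} - A. dominate L x y \<eta> \<and> h = Hf \<alpha> n (\<Sum>z\<in>arc L x y. \<eta> z))
     = Hf \<alpha> n (\<Sum>z\<in>arc L x y. \<eta> z)"
    by (rule the_equality) (use assms un in blast)+
  then show ?thesis using assms unfolding test_fun_def by metis
qed

lemma test_fun_not_dominate:
  assumes "\<And>x y. x \<in> A \<Longrightarrow> y \<in> {..<L} - A \<Longrightarrow> \<not> dominate L x y \<eta>"
  shows "test_fun L \<alpha> n A \<eta> = lead L A \<eta>"
  using assms by (auto simp: test_fun_def)

lemma arc_sum_bounds:
  assumes "x < L" "y < L" "x \<noteq> y" "\<eta> \<in> config_space L n"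
  shows "\<eta> x \<le> (\<Sum>z\<in>arc L x y. \<eta> z)" "(\<Sum>z\<in>arc L x y. \<eta> z) + \<eta> y \<le> n"
proof -
  note arc = arc_props[OF assms(1-3)]
  show "\<eta> x \<le> (\<Sum>z\<in>arc L x y. \<eta> z)" using arc by (intro member_le_sum) auto
  have "(\<Sum>z\<in>insert y (arc L x y). \<eta> z) \<le> (\<Sum>z<L. \<eta> z)"
    using arc assms by (intro sum_mono2) auto
  then show "(\<Sum>z\<in>arc L x y. \<eta> z) + \<eta> y \<le> n"
    using arc config_spaceD(2)[OF assms(4)] by simp
qed

lemma test_fun_bounds:
  assumes "A \<subseteq> {..<L}" "\<eta> \<in> config_space L (Suc n)"
  shows "0 \<le> test_fun L \<alpha> n A \<eta> \<and> test_fun L \<alpha> n A \<eta> \<le> 1"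
proof (cases "\<exists>x\<in>A. \<exists>y\<in>{..<L} - A. dominate L x y \<eta>")
  case True
  then obtain x y where xy: "x \<in> A" "y \<in> {..<L} - A" "dominate L x y \<eta>" by blast
  then have "(\<Sum>z\<in>arc L x y. \<eta> z) + \<eta> y \<le> Suc n"
    using assms by (intro arc_sum_bounds(2)) auto
  then show ?thesis
    unfolding test_fun_dominate[OF assms(1) xy] by (simp add: Hf_nonneg Hf_le_1)
next
  case False
  then have "test_fun L \<alpha> n A \<eta> = lead L A \<eta>" by (intro test_fun_not_dominate) auto
  then show ?thesis by (simp add: lead_def)
qed

text \<open>A strict maximum \<open>u\<close> belongs to every dominating pair. If
  \<open>u = y\<close>, the arc misses the particles at \<open>u\<close>; if \<open>u = x\<close>,
  it contains them and \<open>Hf_complement\<close> leads to the same bound. Without a mixed pair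
  \<open>lead\<close> is exact.\<close>

lemma test_fun_near_max:
  assumes A: "A \<subseteq> {..<L}" and \<eta>: "\<eta> \<in> config_space L (Suc n)"
    and u: "u < L" "\<And>y. y < L \<Longrightarrow> y \<noteq> u \<Longrightarrow> \<eta> y < \<eta> u"
  shows "\<bar>test_fun L \<alpha> n A \<eta> - (if u \<in> A then 1 else 0)\<bar> \<le> Hf \<alpha> n (Suc n - \<eta> u)"
proof (cases "\<exists>x\<in>A. \<exists>y\<in>{..<L} - A. dominate L x y \<eta>")
  case True
  then obtain x y where xy: "x \<in> A" "y \<in> {..<L} - A" "dominate L x y \<eta>" by blast
  let ?M = "\<Sum>z\<in>arc L x y. \<eta> z"
  have M: "\<eta> x \<le> ?M" "?M + \<eta> y \<le> Suc n"
    using xy A \<eta> by (auto intro!: arc_sum_bounds)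
  note t = test_fun_dominate[OF A xy, of \<alpha> n]
  have "u = x \<or> u = y" using xy A u unfolding dominate_def by (metis less_asym subsetD lessThan_iff)
  then show ?thesis
  proof
    assume "u = x"
    moreover have "1 - Hf \<alpha> n ?M = Hf \<alpha> n (Suc n - ?M)" using M by (intro Hf_complement) simp
    moreover have "Hf \<alpha> n (Suc n - ?M) \<le> Hf \<alpha> n (Suc n - \<eta> x)" using M by (intro Hf_mono) simp
    moreover have "Hf \<alpha> n ?M \<le> 1" using M by (intro Hf_le_1) simp
    ultimately show ?thesis using xy t by simp
  next
    assume "u = y"
    moreover have "Hf \<alpha> n ?M \<le> Hf \<alpha> n (Suc n - \<eta> y)" using M by (intro Hf_mono) simp
    ultimately show ?thesis using xy t Hf_nonneg[of \<alpha> n ?M] by simp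
  qed
next
  case False
  have "lead L A \<eta> = (if u \<in> A then 1 else 0)"
  proof (cases "u \<in> A")
    case True
    then show ?thesis using u by (auto simp: lead_def)
  next
    case False
    then have "\<not> (\<exists>x\<in>A. \<forall>y\<in>{..<L} - A. \<eta> y < \<eta> x)"
      using u A by (metis Diff_iff lessThan_iff less_asym subsetD)
    then show ?thesis using False by (simp add: lead_def)
  qed
  then show ?thesis
    using False test_fun_not_dominate[of A L \<eta> \<alpha> n] Hf_nonneg[of \<alpha> n "Suc n - \<eta> u"] by auto
qed

section \<open>The local flow\<close>

text \<open>A gap of 2 survives the addition of one particle anywhere, so the pair dominates at
  every point of the cycle \<open>inc z \<xi>\<close>.\<close>

definition pair_gap :: "nat \<Rightarrow> nat \<Rightarrow> nat \<Rightarrow> (nat \<Rightarrow> nat) \<Rightarrow> bool" where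
  "pair_gap L x y \<xi> \<longleftrightarrow> (\<forall>z<L. z \<noteq> x \<longrightarrow> z \<noteq> y \<longrightarrow> \<xi> z + 2 \<le> \<xi> x \<and> \<xi> z + 2 \<le> \<xi> y)"

text \<open>The complementary case of comparable second and third occupation numbers. The three
  sites are parameters so that errors can be summed over triples.\<close>

definition near_tie :: "nat \<Rightarrow> nat \<Rightarrow> nat \<Rightarrow> nat \<Rightarrow> (nat \<Rightarrow> nat) \<Rightarrow> bool" where
  "near_tie L u v w \<xi> \<longleftrightarrow> u < L \<and> v < L \<and> w < L \<and> u \<noteq> v \<and> u \<noteq> w \<and> v \<noteq> w \<and> \<xi> v \<le> \<xi> u \<and>
     (\<forall>z<L. z \<noteq> u \<longrightarrow> \<xi> z \<le> \<xi> v) \<and> \<xi> v \<le> \<xi> w + 1"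

lemma pair_gap_or_near_tie:
  assumes "L \<ge> 2"
  obtains u v where "u < L" "v < L" "u \<noteq> v" "pair_gap L u v \<xi>" | u v w where "near_tie L u v w \<xi>"
proof -
  obtain u where u: "u < L" "\<And>z. z < L \<Longrightarrow> \<xi> z \<le> \<xi> u"
    using ex_argmax[of "{..<L}" \<xi>] assms by (auto simp: lessThan_empty_iff)
  have "{..<L} - {u} \<noteq> {}"
  proof
    assume "{..<L} - {u} = {}"
    then have "card {..<L} \<le> card {u}" by (intro card_mono) auto
    then show False using assms by simp
  qed
  then obtain v where v: "v < L" "v \<noteq> u" "\<And>z. z < L \<Longrightarrow> z \<noteq> u \<Longrightarrow> \<xi> z \<le> \<xi> v"
    using ex_argmax[of "{..<L} - {u}" \<xi>] by auto
  show thesis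
  proof (cases "\<forall>z<L. z \<noteq> u \<longrightarrow> z \<noteq> v \<longrightarrow> \<xi> z + 2 \<le> \<xi> v")
    case True
    then have "pair_gap L u v \<xi>" unfolding pair_gap_def using u(2)[OF v(1)] by (meson le_trans)
    then show thesis using that(1) u v by blast
  next
    case False
    then obtain w where "w < L" "w \<noteq> u" "w \<noteq> v" "\<xi> v \<le> \<xi> w + 1" by (auto simp: not_le)
    then have "near_tie L u v w \<xi>" unfolding near_tie_def using u v by auto
    then show thesis using that(2) by blast
  qed
qed

lemma pair_gap_dominate_inc: "pair_gap L x y \<xi> \<Longrightarrow> dominate L x y (inc z \<xi>)"
  by (force simp: pair_gap_def dominate_def inc_def)

lemma pair_gap_dominate: "pair_gap L x y \<xi> \<Longrightarrow> dominate L x y \<xi>"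
  by (force simp: pair_gap_def dominate_def)

lemma near_tie_not_pair_gap:
  assumes "near_tie L u v w \<xi>" "x < L" "y < L" "x \<noteq> y"
  shows "\<not> pair_gap L x y \<xi>"
proof
  assume R: "pair_gap L x y \<xi>"
  have "u = x \<or> u = y"
  proof (rule ccontr)
    assume "\<not> ?thesis"
    then have "\<xi> u + 2 \<le> \<xi> x" "\<xi> u + 2 \<le> \<xi> y" "x \<noteq> u"
      using R assms by (auto simp: pair_gap_def near_tie_def)
    moreover have "\<xi> x \<le> \<xi> v" "\<xi> v \<le> \<xi> u" using assms \<open>x \<noteq> u\<close> by (auto simp: near_tie_def)
    ultimately show False by simp
  qed
  moreover have "v = x \<or> v = y"
  proof (rule ccontr)
    assume *: "\<not> ?thesis"
    then have "\<xi> v + 2 \<le> \<xi> x" "\<xi> v + 2 \<le> \<xi> y"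
      using R assms by (auto simp: pair_gap_def near_tie_def)
    moreover have "\<xi> x \<le> \<xi> v \<or> \<xi> y \<le> \<xi> v" using assms by (auto simp: near_tie_def)
    ultimately show False by simp
  qed
  ultimately have "\<xi> w + 2 \<le> \<xi> v"
    using R assms by (auto simp: pair_gap_def near_tie_def)
  then show False using assms by (auto simp: near_tie_def)
qed

text \<open>Along the cycle \<open>F\<close> takes two values, the larger one exactly on the arc.
  Subtracting the smaller leaves one increment of \<open>Hf\<close> times a telescoping sum over the
  arc.\<close>

lemma flow_pair_gap:
  assumes A: "A \<subseteq> {..<L}" and xy: "x \<in> A" "y \<in> {..<L} - A" and R: "pair_gap L x y \<xi>"
  defines "M \<equiv> \<Sum>z\<in>arc L x y. \<xi> z"
  shows "flow L (test_fun L \<alpha> n A) V \<xi> =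
     zrp_a \<alpha> M * zrp_a \<alpha> (n - M) / Zsum \<alpha> n * (V (inc x \<xi>) - V (inc y \<xi>))"
proof -
  have xyL: "x < L" "y < L" "x \<noteq> y" using A xy by auto
  note arc = arc_props[OF xyL]
  have t: "test_fun L \<alpha> n A (inc z \<xi>) = Hf \<alpha> n M + (if z \<in> arc L x y then Hf \<alpha> n (Suc M) - Hf \<alpha> n M else 0)" for z
    unfolding test_fun_dominate[OF A xy pair_gap_dominate_inc[OF R]] sum_inc[OF arc(1)] M_def by simp
  let ?d = "\<lambda>z. V (inc z \<xi>) - V (inc ((z + 1) mod L) \<xi>)"
  have "flow L (test_fun L \<alpha> n A) V \<xi> = (\<Sum>z<L. Hf \<alpha> n M * ?d z)
     + (\<Sum>z<L. (if z \<in> arc L x y then Hf \<alpha> n (Suc M) - Hf \<alpha> n M else 0) * ?d z)"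
    unfolding flow_def t by (simp add: distrib_right sum.distrib)
  also have "(\<Sum>z<L. Hf \<alpha> n M * ?d z) = 0"
    using flow_const[of L "\<lambda>_. Hf \<alpha> n M" \<xi> _ V] xyL by (simp add: flow_def)
  also have "(\<Sum>z<L. (if z \<in> arc L x y then Hf \<alpha> n (Suc M) - Hf \<alpha> n M else 0) * ?d z)
     = (\<Sum>z\<in>arc L x y. (Hf \<alpha> n (Suc M) - Hf \<alpha> n M) * ?d z)"
    using arc(2) by (intro sum.mono_neutral_cong_right) auto
  also have "\<dots> = (Hf \<alpha> n (Suc M) - Hf \<alpha> n M) * (V (inc x \<xi>) - V (inc y \<xi>))"
    using sum_arc_telescope[OF xyL, of "\<lambda>z. V (inc z \<xi>)"] by (simp add: sum_distrib_left[symmetric])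
  finally show ?thesis by (simp add: Hf_Suc)
qed

text \<open>The pair dominates at every point of the cycle, so no pair with one site on each side
  does, and \<open>lead\<close> returns the side of the pair throughout.\<close>

lemma flow_same_side:
  assumes A: "A \<subseteq> {..<L}" and uv: "u < L" "v < L" "u \<noteq> v" "u \<in> A \<longleftrightarrow> v \<in> A" and R: "pair_gap L u v \<xi>"
  shows "flow L (test_fun L \<alpha> n A) V \<xi> = 0"
proof (rule flow_const)
  show "L > 0" using uv by simp
  fix z
  note D = pair_gap_dominate_inc[OF R, of z]
  have "\<not> dominate L x y (inc z \<xi>)" if "x \<in> A" "y \<in> {..<L} - A" for x y
  proof
    assume "dominate L x y (inc z \<xi>)"
    then have "{u, v} = {x, y}" using D uv that A by (intro dominate_unique[of L _ _ "inc z \<xi>"]) auto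
    then show False using uv(4) that by (metis DiffD2 doubleton_eq_iff)
  qed
  then have "test_fun L \<alpha> n A (inc z \<xi>) = lead L A (inc z \<xi>)" by (rule test_fun_not_dominate)
  also have "\<dots> = (if u \<in> A then 1 else 0)"
  proof (cases "u \<in> A")
    case True
    then have "\<forall>y\<in>{..<L} - A. inc z \<xi> y < inc z \<xi> u" using D uv unfolding dominate_def by blast
    then show ?thesis using True by (auto simp: lead_def)
  next
    case False
    then have "\<not> (\<exists>x\<in>A. \<forall>y\<in>{..<L} - A. inc z \<xi> y < inc z \<xi> x)"
      using D uv A unfolding dominate_def by (metis Diff_iff lessThan_iff less_asym subsetD)
    then show ?thesis using False by (simp add: lead_def)
  qed
  finally show "test_fun L \<alpha> n A (inc z \<xi>) = (if u \<in> A then 1 else 0)" .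
qed

lemma flow_osc_bound:
  assumes "L > 0" and V: "\<And>\<eta>. 0 \<le> V \<eta> \<and> V \<eta> \<le> 1"
    and F: "\<And>z. z < L \<Longrightarrow> \<bar>F (inc z \<xi>) - c\<bar> \<le> \<delta>"
  shows "\<bar>flow L F V \<xi>\<bar> \<le> real L * \<delta>"
proof -
  let ?d = "\<lambda>z. V (inc z \<xi>) - V (inc ((z + 1) mod L) \<xi>)"
  have "flow L F V \<xi> = (\<Sum>z<L. c * ?d z) + (\<Sum>z<L. (F (inc z \<xi>) - c) * ?d z)"
    unfolding flow_def sum.distrib[symmetric] by (simp add: algebra_simps)
  also have "(\<Sum>z<L. c * ?d z) = 0"
    using flow_const[of L "\<lambda>_. c" \<xi> c V] assms(1) by (simp add: flow_def)
  finally have "\<bar>flow L F V \<xi>\<bar> \<le> (\<Sum>z<L. \<bar>(F (inc z \<xi>) - c) * ?d z\<bar>)" by (simp add: sum_abs)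
  also have "\<dots> \<le> (\<Sum>z<L. \<delta>)"
  proof (rule sum_mono)
    fix z assume "z \<in> {..<L}"
    then have "\<bar>F (inc z \<xi>) - c\<bar> * \<bar>?d z\<bar> \<le> \<delta> * 1"
      using F[of z] V[of "inc z \<xi>"] V[of "inc ((z + 1) mod L) \<xi>"] by (intro mult_mono) auto
    then show "\<bar>(F (inc z \<xi>) - c) * ?d z\<bar> \<le> \<delta>" by (simp add: abs_mult)
  qed
  finally show ?thesis by simp
qed

text \<open>All sites but \<open>u\<close> hold at most \<open>\<xi> v\<close> particles. If
  \<open>u\<close> is ahead by 2, \<open>F\<close> is nearly constant on the cycle, with error
  \<open>Hf\<close> at a multiple of \<open>\<xi> v\<close>; otherwise \<open>n\<close> itself is
  comparable to \<open>\<xi> v\<close> and \<open>0 \<le> F \<le> 1\<close> suffices.\<close>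

lemma flow_near_tie:
  assumes A: "A \<subseteq> {..<L}" and T: "near_tie L u v w \<xi>" and \<xi>: "\<xi> \<in> config_space L n" "\<xi> u < n"
    and V: "\<And>\<eta>. 0 \<le> V \<eta> \<and> V \<eta> \<le> 1" and \<alpha>: "\<alpha> > 0"
  shows "Zsum \<alpha> n * \<bar>flow L (test_fun L \<alpha> n A) V \<xi>\<bar> \<le>
     real L * real (3 * L) powr (\<alpha> + 1) * real (Suc n) powr \<alpha> * real (\<xi> v) powr (\<alpha> + 1)"
proof -
  have uvw: "u < L" "v < L" "u \<noteq> v" "\<xi> v \<le> \<xi> u" and le: "\<And>z. z < L \<Longrightarrow> z \<noteq> u \<Longrightarrow> \<xi> z \<le> \<xi> v"
    using T by (auto simp: near_tie_def)
  define m where "m = \<xi> v"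
  have "(\<Sum>z<L. \<xi> z) = \<xi> u + (\<Sum>z\<in>{..<L} - {u}. \<xi> z)"
    using uvw by (subst sum.remove[of _ u]) auto
  moreover have "(\<Sum>z\<in>{..<L} - {u}. \<xi> z) \<le> (\<Sum>z\<in>{..<L} - {u}. m)"
    using le by (intro sum_mono) (auto simp: m_def)
  ultimately have n: "n \<le> \<xi> u + (L - 1) * m"
    using config_spaceD(2)[OF \<xi>(1)] uvw by simp
  have m: "m \<ge> 1" using n \<xi>(2) by (cases m) auto
  have Lm: "L * m = (L - 1) * m + m" using uvw by (cases L) auto
  have incc: "inc z \<xi> \<in> config_space L (Suc n)" if "z < L" for z using inc_config that \<xi> by blast
  \<comment> \<open>Both cases end in this bound. The factor 3 covers \<open>k = Suc n\<close>,
    where \<open>n \<le> L * m + 1\<close> and \<open>L * m \<ge> 1\<close>.\<close>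
  have fin: "real L * (real k powr (\<alpha> + 1) * real (Suc n) powr \<alpha>)
      \<le> real L * real (3 * L) powr (\<alpha> + 1) * real (Suc n) powr \<alpha> * real (\<xi> v) powr (\<alpha> + 1)" if "k \<le> 3 * L * m" for k
  proof -
    have "real k powr (\<alpha> + 1) \<le> real (3 * L * m) powr (\<alpha> + 1)"
      using that \<alpha> by (intro powr_mono2) (auto simp del: of_nat_mult)
    also have "\<dots> = real (3 * L) powr (\<alpha> + 1) * real m powr (\<alpha> + 1)" by (simp add: powr_mult)
    finally have "real k powr (\<alpha> + 1) * real (Suc n) powr \<alpha>
      \<le> real (3 * L) powr (\<alpha> + 1) * real m powr (\<alpha> + 1) * real (Suc n) powr \<alpha>" by (intro mult_right_mono) auto
    then have "real L * (real k powr (\<alpha> + 1) * real (Suc n) powr \<alpha>)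
      \<le> real L * (real (3 * L) powr (\<alpha> + 1) * real m powr (\<alpha> + 1) * real (Suc n) powr \<alpha>)"
      by (rule mult_left_mono) simp
    then show ?thesis unfolding m_def by (simp only: mult_ac)
  qed
  show ?thesis
  proof (cases "\<xi> v + 2 \<le> \<xi> u")
    case True
    define c :: real where "c = (if u \<in> A then 1 else 0)"
    have "\<bar>test_fun L \<alpha> n A (inc z \<xi>) - c\<bar> \<le> Hf \<alpha> n (Suc n - \<xi> u)" if z: "z < L" for z
    proof -
      have "inc z \<xi> y < inc z \<xi> u" if "y < L" "y \<noteq> u" for y
        using le[OF that] True by (auto simp: inc_def)
      then have "\<bar>test_fun L \<alpha> n A (inc z \<xi>) - c\<bar> \<le> Hf \<alpha> n (Suc n - inc z \<xi> u)"
        unfolding c_def using incc[OF z] uvw A by (intro test_fun_near_max) auto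
      also have "\<dots> \<le> Hf \<alpha> n (Suc n - \<xi> u)" by (intro Hf_mono) (auto simp: inc_def)
      finally show ?thesis .
    qed
    then have "\<bar>flow L (test_fun L \<alpha> n A) V \<xi>\<bar> \<le> real L * Hf \<alpha> n (Suc n - \<xi> u)"
      using V uvw by (intro flow_osc_bound) auto
    then have "Zsum \<alpha> n * \<bar>flow L (test_fun L \<alpha> n A) V \<xi>\<bar> \<le> Zsum \<alpha> n * (real L * Hf \<alpha> n (Suc n - \<xi> u))"
      using Zsum_pos[of \<alpha> n] by (intro mult_left_mono) auto
    also have "\<dots> = real L * (Zsum \<alpha> n * Hf \<alpha> n (Suc n - \<xi> u))" by (simp only: mult_ac)
    also have "\<dots> \<le> real L * (real (Suc n - \<xi> u) powr (\<alpha> + 1) * real (Suc n) powr \<alpha>)"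
      by (intro mult_left_mono Hf_le \<alpha>) auto
    also have "\<dots> \<le> real L * real (3 * L) powr (\<alpha> + 1) * real (Suc n) powr \<alpha> * real (\<xi> v) powr (\<alpha> + 1)"
      using n m Lm by (intro fin) linarith
    finally show ?thesis .
  next
    case False
    have "\<bar>flow L (test_fun L \<alpha> n A) V \<xi>\<bar> \<le> real L * 1"
      using V uvw test_fun_bounds[OF A incc, of _ \<alpha>] by (intro flow_osc_bound[where c = 0]) auto
    then have "Zsum \<alpha> n * \<bar>flow L (test_fun L \<alpha> n A) V \<xi>\<bar> \<le> Zsum \<alpha> n * (real L * 1)"
      using Zsum_pos[of \<alpha> n] by (intro mult_left_mono) auto
    also have "\<dots> = real L * Zsum \<alpha> n" by simp
    also have "\<dots> \<le> real L * (real (Suc n) powr (\<alpha> + 1) * real (Suc n) powr \<alpha>)"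
      by (intro mult_left_mono Zsum_le \<alpha>) auto
    also have "\<dots> \<le> real L * real (3 * L) powr (\<alpha> + 1) * real (Suc n) powr \<alpha> * real (\<xi> v) powr (\<alpha> + 1)"
    proof (intro fin)
      have "L * m \<ge> 1 * m" "L * m \<ge> L" using uvw m by (auto intro!: mult_le_mono1)
      then show "Suc n \<le> 3 * L * m" using n m Lm False m_def uvw by linarith
    qed
    finally show ?thesis .
  qed
qed

section \<open>Decomposition of the flow into tubes and near ties\<close>

lemma pair_gap_commute: "pair_gap L x y \<xi> \<longleftrightarrow> pair_gap L y x \<xi>"
  by (auto simp: pair_gap_def)

lemma sum_single_pair:
  fixes g :: "nat \<Rightarrow> nat \<Rightarrow> real"
  assumes "finite A" "finite B" "x \<in> A" "y \<in> B"
    and "\<And>x' y'. x' \<in> A \<Longrightarrow> y' \<in> B \<Longrightarrow> P x' y' \<longleftrightarrow> x' = x \<and> y' = y"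
  shows "(\<Sum>x'\<in>A. \<Sum>y'\<in>B. if P x' y' then g x' y' else 0) = g x y"
proof -
  have "(\<Sum>x'\<in>A. \<Sum>y'\<in>B. if P x' y' then g x' y' else 0)
      = (\<Sum>x'\<in>A. if x' = x then (\<Sum>y'\<in>B. if y' = y then g x y else 0) else 0)"
    using assms(5) by (intro sum.cong refl) (auto intro!: sum.cong sum.neutral)
  then show ?thesis using assms by (simp add: sum.delta)
qed

definition tube_flow :: "nat \<Rightarrow> real \<Rightarrow> nat \<Rightarrow> ((nat \<Rightarrow> nat) \<Rightarrow> real) \<Rightarrow> nat \<Rightarrow> nat \<Rightarrow> (nat \<Rightarrow> nat) \<Rightarrow> real" where
  "tube_flow L \<alpha> n V x y \<xi> = zrp_a \<alpha> (\<Sum>z\<in>arc L x y. \<xi> z) * zrp_a \<alpha> (n - (\<Sum>z\<in>arc L x y. \<xi> z)) *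
     (V (inc x \<xi>) - V (inc y \<xi>))"

text \<open>Three cases: for a gapped pair with one site on each side the double sum has the single
  term \<open>tube_flow\<close>; for a gapped pair on one side flow and sum both vanish; in a near
  tie the sum vanishes and one triple already pays for the flow.\<close>

lemma flow_decomposition:
  assumes L: "L \<ge> 2" and A: "A \<subseteq> {..<L}" and \<alpha>: "\<alpha> > 0"
    and \<xi>: "\<xi> \<in> config_space L n" "\<And>z. z < L \<Longrightarrow> \<xi> z < n"
    and V: "\<And>\<eta>. 0 \<le> V \<eta> \<and> V \<eta> \<le> 1"
  shows "\<bar>Zsum \<alpha> n * flow L (test_fun L \<alpha> n A) V \<xi> -
      (\<Sum>x\<in>A. \<Sum>y\<in>{..<L} - A. if pair_gap L x y \<xi> then tube_flow L \<alpha> n V x y \<xi> else 0)\<bar>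
    \<le> (\<Sum>u<L. \<Sum>v<L. \<Sum>w<L. if near_tie L u v w \<xi>
         then real L * real (3 * L) powr (\<alpha> + 1) * real (Suc n) powr \<alpha> * real (\<xi> v) powr (\<alpha> + 1) else 0)"
    (is "\<bar>?Z * ?fl - ?S\<bar> \<le> ?E")
proof -
  have E0: "?E \<ge> 0" by (intro sum_nonneg) auto
  have fA: "finite A" using A finite_subset by blast
  show ?thesis
  proof (rule pair_gap_or_near_tie[OF L, of \<xi>])
    fix u v assume uv: "u < L" "v < L" "u \<noteq> v" "pair_gap L u v \<xi>"
    have un: "{u, v} = {x, y}" if "x \<in> A" "y \<in> {..<L} - A" "pair_gap L x y \<xi>" for x y
      using uv that A by (intro dominate_unique[of L _ _ \<xi>] pair_gap_dominate) auto
    show ?thesis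
    proof (cases "u \<in> A \<longleftrightarrow> v \<in> A")
      case True
      then have "\<not> pair_gap L x y \<xi>" if "x \<in> A" "y \<in> {..<L} - A" for x y
        using un[OF that] that by (metis DiffD2 doubleton_eq_iff)
      then have "?S = 0" by (intro sum.neutral ballI) auto
      moreover have "?fl = 0" using uv True A by (intro flow_same_side)
      ultimately show ?thesis using E0 by simp
    next
      case False
      then obtain x y where xy: "x \<in> A" "y \<in> {..<L} - A" "pair_gap L x y \<xi>" "{u, v} = {x, y}"
        using uv pair_gap_commute by blast
      have "?S = tube_flow L \<alpha> n V x y \<xi>"
      proof (rule sum_single_pair)
        show "pair_gap L x' y' \<xi> \<longleftrightarrow> x' = x \<and> y' = y" if "x' \<in> A" "y' \<in> {..<L} - A" for x' y'
          using un[OF that] that xy by (metis DiffD2 doubleton_eq_iff)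
      qed (use xy fA in auto)
      moreover have "?Z * ?fl = tube_flow L \<alpha> n V x y \<xi>"
        unfolding flow_pair_gap[OF A xy(1-3)] tube_flow_def using Zsum_pos[of \<alpha> n] by simp
      ultimately show ?thesis using E0 by simp
    qed
  next
    fix u v w assume T: "near_tie L u v w \<xi>"
    let ?g = "\<lambda>u v w. if near_tie L u v w \<xi>
         then real L * real (3 * L) powr (\<alpha> + 1) * real (Suc n) powr \<alpha> * real (\<xi> v) powr (\<alpha> + 1) else 0"
    have uvw: "u < L" "v < L" "w < L" using T by (auto simp: near_tie_def)
    have "?S = 0"
      using near_tie_not_pair_gap[OF T] A by (intro sum.neutral ballI) auto
    then have "\<bar>?Z * ?fl - ?S\<bar> = ?Z * \<bar>?fl\<bar>" using Zsum_pos[of \<alpha> n] by (simp add: abs_mult)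
    also have "\<dots> \<le> ?g u v w"
      using flow_near_tie[OF A T \<xi>(1) \<xi>(2) V \<alpha>] uvw T by simp
    also have "\<dots> \<le> (\<Sum>w<L. ?g u v w)" using uvw by (intro member_le_sum) auto
    also have "\<dots> \<le> (\<Sum>v<L. \<Sum>w<L. ?g u v w)" using uvw by (intro member_le_sum[of v] sum_nonneg) auto
    also have "\<dots> \<le> ?E" using uvw by (intro member_le_sum[of u] sum_nonneg) auto
    finally show ?thesis .
  qed
qed

text \<open>If this fails at \<open>z\<close>, then \<open>\<xi> z \<ge> Suc n - l\<close>, which is
  exactly the threshold of the wells for one more particle: the whole cycle of \<open>\<xi>\<close>
  lies in the well of \<open>z\<close>.\<close>

definition shallow :: "nat \<Rightarrow> nat \<Rightarrow> nat \<Rightarrow> (nat \<Rightarrow> nat) \<Rightarrow> bool" where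
  "shallow L n l \<xi> \<longleftrightarrow> (\<forall>z<L. \<xi> z + l \<le> n)"

text \<open>Configurations deep in a well carry no flow, because \<open>V\<close> is constant on
  their cycles. The resulting restriction to \<open>shallow\<close> later makes each fixed profile
  drop out of the error and fixes the ends of the tubes.\<close>

lemma weighted_flow_decomposition:
  assumes L: "L \<ge> 2" and A: "A \<subseteq> {..<L}" and \<alpha>: "\<alpha> > 0" and l: "0 < l" "l \<le> n"
    and V: "\<And>\<eta>. 0 \<le> V \<eta> \<and> V \<eta> \<le> 1"
    and well: "\<And>\<eta> x. \<eta> \<in> config_space L (Suc n) \<Longrightarrow> x < L \<Longrightarrow> \<eta> x \<ge> Suc n - l \<Longrightarrow> V \<eta> = (if x \<in> A then 1 else 0)"
  shows "\<bar>Zsum \<alpha> n * (\<Sum>\<xi>\<in>config_space L n. wt L \<alpha> \<xi> * flow L (test_fun L \<alpha> n A) V \<xi>) -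
      (\<Sum>x\<in>A. \<Sum>y\<in>{..<L} - A. \<Sum>\<xi> | \<xi> \<in> config_space L n \<and> (shallow L n l \<xi> \<and> pair_gap L x y \<xi>).
         wt L \<alpha> \<xi> * tube_flow L \<alpha> n V x y \<xi>)\<bar>
    \<le> real L * real (3 * L) powr (\<alpha> + 1) * (\<Sum>u<L. \<Sum>v<L. \<Sum>w<L. real (Suc n) powr \<alpha> *
         (\<Sum>\<xi> | \<xi> \<in> config_space L n \<and> (shallow L n l \<xi> \<and> near_tie L u v w \<xi>). wt L \<alpha> \<xi> * real (\<xi> v) powr (\<alpha> + 1)))"
    (is "\<bar>?Z * ?Q - ?S\<bar> \<le> ?E")
proof -
  let ?C = "{\<xi>. \<xi> \<in> config_space L n \<and> shallow L n l \<xi>}"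
  let ?fl = "flow L (test_fun L \<alpha> n A) V"
  let ?t = "\<lambda>\<xi>. \<Sum>x\<in>A. \<Sum>y\<in>{..<L} - A. if pair_gap L x y \<xi> then tube_flow L \<alpha> n V x y \<xi> else 0"
  let ?g = "\<lambda>\<xi> u v w. if near_tie L u v w \<xi>
         then real L * real (3 * L) powr (\<alpha> + 1) * real (Suc n) powr \<alpha> * real (\<xi> v) powr (\<alpha> + 1) else 0"
  have fC: "finite ?C" by (rule finite_subset[OF _ finite_config_space[of L n]]) auto
  have deep: "?fl \<xi> = 0" if \<xi>: "\<xi> \<in> config_space L n" "\<not> shallow L n l \<xi>" for \<xi>
  proof -
    obtain u where u: "u < L" "\<xi> u + l > n" using \<xi> by (auto simp: shallow_def not_le)
    have "V (inc z \<xi>) = (if u \<in> A then 1 else 0)" if "z < L" for z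
      using that u \<xi>(1) by (intro well inc_config) (auto simp: inc_def)
    then show ?thesis using L by (simp add: flow_def)
  qed
  have Q: "?Q = (\<Sum>\<xi>\<in>?C. wt L \<alpha> \<xi> * ?fl \<xi>)"
    using deep by (intro sum.mono_neutral_right) auto
  have filt: "(\<Sum>\<xi>\<in>?C. if P \<xi> then f \<xi> else 0) = (\<Sum>\<xi> | \<xi> \<in> config_space L n \<and> (shallow L n l \<xi> \<and> P \<xi>). f \<xi>)"
    for P and f :: "(nat \<Rightarrow> nat) \<Rightarrow> real"
    using sum.inter_filter[OF fC, of f P] by (simp add: conj_assoc)
  have S: "?S = (\<Sum>\<xi>\<in>?C. wt L \<alpha> \<xi> * ?t \<xi>)"
  proof -
    have "(\<Sum>\<xi>\<in>?C. wt L \<alpha> \<xi> * ?t \<xi>) = (\<Sum>x\<in>A. \<Sum>\<xi>\<in>?C. \<Sum>y\<in>{..<L} - A. if pair_gap L x y \<xi> then wt L \<alpha> \<xi> * tube_flow L \<alpha> n V x y \<xi> else 0)"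
      unfolding sum_distrib_left by (subst sum.swap) (simp add: if_distrib[of "(*) _"] cong: if_cong)
    also have "\<dots> = (\<Sum>x\<in>A. \<Sum>y\<in>{..<L} - A. \<Sum>\<xi>\<in>?C. if pair_gap L x y \<xi> then wt L \<alpha> \<xi> * tube_flow L \<alpha> n V x y \<xi> else 0)"
      by (intro sum.cong refl sum.swap)
    finally show ?thesis unfolding filt by simp
  qed
  have "\<bar>?Z * ?Q - ?S\<bar> = \<bar>\<Sum>\<xi>\<in>?C. wt L \<alpha> \<xi> * (?Z * ?fl \<xi> - ?t \<xi>)\<bar>"
    unfolding Q S sum_distrib_left[of ?Z] sum_subtractf[symmetric] by (simp add: right_diff_distrib mult_ac)
  also have "\<dots> \<le> (\<Sum>\<xi>\<in>?C. wt L \<alpha> \<xi> * (\<Sum>u<L. \<Sum>v<L. \<Sum>w<L. ?g \<xi> u v w))"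
  proof (intro order_trans[OF sum_abs] sum_mono)
    fix \<xi> assume "\<xi> \<in> ?C"
    then have "\<xi> \<in> config_space L n" "\<And>z. z < L \<Longrightarrow> \<xi> z < n"
      using l by (auto simp: shallow_def)
    from flow_decomposition[OF L A \<alpha> this V]
    show "\<bar>wt L \<alpha> \<xi> * (?Z * ?fl \<xi> - ?t \<xi>)\<bar> \<le> wt L \<alpha> \<xi> * (\<Sum>u<L. \<Sum>v<L. \<Sum>w<L. ?g \<xi> u v w)"
      unfolding abs_mult by (intro mult_mono) auto
  qed
  also have "\<dots> = (\<Sum>u<L. \<Sum>v<L. \<Sum>w<L. \<Sum>\<xi>\<in>?C. wt L \<alpha> \<xi> * ?g \<xi> u v w)"
  proof -
    have "(\<Sum>\<xi>\<in>?C. wt L \<alpha> \<xi> * (\<Sum>u<L. \<Sum>v<L. \<Sum>w<L. ?g \<xi> u v w))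
        = (\<Sum>u<L. \<Sum>\<xi>\<in>?C. \<Sum>v<L. \<Sum>w<L. wt L \<alpha> \<xi> * ?g \<xi> u v w)"
      unfolding sum_distrib_left by (rule sum.swap)
    also have "\<dots> = (\<Sum>u<L. \<Sum>v<L. \<Sum>\<xi>\<in>?C. \<Sum>w<L. wt L \<alpha> \<xi> * ?g \<xi> u v w)"
      by (intro sum.cong refl sum.swap)
    also have "\<dots> = (\<Sum>u<L. \<Sum>v<L. \<Sum>w<L. \<Sum>\<xi>\<in>?C. wt L \<alpha> \<xi> * ?g \<xi> u v w)"
      by (intro sum.cong refl sum.swap)
    finally show ?thesis .
  qed
  also have "\<dots> = ?E"
  proof -
    have "(\<Sum>\<xi>\<in>?C. wt L \<alpha> \<xi> * ?g \<xi> u v w) = real L * real (3 * L) powr (\<alpha> + 1) * (real (Suc n) powr \<alpha> *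
         (\<Sum>\<xi> | \<xi> \<in> config_space L n \<and> (shallow L n l \<xi> \<and> near_tie L u v w \<xi>). wt L \<alpha> \<xi> * real (\<xi> v) powr (\<alpha> + 1)))" for u v w
      unfolding filt[symmetric] sum_distrib_left by (intro sum.cong refl) auto
    then show ?thesis by (simp only: sum_distrib_left)
  qed
  finally show ?thesis .
qed

text \<open>The surplus \<open>m\<^bsup>1-\<alpha>\<^esup>\<close> of the tied pair is shared equally between its two sites; each exponent
  \<open>(\<alpha> - 1) / 2\<close> is summable exactly when \<open>\<alpha> > 3\<close>.\<close>

lemma near_tie_weight_bound:
  fixes I :: "nat set"
  assumes "finite I" "v \<in> I" "w \<in> I" "v \<noteq> w" "\<alpha> > 3"
    and k: "\<kappa> v \<le> \<kappa> w + 1" "\<kappa> w \<le> \<kappa> v"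
  shows "(\<Prod>z\<in>I. 1 / zrp_a \<alpha> (\<kappa> z)) * real (\<kappa> v) powr (\<alpha> + 1)
     \<le> 2 powr \<alpha> * (\<Prod>z\<in>I. 1 / zrp_a ((\<alpha> - 1) / 2) (\<kappa> z))"
proof -
  define s where "s = (\<alpha> - 1) / 2"
  have s: "s > 0" "s \<le> \<alpha>" "\<alpha> = 1 + 2 * s" using assms(5) by (auto simp: s_def field_simps)
  define J where "J = I - {v} - {w}"
  have split: "(\<Prod>z\<in>I. f z) = f v * (f w * (\<Prod>z\<in>J. f z))" for f :: "nat \<Rightarrow> real"
    unfolding J_def using assms by (subst prod.remove[of _ v]; simp; subst prod.remove[of _ w]) auto
  have J: "(\<Prod>z\<in>J. 1 / zrp_a \<alpha> (\<kappa> z)) \<le> (\<Prod>z\<in>J. 1 / zrp_a s (\<kappa> z))"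
    using s by (intro prod_mono) (auto simp: zrp_a_def intro!: divide_left_mono powr_mono)
  have J0: "(\<Prod>z\<in>J. 1 / zrp_a \<alpha> (\<kappa> z)) \<ge> 0" by (intro prod_nonneg) auto
  have main: "1 / zrp_a \<alpha> (\<kappa> v) * (1 / zrp_a \<alpha> (\<kappa> w)) * real (\<kappa> v) powr (\<alpha> + 1)
     \<le> 2 powr \<alpha> * (1 / zrp_a s (\<kappa> v) * (1 / zrp_a s (\<kappa> w)))"
  proof (cases "\<kappa> w = 0")
    case True
    then have "\<kappa> v = 0 \<or> \<kappa> v = 1" using k by auto
    then show ?thesis using True s by (auto simp: zrp_a_def ge_one_powr_ge_zero)
  next
    case False
    \<comment> \<open>The claim reduces to \<open>m powr (1 + s) * j powr s \<le> 2 powr \<alpha> *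
      j powr \<alpha>\<close>. The exponents on the left add up to \<open>\<alpha>\<close>, so
      \<open>m \<le> 2 * j\<close> is enough.\<close>
    define j m where "j = real (\<kappa> w)" and "m = real (\<kappa> v)"
    have jm: "1 \<le> j" "j \<le> m" "m \<le> 2 * j" using False k by (auto simp: j_def m_def)
    have a: "zrp_a t (\<kappa> v) = m powr t" "zrp_a t (\<kappa> w) = j powr t" for t
      using False k by (auto simp: zrp_a_def j_def m_def)
    have "m powr (1 + s) \<le> (2 * j) powr (1 + s)" using jm s by (intro powr_mono2) auto
    also have "\<dots> = 2 powr (1 + s) * j powr (1 + s)" using jm by (simp add: powr_mult)
    also have "\<dots> \<le> 2 powr \<alpha> * j powr (1 + s)" using s by (intro mult_right_mono powr_mono) auto
    finally have "m powr (1 + s) * j powr s \<le> 2 powr \<alpha> * j powr (1 + s) * j powr s"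
      by (intro mult_right_mono) auto
    also have "\<dots> = 2 powr \<alpha> * j powr \<alpha>" by (simp add: s(3) powr_add[symmetric] mult.assoc add_ac)
    finally have *: "m powr (1 + s) * j powr s \<le> 2 powr \<alpha> * j powr \<alpha>" .
    have "m powr (\<alpha> + 1) = m powr \<alpha> * m" using jm by (simp add: powr_add)
    moreover have "m powr (1 + s) = m * m powr s" using jm by (simp add: powr_add)
    ultimately show ?thesis
      unfolding a using * jm by (simp add: field_simps m_def[symmetric])
  qed
  have "(\<Prod>z\<in>I. 1 / zrp_a \<alpha> (\<kappa> z)) * real (\<kappa> v) powr (\<alpha> + 1)
     = (1 / zrp_a \<alpha> (\<kappa> v) * (1 / zrp_a \<alpha> (\<kappa> w)) * real (\<kappa> v) powr (\<alpha> + 1)) * (\<Prod>z\<in>J. 1 / zrp_a \<alpha> (\<kappa> z))"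
    unfolding split by simp
  also have "\<dots> \<le> (2 powr \<alpha> * (1 / zrp_a s (\<kappa> v) * (1 / zrp_a s (\<kappa> w)))) * (\<Prod>z\<in>J. 1 / zrp_a s (\<kappa> z))"
    by (rule mult_mono[OF main J _ J0]) simp
  also have "\<dots> = 2 powr \<alpha> * (\<Prod>z\<in>I. 1 / zrp_a s (\<kappa> z))" unfolding split by simp
  finally show ?thesis unfolding s_def .
qed

text \<open>The weight of the largest site \<open>u\<close> absorbs the prefactor, leaving a sum
  over profiles with a summable majorant. A fixed profile with fewer than \<open>l n\<close>
  particles violates \<open>shallow\<close> at \<open>u\<close>, so each term is eventually
  zero.\<close>

lemma near_tie_sum_tendsto_0:
  assumes \<alpha>: "\<alpha> > 3" and l: "filterlim l at_top sequentially"
  shows "(\<lambda>n. real (Suc n) powr \<alpha> *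
     (\<Sum>\<xi> | \<xi> \<in> config_space L n \<and> (shallow L n (l n) \<xi> \<and> near_tie L u v w \<xi>). wt L \<alpha> \<xi> * real (\<xi> v) powr (\<alpha> + 1))) \<longlonglongrightarrow> 0"
proof (cases "u < L \<and> v < L \<and> w < L \<and> u \<noteq> v \<and> u \<noteq> w \<and> v \<noteq> w")
  case False
  then have "\<not> near_tie L u v w \<xi>" for \<xi> by (auto simp: near_tie_def)
  then show ?thesis by simp
next
  case True
  define s where "s = (\<alpha> - 1) / 2"
  have s: "s > 1" using \<alpha> by (simp add: s_def)
  define I where "I = {..<L} - {u}"
  have I: "finite I" "v \<in> I" "w \<in> I" "v \<noteq> w" "u < L" using True by (auto simp: I_def)
  let ?k = "\<lambda>\<kappa>. (\<Sum>z\<in>I. \<kappa> z) :: nat"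
  let ?p = "\<lambda>\<kappa>. \<Prod>z\<in>I. 1 / zrp_a \<alpha> (\<kappa> z)"
  let ?\<xi> = "\<lambda>n \<kappa>. \<kappa>(u := n - ?k \<kappa>)"
  define S where "S n = {\<kappa>. \<kappa> \<in> supported I \<and> ?k \<kappa> \<le> n \<and> (shallow L n (l n) (?\<xi> n \<kappa>) \<and> near_tie L u v w (?\<xi> n \<kappa>))}" for n
  define h where "h n \<kappa> = real (Suc n) powr \<alpha> / zrp_a \<alpha> (n - ?k \<kappa>) * (?p \<kappa> * real (\<kappa> v) powr (\<alpha> + 1))" for n \<kappa>
  have "(\<lambda>n. \<Sum>\<kappa>\<in>S n. h n \<kappa>) \<longlonglongrightarrow> 0 * Gamma_const s ^ card I"
  proof (rule dominated_finite_sums[OF has_sum_profile_weight[OF s I(1)], where C = "real (2 * L) powr \<alpha> * 2 powr \<alpha>"])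
    show "finite (S n)" for n
      by (rule finite_subset[OF _ finite_supported_le[OF I(1), of n]]) (auto simp: S_def)
    show "eventually (\<lambda>n. \<forall>\<kappa>\<in>S n. \<bar>h n \<kappa>\<bar> \<le> real (2 * L) powr \<alpha> * 2 powr \<alpha> * (\<Prod>z\<in>I. 1 / zrp_a s (\<kappa> z))) sequentially"
      using eventually_gt_at_top[of 0]
    proof eventually_elim
      case (elim n)
      show ?case
      proof
        fix \<kappa> assume k: "\<kappa> \<in> S n"
        have nt: "near_tie L u v w (?\<xi> n \<kappa>)" using k by (simp add: S_def)
        have "(\<Sum>z<L. ?\<xi> n \<kappa> z) = (n - ?k \<kappa>) + ?k \<kappa>"
          using I by (subst sum.remove[of _ u]) (auto simp: I_def intro!: sum.cong)
        then have "?\<xi> n \<kappa> \<in> config_space L n"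
          using k I by (auto simp: config_space_def S_def supported_def I_def)
        moreover have "?\<xi> n \<kappa> y \<le> n - ?k \<kappa>" if "y < L" for y
          using nt that I by (cases "y = u") (auto simp: near_tie_def intro: le_trans)
        ultimately have "n \<le> L * (n - ?k \<kappa>)" by (rule config_max_ge)
        then have "Suc n \<le> (2 * L) * (n - ?k \<kappa>)" using elim by linarith
        then have 1: "real (Suc n) powr \<alpha> / zrp_a \<alpha> (n - ?k \<kappa>) \<le> real (2 * L) powr \<alpha>"
          using \<alpha> by (intro inverse_zrp_a_bound) auto
        have kk: "\<kappa> v \<le> \<kappa> w + 1" "\<kappa> w \<le> \<kappa> v" using nt True by (auto simp: near_tie_def)
        have 2: "?p \<kappa> * real (\<kappa> v) powr (\<alpha> + 1) \<le> 2 powr \<alpha> * (\<Prod>z\<in>I. 1 / zrp_a s (\<kappa> z))"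
          unfolding s_def using I \<alpha> kk by (intro near_tie_weight_bound) auto
        have 3: "?p \<kappa> * real (\<kappa> v) powr (\<alpha> + 1) \<ge> 0" by (intro mult_nonneg_nonneg prod_nonneg) auto
        have "h n \<kappa> \<le> real (2 * L) powr \<alpha> * (2 powr \<alpha> * (\<Prod>z\<in>I. 1 / zrp_a s (\<kappa> z)))"
          unfolding h_def by (rule mult_mono[OF 1 2 _ 3]) simp
        moreover have "h n \<kappa> \<ge> 0" unfolding h_def by (intro mult_nonneg_nonneg[OF _ 3]) auto
        ultimately show "\<bar>h n \<kappa>\<bar> \<le> real (2 * L) powr \<alpha> * 2 powr \<alpha> * (\<Prod>z\<in>I. 1 / zrp_a s (\<kappa> z))" by (simp add: mult.assoc)
      qed
    qed
    show "(\<lambda>n. if \<kappa> \<in> S n then h n \<kappa> else 0) \<longlonglongrightarrow> 0 * (\<Prod>z\<in>I. 1 / zrp_a s (\<kappa> z))" if "\<kappa> \<in> supported I" for \<kappa>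
    proof -
      have "eventually (\<lambda>n. l n \<ge> Suc (?k \<kappa>)) sequentially"
        using l unfolding filterlim_at_top by blast
      then have "eventually (\<lambda>n. (if \<kappa> \<in> S n then h n \<kappa> else 0) = 0) sequentially"
      proof eventually_elim
        case (elim n)
        have "\<kappa> \<notin> S n"
        proof
          assume "\<kappa> \<in> S n"
          then have "(n - ?k \<kappa>) + l n \<le> n" "?k \<kappa> \<le> n" using I(5) by (auto simp: S_def shallow_def)
          then show False using elim by linarith
        qed
        then show ?case by simp
      qed
      then show ?thesis using tendsto_eventually by force
    qed
  qed (auto simp: S_def intro!: prod_nonneg)
  moreover have "real (Suc n) powr \<alpha> *
     (\<Sum>\<xi> | \<xi> \<in> config_space L n \<and> (shallow L n (l n) \<xi> \<and> near_tie L u v w \<xi>). wt L \<alpha> \<xi> * real (\<xi> v) powr (\<alpha> + 1)) = (\<Sum>\<kappa>\<in>S n. h n \<kappa>)" for n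
    unfolding sum_config_profile1[OF I(5)] I_def[symmetric] S_def h_def sum_distrib_left
    using True by (intro sum.cong refl) (simp add: wt_upd1[OF I(5)] I_def)
  ultimately show ?thesis by simp
qed

section \<open>The tube between two sites\<close>

text \<open>What is left when the increment of \<open>Hf\<close> meets the weight of one large site:
  \<open>k\<close> counts the other particles on its side of the arc. For \<open>m \<ge> 1\<close>
  it is antitone in \<open>m\<close>, with limit 1.\<close>

definition rat :: "real \<Rightarrow> nat \<Rightarrow> nat \<Rightarrow> real" where
  "rat \<alpha> k m = zrp_a \<alpha> (m + k) / zrp_a \<alpha> m"

lemma rat_eq: "m \<ge> 1 \<Longrightarrow> rat \<alpha> k m = (1 + real k / real m) powr \<alpha>"
  by (simp add: rat_def zrp_a_eq powr_divide[symmetric] add_divide_distrib)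

lemma rat_ge_1: "\<alpha> \<ge> 0 \<Longrightarrow> rat \<alpha> k m \<ge> 1"
  using zrp_a_mono[of \<alpha> m "m + k"] by (simp add: rat_def le_divide_eq)

lemma rat_antimono:
  assumes "\<alpha> \<ge> 0" "1 \<le> m" "m \<le> m'"
  shows "rat \<alpha> k m' \<le> rat \<alpha> k m"
proof -
  have "real k / real m' \<le> real k / real m" using assms by (intro divide_left_mono) auto
  then show ?thesis using assms by (simp add: rat_eq powr_mono2)
qed

lemma rat_le:
  assumes "\<alpha> \<ge> 0" "1 \<le> m" "k \<le> L * m"
  shows "rat \<alpha> k m \<le> (1 + real L) powr \<alpha>"
proof -
  have "real k \<le> real L * real m" using assms(3) by (simp flip: of_nat_mult)
  then have "real k / real m \<le> real L" using assms by (simp add: divide_le_eq)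
  then show ?thesis using assms by (simp add: rat_eq powr_mono2)
qed

lemma rat_tendsto_1:
  assumes "filterlim j at_top sequentially"
  shows "(\<lambda>n. rat \<alpha> k (j n)) \<longlonglongrightarrow> 1"
proof -
  have "filterlim (\<lambda>n. real (j n)) at_infinity sequentially"
    using filterlim_compose[OF filterlim_real_at_infinity_sequentially assms] .
  then have "(\<lambda>n. (1 + real k / real (j n)) powr \<alpha>) \<longlonglongrightarrow> (1 + 0) powr \<alpha>"
    by (intro tendsto_intros tendsto_divide_0[OF tendsto_const]) auto
  then have "(\<lambda>n. (1 + real k / real (j n)) powr \<alpha>) \<longlonglongrightarrow> 1" by simp
  moreover have "eventually (\<lambda>n. j n \<ge> 1) sequentially"
    using assms unfolding filterlim_at_top by blast
  then have "eventually (\<lambda>n. (1 + real k / real (j n)) powr \<alpha> = rat \<alpha> k (j n)) sequentially"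
    by eventually_elim (simp add: rat_eq)
  ultimately show ?thesis by (rule Lim_transform_eventually)
qed

text \<open>The lower end of the tube: the constraints make the site occupied, the opposite site
  shallow, and the gap to all other sites at least 2. By symmetry the same number serves at both
  ends.\<close>

definition tube_lo :: "nat set \<Rightarrow> nat \<Rightarrow> (nat \<Rightarrow> nat) \<Rightarrow> nat" where
  "tube_lo I l \<kappa> = Max (insert 1 (insert (l - (\<Sum>z\<in>I. \<kappa> z)) ((\<lambda>z. \<kappa> z + 2) ` I)))"

lemma tube_lo_le_iff:
  assumes "finite I"
  shows "tube_lo I l \<kappa> \<le> m \<longleftrightarrow> 1 \<le> m \<and> l \<le> m + (\<Sum>z\<in>I. \<kappa> z) \<and> (\<forall>z\<in>I. \<kappa> z + 2 \<le> m)"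
  unfolding tube_lo_def using assms by (subst Max_le_iff) auto

text \<open>With the occupation numbers \<open>\<kappa>\<close> of all sites but \<open>x\<close> and \<open>y\<close> frozen, the weights turn the sum
  along the tube into a telescoping sum of increments of \<open>V\<close>, up to factors of bounded variation.\<close>

lemma tube_inner_sum:
  fixes \<alpha> :: real and V :: "(nat \<Rightarrow> nat) \<Rightarrow> real" and n :: nat
  assumes xy: "x < L" "y < L" "x \<noteq> y" and \<alpha>: "\<alpha> \<ge> 0" and l: "l \<ge> 1"
    and V: "\<And>\<eta>. 0 \<le> V \<eta> \<and> V \<eta> \<le> 1"
  defines "I \<equiv> {..<L} - {x, y}"
  assumes \<kappa>: "\<kappa> \<in> supported I"
  defines "k \<equiv> \<Sum>z\<in>I. \<kappa> z" and "k1 \<equiv> \<Sum>z\<in>arc L x y - {x}. \<kappa> z"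
  defines "lo \<equiv> tube_lo I l \<kappa>"
  defines "\<zeta> \<equiv> \<lambda>m. \<kappa>(x := m, y := n - k - m)"
  defines "v \<equiv> \<lambda>m. V (\<kappa>(x := m, y := Suc n - k - m))"
  defines "G \<equiv> \<Sum>m | m + k \<le> n \<and> (shallow L n l (\<zeta> m) \<and> pair_gap L x y (\<zeta> m)).
      wt L \<alpha> (\<zeta> m) * tube_flow L \<alpha> n V x y (\<zeta> m)"
  shows "\<not> 2 * lo + k \<le> n \<Longrightarrow> G = 0"
    and "2 * lo + k \<le> n \<Longrightarrow> \<exists>g. G = (\<Prod>z\<in>I. 1 / zrp_a \<alpha> (\<kappa> z)) * g \<and>
       \<bar>g - (v (Suc (n - k - lo)) - v lo)\<bar> \<le> 4 * (rat \<alpha> k1 lo * rat \<alpha> (k - k1) lo - 1)"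
    and "k1 \<le> k"
proof -
  have I: "finite I" "x \<notin> I" "y \<notin> I" "\<And>z. z < L \<longleftrightarrow> z = x \<or> z = y \<or> z \<in> I"
    using xy by (auto simp: I_def)
  note arc = arc_props[OF xy]
  have lo_le: "lo \<le> m \<longleftrightarrow> 1 \<le> m \<and> l \<le> m + k \<and> (\<forall>z\<in>I. \<kappa> z + 2 \<le> m)" for m
    unfolding lo_def k_def by (rule tube_lo_le_iff[OF I(1)])
  have lo: "1 \<le> lo" "l \<le> lo + k" "\<And>z. z \<in> I \<Longrightarrow> \<kappa> z + 2 \<le> lo" using lo_le[of lo] by auto
  have arcI: "arc L x y - {x} \<subseteq> I" using arc by (auto simp: I_def)
  show k1: "k1 \<le> k" unfolding k1_def k_def using arcI I(1) by (intro sum_mono2) auto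
  have gap: "pair_gap L x y (\<zeta> m) \<longleftrightarrow> (\<forall>z\<in>I. \<kappa> z + 2 \<le> m \<and> \<kappa> z + 2 \<le> n - k - m)" for m
    using xy I(2-4) unfolding pair_gap_def \<zeta>_def by auto
  have sh: "shallow L n l (\<zeta> m) \<longleftrightarrow> m + l \<le> n \<and> (n - k - m) + l \<le> n \<and> (\<forall>z\<in>I. \<kappa> z + l \<le> n)" for m
    using xy I(2-4) unfolding shallow_def \<zeta>_def by auto
  have I0: "k = 0" if "I = {}" using that by (simp add: k_def)
  \<comment> \<open>The constraints at \<open>x\<close> and \<open>y\<close> are exchanged by
    \<open>m \<mapsto> n - k - m\<close>, so \<open>lo\<close> governs both ends.\<close>
  have set_eq: "{m. m + k \<le> n \<and> (shallow L n l (\<zeta> m) \<and> pair_gap L x y (\<zeta> m))} = {m. lo \<le> m \<and> m + lo + k \<le> n}"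
  proof (intro set_eqI iffI)
    fix m assume "m \<in> {m. m + k \<le> n \<and> (shallow L n l (\<zeta> m) \<and> pair_gap L x y (\<zeta> m))}"
    then have m: "m + k \<le> n" "m + l \<le> n" "(n - k - m) + l \<le> n" "\<And>z. z \<in> I \<Longrightarrow> \<kappa> z + 2 \<le> m \<and> \<kappa> z + 2 \<le> n - k - m"
      by (auto simp: gap sh)
    \<comment> \<open>For \<open>L = 2\<close> there is no third site whose gap forces both sites to
      be occupied; \<open>l \<ge> 1\<close> does it instead.\<close>
    have "1 \<le> m \<and> 1 \<le> n - k - m"
    proof (cases "I = {}")
      case True
      then have "k = 0" by (rule I0)
      then show ?thesis using m(1-3) l by linarith
    next
      case False
      then show ?thesis using m(4) by fastforce
    qed
    then have "lo \<le> m" "lo \<le> n - k - m" unfolding lo_le using m by auto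
    then show "m \<in> {m. lo \<le> m \<and> m + lo + k \<le> n}" using m(1) by auto
  next
    fix m assume "m \<in> {m. lo \<le> m \<and> m + lo + k \<le> n}"
    then have m: "lo \<le> m" "lo \<le> n - k - m" "m + lo + k \<le> n" by auto
    have "\<kappa> z + l \<le> n" if "z \<in> I" for z using lo(2) lo(3)[OF that] m by linarith
    then show "m \<in> {m. m + k \<le> n \<and> (shallow L n l (\<zeta> m) \<and> pair_gap L x y (\<zeta> m))}"
      using m lo by (auto simp: gap sh intro: le_trans)
  qed
  have summand: "wt L \<alpha> (\<zeta> m) * tube_flow L \<alpha> n V x y (\<zeta> m) =
      (\<Prod>z\<in>I. 1 / zrp_a \<alpha> (\<kappa> z)) * (rat \<alpha> k1 m * rat \<alpha> (k - k1) (n - k - m) * (v (Suc m) - v m))"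
    if m: "m + k \<le> n" for m
  proof -
    have "(\<Sum>z\<in>arc L x y. \<zeta> m z) = \<zeta> m x + (\<Sum>z\<in>arc L x y - {x}. \<zeta> m z)"
      using arc by (intro sum.remove) auto
    also have "(\<Sum>z\<in>arc L x y - {x}. \<zeta> m z) = k1"
      unfolding k1_def \<zeta>_def using arc by (intro sum.cong) auto
    \<comment> \<open>Of the \<open>k\<close> other particles the arc contains \<open>k1\<close>;
      the remaining \<open>k - k1\<close> are counted with \<open>y\<close>.\<close>
    finally have M: "(\<Sum>z\<in>arc L x y. \<zeta> m z) = m + k1" using xy by (simp add: \<zeta>_def)
    have n: "n - (m + k1) = (n - k - m) + (k - k1)" using m k1 by simp
    have "inc x (\<zeta> m) = \<kappa>(x := Suc m, y := Suc n - k - Suc m)"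
      unfolding inc_def \<zeta>_def using xy by (auto simp: fun_upd_twist)
    moreover have "inc y (\<zeta> m) = \<kappa>(x := m, y := Suc n - k - m)"
      unfolding inc_def \<zeta>_def using xy m by (auto simp: Suc_diff_le fun_upd_twist)
    ultimately have tf: "tube_flow L \<alpha> n V x y (\<zeta> m) =
        zrp_a \<alpha> (m + k1) * zrp_a \<alpha> ((n - k - m) + (k - k1)) * (v (Suc m) - v m)"
      unfolding tube_flow_def M n v_def by simp
    have "wt L \<alpha> (\<zeta> m) = 1 / (zrp_a \<alpha> m * zrp_a \<alpha> (n - k - m)) * (\<Prod>z\<in>I. 1 / zrp_a \<alpha> (\<kappa> z))"
      unfolding \<zeta>_def I_def by (rule wt_upd2[OF xy])
    then show ?thesis unfolding tf rat_def by simp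
  qed
  have G: "G = (\<Prod>z\<in>I. 1 / zrp_a \<alpha> (\<kappa> z)) *
      (\<Sum>m | lo \<le> m \<and> m + lo + k \<le> n. rat \<alpha> k1 m * rat \<alpha> (k - k1) (n - k - m) * (v (Suc m) - v m))"
    unfolding G_def set_eq sum_distrib_left by (intro sum.cong refl summand) auto
  show "G = 0" if "\<not> 2 * lo + k \<le> n"
  proof -
    have "{m. lo \<le> m \<and> m + lo + k \<le> n} = {}" using that by auto
    then show ?thesis unfolding G by (simp only: sum.empty mult_zero_right)
  qed
  assume le: "2 * lo + k \<le> n"
  then have "{m. lo \<le> m \<and> m + lo + k \<le> n} = {lo..n - k - lo}" by auto
  moreover have "\<bar>(\<Sum>m=lo..n - k - lo. rat \<alpha> k1 m * rat \<alpha> (k - k1) (n - k - m) * (v (Suc m) - v m))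
      - (v (Suc (n - k - lo)) - v lo)\<bar> \<le> 4 * (rat \<alpha> k1 lo * rat \<alpha> (k - k1) lo - 1)"
  \<comment> \<open>As \<open>m\<close> grows, the factor on the \<open>x\<close> side decreases and
    that on the \<open>y\<close> side increases; each is largest where its own site holds
    \<open>lo\<close> particles.\<close>
  proof (rule abel_sum_bound)
    show "lo \<le> n - k - lo" using le by simp
    show "rat \<alpha> k1 (Suc m) \<le> rat \<alpha> k1 m" if "lo \<le> m" for m
      using that lo \<alpha> by (intro rat_antimono) auto
    show "rat \<alpha> (k - k1) (n - k - m) \<le> rat \<alpha> (k - k1) (n - k - Suc m)" if "m < n - k - lo" for m
      using that lo \<alpha> by (intro rat_antimono) auto
    show "1 \<le> rat \<alpha> k1 m \<and> rat \<alpha> k1 m \<le> rat \<alpha> k1 lo" if "m \<in> {lo..n - k - lo}" for m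
      using that lo \<alpha> by (auto intro: rat_antimono rat_ge_1)
    show "1 \<le> rat \<alpha> (k - k1) (n - k - m) \<and> rat \<alpha> (k - k1) (n - k - m) \<le> rat \<alpha> (k - k1) lo"
      if "m \<in> {lo..n - k - lo}" for m
      using that lo \<alpha> le by (auto intro!: rat_antimono rat_ge_1)
    show "0 \<le> v m \<and> v m \<le> 1" for m unfolding v_def by (rule V)
  qed
  ultimately show "\<exists>g. G = (\<Prod>z\<in>I. 1 / zrp_a \<alpha> (\<kappa> z)) * g \<and>
       \<bar>g - (v (Suc (n - k - lo)) - v lo)\<bar> \<le> 4 * (rat \<alpha> k1 lo * rat \<alpha> (k - k1) lo - 1)"
    unfolding G by auto
qed

text \<open>For a fixed profile both ends of the tube eventually lie in the wells, so the telescoped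
  sum is \<open>1 - 0\<close>, and the \<open>rat\<close> factors tend to 1 since the tube starts
  ever higher. Each profile then contributes its own weight.\<close>

lemma tube_sum_tendsto:
  assumes xy: "x < L" "y < L" "x \<noteq> y" and \<alpha>: "\<alpha> > 1"
    and l: "filterlim l at_top sequentially" "\<And>n. l n \<ge> 1" "eventually (\<lambda>n. 2 * l n \<le> n) sequentially"
    and V: "\<And>n \<eta>. 0 \<le> V n \<eta> \<and> V n \<eta> \<le> 1"
    and Vx: "eventually (\<lambda>n. \<forall>\<eta>\<in>config_space L (Suc n). \<eta> x \<ge> Suc n - l n \<longrightarrow> V n \<eta> = 1) sequentially"
    and Vy: "eventually (\<lambda>n. \<forall>\<eta>\<in>config_space L (Suc n). \<eta> y \<ge> Suc n - l n \<longrightarrow> V n \<eta> = 0) sequentially"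
  shows "(\<lambda>n. \<Sum>\<xi> | \<xi> \<in> config_space L n \<and> (shallow L n (l n) \<xi> \<and> pair_gap L x y \<xi>).
      wt L \<alpha> \<xi> * tube_flow L \<alpha> n (V n) x y \<xi>) \<longlonglongrightarrow> Gamma_const \<alpha> ^ (L - 2)"
proof -
  define I where "I = {..<L} - {x, y}"
  have I: "finite I" "card I = L - 2" "card I \<le> L"
    using xy by (auto simp: I_def card_Diff_subset)
  have \<alpha>0: "\<alpha> \<ge> 0" using \<alpha> by simp
  let ?k = "\<lambda>\<kappa>. (\<Sum>z\<in>I. \<kappa> z) :: nat"
  let ?p = "\<lambda>\<kappa>. \<Prod>z\<in>I. 1 / zrp_a \<alpha> (\<kappa> z)"
  define k1 where "k1 \<kappa> = (\<Sum>z\<in>arc L x y - {x}. \<kappa> z)" for \<kappa> :: "nat \<Rightarrow> nat"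
  define S where "S n = {\<kappa>. \<kappa> \<in> supported I \<and> ?k \<kappa> \<le> n}" for n
  define h where "h n \<kappa> = (\<Sum>m | m + ?k \<kappa> \<le> n \<and> (shallow L n (l n) (\<kappa>(x := m, y := n - ?k \<kappa> - m)) \<and>
        pair_gap L x y (\<kappa>(x := m, y := n - ?k \<kappa> - m))).
      wt L \<alpha> (\<kappa>(x := m, y := n - ?k \<kappa> - m)) * tube_flow L \<alpha> n (V n) x y (\<kappa>(x := m, y := n - ?k \<kappa> - m)))" for n \<kappa>
  define v where "v n \<kappa> m = V n (\<kappa>(x := m, y := Suc n - ?k \<kappa> - m))" for n \<kappa> m
  \<comment> \<open>The 1 bounds the increment of \<open>V\<close> between the ends, the rest bounds
    the error of \<open>abel_sum_bound\<close>.\<close>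
  define C where "C = 1 + 4 * ((1 + real L) powr \<alpha> * (1 + real L) powr \<alpha>)"
  have C0: "C \<ge> 0" by (simp add: C_def)
  have inner: "\<not> 2 * tube_lo I (l n) \<kappa> + ?k \<kappa> \<le> n \<Longrightarrow> h n \<kappa> = 0"
    "2 * tube_lo I (l n) \<kappa> + ?k \<kappa> \<le> n \<Longrightarrow> \<exists>g. h n \<kappa> = ?p \<kappa> * g \<and>
      \<bar>g - (v n \<kappa> (Suc (n - ?k \<kappa> - tube_lo I (l n) \<kappa>)) - v n \<kappa> (tube_lo I (l n) \<kappa>))\<bar>
        \<le> 4 * (rat \<alpha> (k1 \<kappa>) (tube_lo I (l n) \<kappa>) * rat \<alpha> (?k \<kappa> - k1 \<kappa>) (tube_lo I (l n) \<kappa>) - 1)"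
    "k1 \<kappa> \<le> ?k \<kappa>"
    if "\<kappa> \<in> supported I" for n \<kappa>
    unfolding I_def h_def v_def k1_def
    by (rule tube_inner_sum[where V = "V n" and l = "l n", OF xy \<alpha>0 l(2) V that[unfolded I_def]], assumption?)+
  have "(\<lambda>n. \<Sum>\<kappa>\<in>S n. h n \<kappa>) \<longlonglongrightarrow> 1 * Gamma_const \<alpha> ^ card I"
  proof (rule dominated_finite_sums[OF has_sum_profile_weight[OF \<alpha> I(1)], where C = C])
    show "finite (S n)" for n unfolding S_def using finite_supported_le[OF I(1), of n] by simp
    have "\<bar>h n \<kappa>\<bar> \<le> C * ?p \<kappa>" if "\<kappa> \<in> S n" for n \<kappa>
    proof -
      have \<kappa>: "\<kappa> \<in> supported I" using that by (simp add: S_def)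
      define lo where "lo = tube_lo I (l n) \<kappa>"
      have p0: "?p \<kappa> \<ge> 0" by (intro prod_nonneg) auto
      have lo: "1 \<le> lo" "\<And>z. z \<in> I \<Longrightarrow> \<kappa> z + 2 \<le> lo"
        using tube_lo_le_iff[OF I(1), of "l n" \<kappa> lo] by (auto simp: lo_def)
      \<comment> \<open>Every other site stays below \<open>lo\<close>, so the \<open>rat\<close>
        factors are bounded even for profiles that grow with \<open>n\<close>.\<close>
      have "?k \<kappa> \<le> (\<Sum>z\<in>I. lo)" using lo(2) by (intro sum_mono) (meson add_leD1)
      then have kL: "?k \<kappa> \<le> L * lo" using I(3) by (simp add: order_trans[OF _ mult_le_mono1])
      show ?thesis
      proof (cases "2 * lo + ?k \<kappa> \<le> n")
        case False
        then show ?thesis using inner(1)[OF \<kappa>, of n] p0 C0 by (simp add: lo_def)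
      next
        case True
        then obtain g where g: "h n \<kappa> = ?p \<kappa> * g"
          "\<bar>g - (v n \<kappa> (Suc (n - ?k \<kappa> - lo)) - v n \<kappa> lo)\<bar> \<le> 4 * (rat \<alpha> (k1 \<kappa>) lo * rat \<alpha> (?k \<kappa> - k1 \<kappa>) lo - 1)"
          using inner(2)[OF \<kappa>, of n] unfolding lo_def by blast
        have "rat \<alpha> (k1 \<kappa>) lo * rat \<alpha> (?k \<kappa> - k1 \<kappa>) lo \<le> (1 + real L) powr \<alpha> * (1 + real L) powr \<alpha>"
          using lo kL \<alpha>0 inner(3)[OF \<kappa>] rat_ge_1[OF \<alpha>0]
          by (intro mult_mono rat_le) (auto intro: order_trans[OF zero_le_one])
        moreover have "\<bar>v n \<kappa> (Suc (n - ?k \<kappa> - lo)) - v n \<kappa> lo\<bar> \<le> 1"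
          unfolding v_def using V by (smt (verit))
        ultimately have "\<bar>g\<bar> \<le> C" unfolding C_def using g(2) by argo
        then show ?thesis unfolding g(1) using p0 by (simp add: abs_mult mult.commute mult_right_mono)
      qed
    qed
    then show "eventually (\<lambda>n. \<forall>\<kappa>\<in>S n. \<bar>h n \<kappa>\<bar> \<le> C * ?p \<kappa>) sequentially" by simp
    show "(\<lambda>n. if \<kappa> \<in> S n then h n \<kappa> else 0) \<longlonglongrightarrow> 1 * ?p \<kappa>" if \<kappa>: "\<kappa> \<in> supported I" for \<kappa>
    proof -
      let ?r = "\<lambda>n. rat \<alpha> (k1 \<kappa>) (l n - ?k \<kappa>) * rat \<alpha> (?k \<kappa> - k1 \<kappa>) (l n - ?k \<kappa>)"
      have lk: "filterlim (\<lambda>n. l n - ?k \<kappa>) at_top sequentially"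
        unfolding filterlim_at_top
      proof
        fix Z
        have "eventually (\<lambda>n. Z + ?k \<kappa> \<le> l n) sequentially" using l(1) unfolding filterlim_at_top by blast
        then show "eventually (\<lambda>n. Z \<le> l n - ?k \<kappa>) sequentially" by eventually_elim simp
      qed
      have "(\<lambda>n. 4 * (?r n - 1) * ?p \<kappa>) \<longlonglongrightarrow> 4 * (1 * 1 - 1) * ?p \<kappa>"
        by (intro tendsto_intros rat_tendsto_1 lk)
      then have lim0: "(\<lambda>n. 4 * (?r n - 1) * ?p \<kappa>) \<longlonglongrightarrow> 0" by simp
      have p0: "?p \<kappa> \<ge> 0" by (intro prod_nonneg) auto
      \<comment> \<open>Then \<open>l n - ?k \<kappa> \<ge> ?k \<kappa> + 3\<close> exceeds every
        \<open>\<kappa> z + 2\<close>, so the well constraint alone decides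
        \<open>tube_lo\<close>.\<close>
      have "eventually (\<lambda>n. l n \<ge> 2 * ?k \<kappa> + 3) sequentially"
        using l(1) unfolding filterlim_at_top by blast
      then have "eventually (\<lambda>n. norm ((if \<kappa> \<in> S n then h n \<kappa> else 0) - ?p \<kappa>) \<le> 4 * (?r n - 1) * ?p \<kappa>) sequentially"
        using l(3) Vx Vy
      proof eventually_elim
        case (elim n)
        have kz: "\<kappa> z \<le> ?k \<kappa>" if "z \<in> I" for z using that I(1) by (intro member_le_sum) auto
        have lo: "tube_lo I (l n) \<kappa> = l n - ?k \<kappa>" (is "?lo = _")
        proof (rule antisym)
          show "?lo \<le> l n - ?k \<kappa>"
            unfolding tube_lo_le_iff[OF I(1)] using elim(1) kz by fastforce
          show "l n - ?k \<kappa> \<le> ?lo" using tube_lo_le_iff[OF I(1), of "l n" \<kappa> ?lo] by linarith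
        qed
        have le: "2 * (l n - ?k \<kappa>) + ?k \<kappa> \<le> n" using elim(1,2) by linarith
        have kS: "\<kappa> \<in> S n" using \<kappa> le elim(1,2) by (auto simp: S_def)
        obtain g where g: "h n \<kappa> = ?p \<kappa> * g"
          "\<bar>g - (v n \<kappa> (Suc (n - ?k \<kappa> - (l n - ?k \<kappa>))) - v n \<kappa> (l n - ?k \<kappa>))\<bar> \<le> 4 * (?r n - 1)"
          using inner(2)[OF \<kappa>, of n] le unfolding lo by blast
        have conf: "\<kappa>(x := m, y := Suc n - ?k \<kappa> - m) \<in> config_space L (Suc n)" if "m + ?k \<kappa> \<le> Suc n" for m
        proof -
          have L: "{..<L} = insert x (insert y I)" "x \<notin> I" "y \<notin> I" using xy by (auto simp: I_def)
          have "(\<Sum>z\<in>I. (\<kappa>(x := m, y := Suc n - ?k \<kappa> - m)) z) = ?k \<kappa>"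
            using L by (intro sum.cong) auto
          then have "(\<Sum>z<L. (\<kappa>(x := m, y := Suc n - ?k \<kappa> - m)) z) = Suc n"
            unfolding L(1) using L I(1) xy that by (simp del: fun_upd_apply) simp
          then show ?thesis using \<kappa> xy by (auto simp: config_space_def supported_def I_def)
        qed
        \<comment> \<open>At the upper end \<open>x\<close> holds \<open>Suc n - l n\<close>
          particles, at the lower end \<open>y\<close> does: exactly the threshold of the respective
          well.\<close>
        have "v n \<kappa> (Suc (n - ?k \<kappa> - (l n - ?k \<kappa>))) = 1"
          unfolding v_def using elim(1,2,3) conf[of "Suc (n - ?k \<kappa> - (l n - ?k \<kappa>))"] xy
          by (auto simp: Suc_diff_le)
        moreover have "v n \<kappa> (l n - ?k \<kappa>) = 0"
          unfolding v_def using elim(1,2,4) conf[of "l n - ?k \<kappa>"] xy by auto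
        ultimately have "\<bar>g - 1\<bar> \<le> 4 * (?r n - 1)" using g(2) by simp
        then have "?p \<kappa> * \<bar>g - 1\<bar> \<le> ?p \<kappa> * (4 * (?r n - 1))" using p0 by (rule mult_left_mono)
        moreover have "\<bar>h n \<kappa> - ?p \<kappa>\<bar> = ?p \<kappa> * \<bar>g - 1\<bar>"
        proof -
          have "h n \<kappa> - ?p \<kappa> = ?p \<kappa> * (g - 1)" unfolding g(1) by (simp add: right_diff_distrib)
          then show ?thesis using p0 by (simp only: abs_mult abs_of_nonneg)
        qed
        ultimately show ?case using kS by (simp add: mult.commute)
      qed
      then have "(\<lambda>n. (if \<kappa> \<in> S n then h n \<kappa> else 0) - ?p \<kappa>) \<longlonglongrightarrow> 0"
        using lim0 by (rule Lim_null_comparison)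
      then show ?thesis using LIM_zero_cancel by force
    qed
  qed (auto simp: S_def intro!: prod_nonneg)
  moreover have "(\<Sum>\<xi> | \<xi> \<in> config_space L n \<and> (shallow L n (l n) \<xi> \<and> pair_gap L x y \<xi>).
      wt L \<alpha> \<xi> * tube_flow L \<alpha> n (V n) x y \<xi>) = (\<Sum>\<kappa>\<in>S n. h n \<kappa>)" for n
    unfolding sum_config_profile2[OF xy] I_def[symmetric] S_def h_def ..
  ultimately show ?thesis using I by simp
qed

section \<open>Capacities\<close>

text \<open>The walk has a deterministic path, so the potential is the indicator of the sites from
  which it meets \<open>x\<close> before \<open>y\<close>. It changes only across the edges leaving
  \<open>x\<close> and \<open>y\<close>, each contributing \<open>1 / L\<close> before the factor
  one half.\<close>

lemma rw_cap_eq: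
  assumes xy: "x < L" "y < L" "x \<noteq> y"
  shows "rw_cap L x y = 1 / real L"
proof -
  define U :: "nat \<Rightarrow> real" where
    "U z = (if z < L \<and> (if x < y then z \<le> x \<or> y < z else y < z \<and> z \<le> x) then 1 else 0)" for z
  let ?P = "\<lambda>V. (\<forall>z\<in>{x}. V z = 1) \<and> (\<forall>z\<in>{y}. V z = (0::real)) \<and>
      (\<forall>z\<in>{..<L} - ({x} \<union> {y}). rw_gen L V z = 0) \<and> (\<forall>z. z \<notin> {..<L} \<longrightarrow> V z = 0)"
  have md: "(z + 1) mod L = (if z + 1 = L then 0 else z + 1)" if "z < L" for z using that by auto
  have step: "U ((z + 1) mod L) - U z = 0" if "z < L" "z \<noteq> x" "z \<noteq> y" for z
    unfolding md[OF that(1)] using that xy by (auto simp: U_def)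
  have sx: "(U ((x + 1) mod L) - U x)\<^sup>2 = 1" unfolding md[OF xy(1)] using xy by (auto simp: U_def)
  have sy: "(U ((y + 1) mod L) - U y)\<^sup>2 = 1" unfolding md[OF xy(2)] using xy by (auto simp: U_def)
  have PU: "?P U" using xy step by (auto simp: rw_gen_def) (auto simp: U_def)
  have "V = U" if PV: "?P V" for V
  proof (rule ccontr)
    assume "V \<noteq> U"
    then obtain z where z: "V z \<noteq> U z" by blast
    then have zL: "z < L" using PV PU by (metis lessThan_iff)
    \<comment> \<open>A disagreement is carried forward along the orbit until it meets
      \<open>x\<close>, where both functions equal 1.\<close>
    have "V ((z + i) mod L) \<noteq> U ((z + i) mod L)" for i
    proof (induction i)
      case 0
      then show ?case using z zL by simp
    next
      case (Suc i)
      let ?w = "(z + i) mod L"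
      have w: "?w < L" using zL by simp
      have "?w \<noteq> x \<and> ?w \<noteq> y" using Suc PV PU by auto
      then have "rw_gen L V ?w = 0" "rw_gen L U ?w = 0" using PV PU w by auto
      moreover have "(?w + 1) mod L = (z + Suc i) mod L" by (simp add: mod_Suc_eq)
      ultimately show ?case using Suc by (simp add: rw_gen_def)
    qed
    from this[of "x + L - z"] show False using zL xy(1) PV PU by simp
  qed
  then have eq: "eq_pot {..<L} (rw_gen L) {x} {y} = U"
    unfolding eq_pot_def by (rule the_equality[where P = ?P, OF PU])
  have "(\<Sum>z<L. 1 / real L * (U ((z + 1) mod L) - U z)\<^sup>2) = (\<Sum>z\<in>{x, y}. 1 / real L * (U ((z + 1) mod L) - U z)\<^sup>2)"
    using xy step by (intro sum.mono_neutral_right) auto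
  also have "\<dots> = 2 / real L" using xy(3) by (simp add: sx[simplified] sy[simplified])
  finally show ?thesis unfolding rw_cap_def rw_dirichlet_def eq by simp
qed

lemma Zsum_asymp_Suc:
  assumes "\<alpha> > 0"
  shows "(\<lambda>n. real (Suc n) powr (2 * \<alpha> + 1) / Zsum \<alpha> n) \<longlonglongrightarrow> 1 / I_const \<alpha>"
proof -
  have "(\<lambda>n. (real (Suc n) / real n) powr (2 * \<alpha> + 1)) \<longlonglongrightarrow> 1 powr (2 * \<alpha> + 1)"
    by (intro tendsto_powr LIMSEQ_Suc_n_over_n tendsto_const) simp
  then have "(\<lambda>n. (real (Suc n) / real n) powr (2 * \<alpha> + 1) / (Zsum \<alpha> n / real n powr (2 * \<alpha> + 1))) \<longlonglongrightarrow> 1 powr (2 * \<alpha> + 1) / I_const \<alpha>"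
    using I_const_pos[OF assms] by (intro tendsto_divide Zsum_asymp assms) auto
  moreover have "eventually (\<lambda>n. (real (Suc n) / real n) powr (2 * \<alpha> + 1) / (Zsum \<alpha> n / real n powr (2 * \<alpha> + 1))
      = real (Suc n) powr (2 * \<alpha> + 1) / Zsum \<alpha> n) sequentially"
    using eventually_gt_at_top[of 0]
  proof eventually_elim
    case (elim n)
    then have "(real (Suc n) / real n) powr (2 * \<alpha> + 1) = real (Suc n) powr (2 * \<alpha> + 1) / real n powr (2 * \<alpha> + 1)"
      by (intro powr_divide)
    then show ?case using elim by simp
  qed
  ultimately show ?thesis using Lim_transform_eventually by fastforce
qed

text \<open>The value is at most of order \<open>(l n / n) powr (\<alpha> + 1)\<close>, so small
  wells make the test function accurate there.\<close>

lemma Hf_tendsto_0: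
  assumes "\<alpha> > 0" "(\<lambda>n. real (l n) / real (Suc n)) \<longlonglongrightarrow> 0"
  shows "(\<lambda>n. Hf \<alpha> n (l n)) \<longlonglongrightarrow> 0"
proof (rule tendsto_sandwich[OF _ _ tendsto_const])
  show "eventually (\<lambda>n. 0 \<le> Hf \<alpha> n (l n)) sequentially" by (simp add: Hf_nonneg)
  show "eventually (\<lambda>n. Hf \<alpha> n (l n) \<le> (real (l n) / real (Suc n)) powr (\<alpha> + 1) * (real (Suc n) powr (2 * \<alpha> + 1) / Zsum \<alpha> n)) sequentially"
  proof (rule always_eventually, rule allI)
    fix n
    have "real (Suc n) powr (2 * \<alpha> + 1) = real (Suc n) powr (\<alpha> + 1) * real (Suc n) powr \<alpha>"
      unfolding powr_add[symmetric] by (simp add: algebra_simps)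
    then have "(real (l n) / real (Suc n)) powr (\<alpha> + 1) * (real (Suc n) powr (2 * \<alpha> + 1) / Zsum \<alpha> n)
        = real (l n) powr (\<alpha> + 1) * real (Suc n) powr \<alpha> / Zsum \<alpha> n"
      by (simp add: powr_divide del: of_nat_Suc)
    then show "Hf \<alpha> n (l n) \<le> (real (l n) / real (Suc n)) powr (\<alpha> + 1) * (real (Suc n) powr (2 * \<alpha> + 1) / Zsum \<alpha> n)"
      using Hf_le[OF assms(1), of n "l n"] Zsum_pos[of \<alpha> n] by (simp add: le_divide_eq mult.commute del: of_nat_Suc)
  qed
  have "(\<lambda>n. (real (l n) / real (Suc n)) powr (\<alpha> + 1)) \<longlonglongrightarrow> 0 powr (\<alpha> + 1)"
    using assms by (intro tendsto_powr' tendsto_const) auto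
  then have "(\<lambda>n. (real (l n) / real (Suc n)) powr (\<alpha> + 1) * (real (Suc n) powr (2 * \<alpha> + 1) / Zsum \<alpha> n)) \<longlonglongrightarrow> 0 powr (\<alpha> + 1) * (1 / I_const \<alpha>)"
    by (intro tendsto_mult Zsum_asymp_Suc assms)
  then show "(\<lambda>n. (real (l n) / real (Suc n)) powr (\<alpha> + 1) * (real (Suc n) powr (2 * \<alpha> + 1) / Zsum \<alpha> n)) \<longlonglongrightarrow> 0"
    by simp
qed

lemma config_space_two_sites:
  assumes "\<eta> \<in> config_space L N" "x < L" "y < L" "x \<noteq> y"
  shows "\<eta> x + \<eta> y \<le> N"
proof -
  have "(\<Sum>z\<in>{x, y}. \<eta> z) \<le> (\<Sum>z<L. \<eta> z)" using assms by (intro sum_mono2) auto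
  then show ?thesis using assms config_spaceD(2)[OF assms(1)] by simp
qed

text \<open>Each of the \<open>card A * card B\<close> tubes contributes
  \<open>Gamma_const \<alpha> ^ (L - 2)\<close> to the limit of \<open>Zsum\<close> times
  \<open>zrp_W\<close> times the capacity; dividing by the asymptotics of the first two gives the
  constant. The index \<open>n\<close> stands for \<open>N - 1\<close>.\<close>

lemma zrp_cap_asymp:
  fixes L :: nat and \<alpha> :: real and ell :: "nat \<Rightarrow> nat" and A :: "nat set"
  assumes L: "L \<ge> 2" and \<alpha>: "\<alpha> > 3" and ell_pos: "\<forall>N. ell N > 0"
    and ell_top: "filterlim ell at_top sequentially"
    and ell_small: "(\<lambda>N. real (ell N) / real N) \<longlonglongrightarrow> 0"
    and A: "A \<subseteq> {..<L}" "A \<noteq> {}"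
  shows "(\<lambda>N. real N powr (1 + \<alpha>) * zrp_cap L \<alpha> N (wells L N ell A) (wells L N ell ({..<L} - A)))
    \<longlonglongrightarrow> 1 / (Gamma_const \<alpha> * I_const \<alpha>) * (real (card A) * (real L - real (card A)) / real L)"
proof -
  define B where "B = {..<L} - A"
  define l where "l n = ell (Suc n)" for n
  define WA WB where "WA n = wells L (Suc n) ell A" and "WB n = wells L (Suc n) ell B" for n
  \<comment> \<open>For the finitely many \<open>n\<close> at which the wells may overlap, the
    placeholder 0 keeps \<open>0 \<le> V \<le> 1\<close> valid for all \<open>n\<close>.\<close>
  define V where "V n = (if 2 * l n \<le> n then eq_pot (config_space L (Suc n)) (zrp_gen L \<alpha>) (WA n) (WB n) else (\<lambda>_. 0))" for n
  define F where "F n = test_fun L \<alpha> n A" for n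
  define Q where "Q n = (\<Sum>\<xi>\<in>config_space L n. wt L \<alpha> \<xi> * flow L (F n) (V n) \<xi>)" for n
  define cap where "cap n = zrp_cap L \<alpha> (Suc n) (WA n) (WB n)" for n
  define c where "c n = Zsum \<alpha> n * (zrp_W L \<alpha> (Suc n) * cap n)" for n
  define M where "M = real (card A) * real (card B) * Gamma_const \<alpha> ^ (L - 2)"
  have L0: "L > 0" using L by simp
  have l1: "l n \<ge> 1" for n using ell_pos[rule_format, of "Suc n"] by (simp add: l_def)
  have l_top: "filterlim l at_top sequentially"
    unfolding l_def using filterlim_compose[OF ell_top filterlim_Suc] by simp
  have l_small: "(\<lambda>n. real (l n) / real (Suc n)) \<longlonglongrightarrow> 0"
    unfolding l_def using LIMSEQ_Suc[OF ell_small] by simp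
  have good: "eventually (\<lambda>n. 2 * l n \<le> n) sequentially"
  proof -
    have "eventually (\<lambda>n. real (l n) / real (Suc n) < 1 / 4) sequentially"
      using l_small by (rule order_tendstoD) simp
    then show ?thesis
    proof eventually_elim
      case (elim n)
      then have "4 * real (l n) < real (Suc n)" by (simp add: field_simps)
      then have "4 * l n < Suc n" by linarith
      then show ?case by simp
    qed
  qed
  have well_iff: "\<eta> \<in> well L (Suc n) ell x \<longleftrightarrow> \<eta> \<in> config_space L (Suc n) \<and> \<eta> x \<ge> Suc n - l n" for \<eta> n x
    by (auto simp: well_def l_def)
  have sub: "WA n \<union> WB n \<subseteq> config_space L (Suc n)" for n
    by (auto simp: WA_def WB_def wells_def well_iff)
  have disj: "WA n \<inter> WB n = {}" if g: "2 * l n \<le> n" for n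
  proof (rule ccontr)
    assume "WA n \<inter> WB n \<noteq> {}"
    then obtain \<eta> x y where *: "x \<in> A" "y \<in> B" "\<eta> \<in> config_space L (Suc n)" "\<eta> x \<ge> Suc n - l n" "\<eta> y \<ge> Suc n - l n"
      unfolding WA_def WB_def wells_def by (auto simp: well_iff)
    then have "\<eta> x + \<eta> y \<le> Suc n" using A by (intro config_space_two_sites[of _ L]) (auto simp: B_def)
    then show False using * g by linarith
  qed
  have ne: "WA n \<noteq> {}" for n
  proof -
    obtain x where x: "x \<in> A" "x < L" using A by blast
    have "(\<lambda>z. 0)(x := Suc n) \<in> well L (Suc n) ell x"
      using x by (auto simp: well_iff config_space_single)
    then show ?thesis using x by (auto simp: WA_def wells_def)
  qed
  have V01: "0 \<le> V n \<eta> \<and> V n \<eta> \<le> 1" for n \<eta>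
    using eq_pot_zrp(4,5)[OF L0 ne sub disj] by (simp add: V_def)
  have Vwell: "V n \<eta> = (if x \<in> A then 1 else 0)"
    if g: "2 * l n \<le> n" and "\<eta> \<in> config_space L (Suc n)" "x < L" "\<eta> x \<ge> Suc n - l n" for n \<eta> x
  proof -
    have w: "\<eta> \<in> well L (Suc n) ell x" using that by (simp add: well_iff)
    show ?thesis
    proof (cases "x \<in> A")
      case True
      then have "\<eta> \<in> WA n" using w by (auto simp: WA_def wells_def)
      then show ?thesis using eq_pot_zrp(1)[OF L0 ne sub disj[OF g]] True g by (simp add: V_def)
    next
      case False
      then have "\<eta> \<in> WB n" using w that by (auto simp: WB_def B_def wells_def)
      then show ?thesis using eq_pot_zrp(2)[OF L0 ne sub disj[OF g]] False g by (simp add: V_def)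
    qed
  qed
  have Fwell: "\<bar>F n \<eta> - (if x \<in> A then 1 else 0)\<bar> \<le> Hf \<alpha> n (l n)"
    if g: "2 * l n \<le> n" and "x < L" and w: "\<eta> \<in> well L (Suc n) ell x" for n \<eta> x
  proof -
    have \<eta>: "\<eta> \<in> config_space L (Suc n)" "\<eta> x \<ge> Suc n - l n" using w by (auto simp: well_iff)
    have "\<eta> y < \<eta> x" if "y < L" "y \<noteq> x" for y
      using config_space_two_sites[OF \<eta>(1) that(1) \<open>x < L\<close> that(2)] \<eta>(2) g by linarith
    then have "\<bar>F n \<eta> - (if x \<in> A then 1 else 0)\<bar> \<le> Hf \<alpha> n (Suc n - \<eta> x)"
      unfolding F_def using \<eta> \<open>x < L\<close> A by (intro test_fun_near_max) auto
    also have "\<dots> \<le> Hf \<alpha> n (l n)" using \<eta>(2) by (intro Hf_mono) simp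
    finally show ?thesis .
  qed
  have compare: "\<bar>Zsum \<alpha> n * Q n - c n\<bar> \<le> 2 * Hf \<alpha> n (l n) * c n" if g: "2 * l n \<le> n" for n
  proof -
    have "\<bar>Q n - zrp_W L \<alpha> (Suc n) * cap n\<bar> \<le> 2 * Hf \<alpha> n (l n) * (zrp_W L \<alpha> (Suc n) * cap n)"
    proof -
      have FA: "\<bar>F n \<eta> - 1\<bar> \<le> Hf \<alpha> n (l n)" if \<eta>: "\<eta> \<in> WA n" for \<eta>
      proof -
        obtain x where "x \<in> A" "\<eta> \<in> well L (Suc n) ell x" using \<eta> by (auto simp: WA_def wells_def)
        then show ?thesis using Fwell[OF g, of x \<eta>] A by auto
      qed
      have FB: "\<bar>F n \<eta>\<bar> \<le> Hf \<alpha> n (l n)" if \<eta>: "\<eta> \<in> WB n" for \<eta>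
      proof -
        obtain y where "y \<in> B" "\<eta> \<in> well L (Suc n) ell y" using \<eta> by (auto simp: WB_def wells_def)
        then show ?thesis using Fwell[OF g, of y \<eta>] by (auto simp: B_def)
      qed
      show ?thesis
        using cap_flow_bound[where \<alpha> = \<alpha> and F = "F n" and \<epsilon> = "Hf \<alpha> n (l n)",
            OF L0 ne[of n] sub[of n] disj[OF g] FA FB] g by (simp add: Q_def V_def cap_def)
    qed
    then have "Zsum \<alpha> n * \<bar>Q n - zrp_W L \<alpha> (Suc n) * cap n\<bar> \<le> Zsum \<alpha> n * (2 * Hf \<alpha> n (l n) * (zrp_W L \<alpha> (Suc n) * cap n))"
      using Zsum_pos[of \<alpha> n] by (intro mult_left_mono) auto
    moreover have "\<bar>Zsum \<alpha> n * Q n - c n\<bar> = Zsum \<alpha> n * \<bar>Q n - zrp_W L \<alpha> (Suc n) * cap n\<bar>"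
    proof -
      have "Zsum \<alpha> n * Q n - c n = Zsum \<alpha> n * (Q n - zrp_W L \<alpha> (Suc n) * cap n)"
        by (simp add: c_def right_diff_distrib)
      then show ?thesis using Zsum_pos[of \<alpha> n] by (simp add: abs_mult)
    qed
    ultimately show ?thesis by (simp add: c_def mult_ac)
  qed
  have limQ: "(\<lambda>n. Zsum \<alpha> n * Q n) \<longlonglongrightarrow> M"
  proof -
    let ?T = "\<lambda>n. \<Sum>x\<in>A. \<Sum>y\<in>B. \<Sum>\<xi> | \<xi> \<in> config_space L n \<and> (shallow L n (l n) \<xi> \<and> pair_gap L x y \<xi>).
         wt L \<alpha> \<xi> * tube_flow L \<alpha> n (V n) x y \<xi>"
    let ?E = "\<lambda>n. real L * real (3 * L) powr (\<alpha> + 1) * (\<Sum>u<L. \<Sum>v<L. \<Sum>w<L. real (Suc n) powr \<alpha> *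
         (\<Sum>\<xi> | \<xi> \<in> config_space L n \<and> (shallow L n (l n) \<xi> \<and> near_tie L u v w \<xi>). wt L \<alpha> \<xi> * real (\<xi> v) powr (\<alpha> + 1)))"
    have "?E \<longlonglongrightarrow> real L * real (3 * L) powr (\<alpha> + 1) * (\<Sum>u<L. \<Sum>v<L. \<Sum>w<L. 0)"
      by (intro tendsto_mult tendsto_const tendsto_sum near_tie_sum_tendsto_0 \<alpha> l_top)
    then have E: "?E \<longlonglongrightarrow> 0" by simp
    have "?T \<longlonglongrightarrow> (\<Sum>x\<in>A. \<Sum>y\<in>B. Gamma_const \<alpha> ^ (L - 2))"
    proof (intro tendsto_sum tube_sum_tendsto l_top l1 good V01)
      fix x y assume xy: "x \<in> A" "y \<in> B"
      show "x < L" "y < L" "x \<noteq> y" using xy A by (auto simp: B_def)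
      show "\<alpha> > 1" using \<alpha> by simp
      show "eventually (\<lambda>n. \<forall>\<eta>\<in>config_space L (Suc n). \<eta> x \<ge> Suc n - l n \<longrightarrow> V n \<eta> = 1) sequentially"
        using good by eventually_elim (use Vwell xy \<open>x < L\<close> in auto)
      show "eventually (\<lambda>n. \<forall>\<eta>\<in>config_space L (Suc n). \<eta> y \<ge> Suc n - l n \<longrightarrow> V n \<eta> = 0) sequentially"
        using good by eventually_elim (use Vwell xy \<open>y < L\<close> in \<open>auto simp: B_def\<close>)
    qed
    then have T: "?T \<longlonglongrightarrow> M" by (simp add: M_def mult.assoc)
    have "eventually (\<lambda>n. norm (Zsum \<alpha> n * Q n - ?T n) \<le> ?E n) sequentially"
      using good
    proof eventually_elim
      case (elim n)
      show ?case
        unfolding Q_def F_def B_def real_norm_def using l1[of n] elim L A(1) \<alpha> V01[of n] Vwell[OF elim]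
        by (intro weighted_flow_decomposition) auto
    qed
    then have "(\<lambda>n. Zsum \<alpha> n * Q n - ?T n) \<longlonglongrightarrow> 0" using E by (rule Lim_null_comparison)
    from tendsto_add[OF this T] show ?thesis by simp
  qed
  have H0: "(\<lambda>n. Hf \<alpha> n (l n)) \<longlonglongrightarrow> 0" using \<alpha> l_small by (intro Hf_tendsto_0) auto
  have limc: "c \<longlonglongrightarrow> M"
  proof -
    \<comment> \<open>The error in \<open>compare\<close> is relative to the unknown
      \<open>c\<close> itself. Once \<open>Hf\<close> is below 1/4, it is at most
      \<open>\<bar>c n\<bar> / 2\<close>; this bounds \<open>c\<close> by twice the known quantity
      and makes the error relative to that quantity.\<close>
    have "eventually (\<lambda>n. Hf \<alpha> n (l n) < 1 / 4) sequentially"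
      using H0 by (rule order_tendstoD) simp
    then have "eventually (\<lambda>n. norm (c n - Zsum \<alpha> n * Q n) \<le> 4 * Hf \<alpha> n (l n) * \<bar>Zsum \<alpha> n * Q n\<bar>) sequentially"
      using good
    proof eventually_elim
      case (elim n)
      let ?h = "Hf \<alpha> n (l n)" and ?q = "Zsum \<alpha> n * Q n"
      have h0: "?h \<ge> 0" by (rule Hf_nonneg)
      have "2 * ?h * c n \<le> 2 * ?h * \<bar>c n\<bar>" using h0 by (intro mult_left_mono) auto
      then have 1: "\<bar>c n - ?q\<bar> \<le> 2 * ?h * \<bar>c n\<bar>" using compare[OF elim(2)] by (simp add: abs_minus_commute)
      also have "\<dots> \<le> 1 / 2 * \<bar>c n\<bar>" using elim(1) by (intro mult_right_mono) auto
      finally have "\<bar>c n\<bar> \<le> 2 * \<bar>?q\<bar>" by linarith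
      then have "2 * ?h * \<bar>c n\<bar> \<le> 2 * ?h * (2 * \<bar>?q\<bar>)" using h0 by (intro mult_left_mono) auto
      with 1 have "\<bar>c n - ?q\<bar> \<le> 2 * ?h * (2 * \<bar>?q\<bar>)" by (rule order_trans)
      then show ?case by simp
    qed
    moreover have "(\<lambda>n. 4 * Hf \<alpha> n (l n) * \<bar>Zsum \<alpha> n * Q n\<bar>) \<longlonglongrightarrow> 4 * 0 * \<bar>M\<bar>"
      by (intro tendsto_intros H0 limQ)
    then have "(\<lambda>n. 4 * Hf \<alpha> n (l n) * \<bar>Zsum \<alpha> n * Q n\<bar>) \<longlonglongrightarrow> 0" by simp
    ultimately have "(\<lambda>n. c n - Zsum \<alpha> n * Q n) \<longlonglongrightarrow> 0"
      by (rule Lim_null_comparison)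
    from tendsto_add[OF this limQ] show ?thesis by simp
  qed
  have G: "Gamma_const \<alpha> > 0" using \<alpha> by (intro Gamma_const_pos) simp
  have I: "I_const \<alpha> > 0" using \<alpha> by (intro I_const_pos) simp
  have limW: "(\<lambda>n. real (Suc n) powr \<alpha> * zrp_W L \<alpha> (Suc n)) \<longlonglongrightarrow> real L * Gamma_const \<alpha> ^ (L - 1)"
    using \<alpha> L0 by (intro LIMSEQ_Suc zrp_W_asymp) auto
  have "(\<lambda>n. c n / (real (Suc n) powr \<alpha> * zrp_W L \<alpha> (Suc n)) * (real (Suc n) powr (2 * \<alpha> + 1) / Zsum \<alpha> n))
     \<longlonglongrightarrow> M / (real L * Gamma_const \<alpha> ^ (L - 1)) * (1 / I_const \<alpha>)"
    using \<alpha> L0 G by (intro tendsto_mult tendsto_divide limc limW Zsum_asymp_Suc) auto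
  moreover have "c n / (real (Suc n) powr \<alpha> * zrp_W L \<alpha> (Suc n)) * (real (Suc n) powr (2 * \<alpha> + 1) / Zsum \<alpha> n)
      = real (Suc n) powr (1 + \<alpha>) * cap n" for n
  proof -
    have p: "real (Suc n) powr (2 * \<alpha> + 1) = real (Suc n) powr \<alpha> * real (Suc n) powr (1 + \<alpha>)"
      unfolding powr_add[symmetric] by (simp add: algebra_simps)
    show ?thesis unfolding c_def p using Zsum_pos[of \<alpha> n] zrp_W_pos[OF L0, of \<alpha> "Suc n"]
      by (simp del: of_nat_Suc)
  qed
  moreover have "M / (real L * Gamma_const \<alpha> ^ (L - 1)) * (1 / I_const \<alpha>)
      = 1 / (Gamma_const \<alpha> * I_const \<alpha>) * (real (card A) * (real L - real (card A)) / real L)"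
  proof -
    have "card A \<le> L" using A(1) card_mono[of "{..<L}" A] by simp
    then have B: "real (card B) = real L - real (card A)"
      unfolding B_def using A(1) by (simp add: card_Diff_subset finite_subset of_nat_diff)
    have "L - 1 = Suc (L - 2)" using L by simp
    then have "Gamma_const \<alpha> ^ (L - 1) = Gamma_const \<alpha> * Gamma_const \<alpha> ^ (L - 2)" by simp
    then show ?thesis unfolding M_def B using G I L0 by (simp add: field_simps)
  qed
  ultimately have "(\<lambda>n. real (Suc n) powr (1 + \<alpha>) * zrp_cap L \<alpha> (Suc n) (wells L (Suc n) ell A) (wells L (Suc n) ell ({..<L} - A)))
    \<longlonglongrightarrow> 1 / (Gamma_const \<alpha> * I_const \<alpha>) * (real (card A) * (real L - real (card A)) / real L)"
    unfolding cap_def WA_def WB_def B_def by (simp del: of_nat_Suc)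
  then show ?thesis by (rule LIMSEQ_imp_Suc)
qed

theorem theorem2p1:
  fixes L :: nat and \<alpha> :: real and ell :: "nat \<Rightarrow> nat" and A :: "nat set"
  assumes "L \<ge> 2" and "\<alpha> > 3"
    and "\<forall>N. ell N > 0"
    and "filterlim ell at_top sequentially"
    and "(\<lambda>N. real (ell N) / real N) \<longlonglongrightarrow> 0"
    and "A \<subseteq> {..<L}" and "A \<noteq> {}" and "A \<noteq> {..<L}"
  shows "((\<lambda>N. real N powr (1 + \<alpha>) *
            zrp_cap L \<alpha> N (wells L N ell A) (wells L N ell ({..<L} - A)))
          \<longlonglongrightarrow> 1 / (Gamma_const \<alpha> * I_const \<alpha>) * (\<Sum>x\<in>A. \<Sum>y\<in>{..<L} - A. rw_cap L x y))
     \<and> 1 / (Gamma_const \<alpha> * I_const \<alpha>) * (\<Sum>x\<in>A. \<Sum>y\<in>{..<L} - A. rw_cap L x y)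
          = 1 / (Gamma_const \<alpha> * I_const \<alpha>) * (real (card A) * (real L - real (card A)) / real L)"
proof -
  have "(\<Sum>x\<in>A. \<Sum>y\<in>{..<L} - A. rw_cap L x y) = (\<Sum>x\<in>A. \<Sum>y\<in>{..<L} - A. 1 / real L)"
    using assms(6) by (intro sum.cong refl rw_cap_eq) auto
  also have "\<dots> = real (card A) * real (card ({..<L} - A)) / real L" by simp
  also have "real (card ({..<L} - A)) = real L - real (card A)"
    using assms(6) card_mono[of "{..<L}" A] by (simp add: card_Diff_subset finite_subset of_nat_diff)
  finally show ?thesis
    using zrp_cap_asymp[OF assms(1-7)] by simp
qed

end
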